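(* Let $\xi = a_1\frac{\partial}{\partial x}+a_2\frac{\partial}{\partial y}$ be a vector field on $\mathbb{R}^2$ of class $C^1$ that is definable in an o-minimal expansion $\mathcal{R}$ of the real field. Then there is a ($C^1$-)cell decomposition $\mathcal{C}$ of $\mathbb{R}^2$ (definable in $\mathcal{R}$) compatible with $S(\xi)$ such that, with $\mathcal{C}_{\mathrm{reg}} := \{C\in\mathcal{C} : C\cap S(\xi)=\emptyset\}$: (1) every $1$-dimensional $C\in\mathcal{C}_{\mathrm{reg}}$ is either transverse to $\xi$ or tangent to $\xi$; (2) for every open $C\in\mathcal{C}_{\mathrm{reg}}$, every leaf of $\xi|_C$ is a Rolle leaf of $\xi|_C$; (3) for every open $C\in\mathcal{C}_{\mathrm{reg}}$, the relation $\ll_C$ on the set of all leaves of $\xi|_C$ is a (strict) linear ordering.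
   Context: $S(\xi)=\{z\in\mathbb{R}^2: a_1(z)=a_2(z)=0\}$ is the set of singularities of $\xi$, and $\xi^\perp := (a_2,-a_1)$. For an open set $U\subseteq\mathbb{R}^2$, a leaf of $\xi|_U$ is a leaf of the $1$-dimensional $C^1$-foliation of $U\setminus S(\xi)$ induced by $\xi$ (a maximal connected immersed integral curve of $\xi$ in $U\setminus S(\xi)$). A $C^1$-curve $\gamma$ is transverse (respectively tangent) to $\xi$ if $\xi^\perp(\gamma(t))\cdot\gamma'(t)\neq 0$ (respectively $=0$) for all $t$; a $1$-dimensional cell is transverse (tangent) to $\xi$ if a regular $C^1$-parametrization of it is. A leaf $L$ of $\xi|_U$ is a Rolle leaf of $\xi|_U$ if for every $C^1$-curve $\delta:[0,1]\to U$ with $\delta(0),\delta(1)\in L$ there is $t\in[0,1]$ such that $\delta'(t)$ is tangent to $\xi(\delta(t))$, i.e. $\xi^\perp(\delta(t))\cdot\delta'(t)=0$. Let $C\in\mathcal{C}_{\mathrm{reg}}$ be open and such that all leaves of $\xi|_C$ are Rolle leaves. For each leaf $L$ of $\xi|_C$ the set $C\setminus L$ has exactly two connected components $U_{L,1}$ and $U_{L,2}$, labelled so that $\xi^\perp(z)$ points into $U_{L,2}$ for all $z\in L$. For leaves $L,M$ of $\xi|_C$ define $L\ll_C M$ if and only if $L\subseteq U_{M,1}$. *)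

theory Defs
  imports "HOL-Analysis.Analysis"
begin

type_synonym plane = "real \<times> real"


section \<open>O-minimal expansions of the real field\<close>

text \<open>Cells of the real line, indexed by their dimension: points, and open intervals
  with endpoints in the extended reals.\<close>

inductive line_cell :: "nat \<Rightarrow> real set \<Rightarrow> bool" where
  point: "line_cell 0 {r}"
| interval: "a < b \<Longrightarrow> line_cell 1 {x. a < ereal x \<and> ereal x < b}"

text \<open>A structure on the reals is given by its definable sets, following van den Dries,
  ``Tame Topology and O-minimal Structures'': \<open>Def n\<close> is the collection of definable subsets of
  n-space, whose points are the lists of length \<open>n\<close>. Since every point and interval belongs to
  \<open>Def 1\<close>, these are the sets that are definable with parameters.\<close>

locale real_structure =
  fixes Def :: "nat \<Rightarrow> real list set set"
  assumes arity: "A \<in> Def n \<Longrightarrow> A \<subseteq> {xs. length xs = n}"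
    and whole_space: "{xs. length xs = n} \<in> Def n"
    and union: "A \<in> Def n \<Longrightarrow> B \<in> Def n \<Longrightarrow> A \<union> B \<in> Def n"
    and complement: "A \<in> Def n \<Longrightarrow> {xs. length xs = n} - A \<in> Def n"
    and cylinder_left: "A \<in> Def n \<Longrightarrow> {x # xs | x xs. xs \<in> A} \<in> Def (Suc n)"
    and cylinder_right: "A \<in> Def n \<Longrightarrow> {xs @ [x] | x xs. xs \<in> A} \<in> Def (Suc n)"
    and diagonal: "1 \<le> n \<Longrightarrow> {xs. length xs = n \<and> hd xs = last xs} \<in> Def n"
    and projection: "A \<in> Def (Suc n) \<Longrightarrow> butlast ` A \<in> Def n"

locale o_minimal_real_field = real_structure +
  assumes less: "{[x, y] | x y. x < y} \<in> Def 2"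
    and add: "{[x, y, x + y] | x y. True} \<in> Def 3"
    and mult: "{[x, y, x * y] | x y. True} \<in> Def 3"
    and o_minimal: "A \<in> Def 1 \<longleftrightarrow>
      (\<exists>\<B>. finite \<B> \<and> (\<forall>B\<in>\<B>. \<exists>d. line_cell d B) \<and> A = (\<lambda>x. [x]) ` \<Union>\<B>)"

definition definable_on_line :: "(nat \<Rightarrow> real list set set) \<Rightarrow> real set \<Rightarrow> (real \<Rightarrow> real) \<Rightarrow> bool"
  where "definable_on_line Def B f \<longleftrightarrow> {[x, f x] | x. x \<in> B} \<in> Def 2"

definition definable_on_plane :: "(nat \<Rightarrow> real list set set) \<Rightarrow> (plane \<Rightarrow> real) \<Rightarrow> bool"
  where "definable_on_plane Def f \<longleftrightarrow> {[x, y, f (x, y)] | x y. True} \<in> Def 3"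


section \<open>Planar cell decompositions of class C1\<close>

text \<open>When \<open>B\<close> is a point the differentiability requirement is no restriction, because only the
  values of \<open>f\<close> on \<open>B\<close> enter the definition of a cell.\<close>

definition definable_C1 :: "(nat \<Rightarrow> real list set set) \<Rightarrow> real set \<Rightarrow> (real \<Rightarrow> real) \<Rightarrow> bool"
  where "definable_C1 Def B f \<longleftrightarrow> definable_on_line Def B f \<and> f C1_differentiable_on B"

definition cell_bound :: "(nat \<Rightarrow> real list set set) \<Rightarrow> real set \<Rightarrow> (real \<Rightarrow> ereal) \<Rightarrow> bool"
  where "cell_bound Def B f \<longleftrightarrow>
    (\<forall>x\<in>B. f x = - \<infinity>) \<or> (\<forall>x\<in>B. f x = \<infinity>) \<or>
    (\<exists>g. definable_C1 Def B g \<and> (\<forall>x\<in>B. f x = ereal (g x)))"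

text \<open>\<open>plane_cell Def d C\<close>: the set \<open>C\<close> is a definable C1 cell of dimension \<open>d\<close> in the plane.\<close>

inductive plane_cell :: "(nat \<Rightarrow> real list set set) \<Rightarrow> nat \<Rightarrow> plane set \<Rightarrow> bool"
  for Def :: "nat \<Rightarrow> real list set set" where
  graph: "line_cell d B \<Longrightarrow> definable_C1 Def B f \<Longrightarrow>
    plane_cell Def d {(x, f x) | x. x \<in> B}"
| band: "line_cell d B \<Longrightarrow> cell_bound Def B f \<Longrightarrow> cell_bound Def B g \<Longrightarrow>
    (\<forall>x\<in>B. f x < g x) \<Longrightarrow>
    plane_cell Def (Suc d) {(x, y) | x y. x \<in> B \<and> f x < ereal y \<and> ereal y < g x}"

definition line_decomposition :: "real set set \<Rightarrow> bool"
  where "line_decomposition \<B> \<longleftrightarrow>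
    finite \<B> \<and> partition_on UNIV \<B> \<and> (\<forall>B\<in>\<B>. \<exists>d. line_cell d B)"

definition plane_decomposition :: "(nat \<Rightarrow> real list set set) \<Rightarrow> plane set set \<Rightarrow> bool"
  where "plane_decomposition Def \<C> \<longleftrightarrow>
    finite \<C> \<and> partition_on UNIV \<C> \<and> (\<forall>C\<in>\<C>. \<exists>d. plane_cell Def d C) \<and>
    line_decomposition ((`) fst ` \<C>)"

definition compatible :: "'a set set \<Rightarrow> 'a set \<Rightarrow> bool"
  where "compatible \<C> A \<longleftrightarrow> (\<forall>C\<in>\<C>. C \<subseteq> A \<or> C \<inter> A = {})"


section \<open>Vector fields, leaves and Rolle leaves\<close>

definition C1_on :: "'a::real_normed_vector set \<Rightarrow> ('a \<Rightarrow> 'b::real_normed_vector) \<Rightarrow> bool"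
  where "C1_on U f \<longleftrightarrow> (\<exists>f' :: 'a \<Rightarrow> 'a \<Rightarrow>\<^sub>L 'b.
    (\<forall>z\<in>U. (f has_derivative blinfun_apply (f' z)) (at z)) \<and> continuous_on U f')"

definition sing :: "(plane \<Rightarrow> plane) \<Rightarrow> plane set"
  where "sing \<xi> = {z. fst (\<xi> z) = 0 \<and> snd (\<xi> z) = 0}"

definition perp :: "(plane \<Rightarrow> plane) \<Rightarrow> plane \<Rightarrow> plane"
  where "perp \<xi> z = (snd (\<xi> z), - fst (\<xi> z))"

definition regular_param :: "real set \<Rightarrow> (real \<Rightarrow> plane) \<Rightarrow> (real \<Rightarrow> plane) \<Rightarrow> plane set \<Rightarrow> bool"
  where "regular_param I \<gamma> \<gamma>' C \<longleftrightarrow>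
    open I \<and> is_interval I \<and> bij_betw \<gamma> I C \<and>
    (\<forall>t\<in>I. (\<gamma> has_vector_derivative \<gamma>' t) (at t) \<and> \<gamma>' t \<noteq> 0) \<and> continuous_on I \<gamma>'"

definition transverse_cell :: "(plane \<Rightarrow> plane) \<Rightarrow> plane set \<Rightarrow> bool"
  where "transverse_cell \<xi> C \<longleftrightarrow>
    (\<exists>I \<gamma> \<gamma>'. regular_param I \<gamma> \<gamma>' C \<and> (\<forall>t\<in>I. perp \<xi> (\<gamma> t) \<bullet> \<gamma>' t \<noteq> 0))"

definition tangent_cell :: "(plane \<Rightarrow> plane) \<Rightarrow> plane set \<Rightarrow> bool"
  where "tangent_cell \<xi> C \<longleftrightarrow>
    (\<exists>I \<gamma> \<gamma>'. regular_param I \<gamma> \<gamma>' C \<and> (\<forall>t\<in>I. perp \<xi> (\<gamma> t) \<bullet> \<gamma>' t = 0))"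

text \<open>An integral curve, taken as a set of points. It is connected because the parameter ranges
  over an interval, and immersed because \<open>\<xi>\<close> does not vanish on it.\<close>

definition integral_curve :: "(plane \<Rightarrow> plane) \<Rightarrow> plane set \<Rightarrow> plane set \<Rightarrow> bool"
  where "integral_curve \<xi> U L \<longleftrightarrow>
    (\<exists>I \<gamma>. open I \<and> is_interval I \<and> I \<noteq> {} \<and> L = \<gamma> ` I \<and>
      (\<forall>t\<in>I. \<gamma> t \<in> U - sing \<xi> \<and> (\<gamma> has_vector_derivative \<xi> (\<gamma> t)) (at t)))"

definition leaves :: "(plane \<Rightarrow> plane) \<Rightarrow> plane set \<Rightarrow> plane set set"
  where "leaves \<xi> U =
    {L. integral_curve \<xi> U L \<and> (\<forall>M. integral_curve \<xi> U M \<and> L \<subseteq> M \<longrightarrow> M = L)}"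

definition rolle_leaf :: "(plane \<Rightarrow> plane) \<Rightarrow> plane set \<Rightarrow> plane set \<Rightarrow> bool"
  where "rolle_leaf \<xi> U L \<longleftrightarrow> L \<in> leaves \<xi> U \<and>
    (\<forall>\<delta> \<delta>'. (\<forall>t\<in>{0..1}. (\<delta> has_vector_derivative \<delta>' t) (at t within {0..1})) \<and>
        continuous_on {0..1} \<delta>' \<and> \<delta> ` {0..1} \<subseteq> U \<and> \<delta> 0 \<in> L \<and> \<delta> 1 \<in> L \<longrightarrow>
      (\<exists>t\<in>{0..1}. perp \<xi> (\<delta> t) \<bullet> \<delta>' t = 0))"


section \<open>The ordering of the leaves\<close>

definition points_into :: "plane \<Rightarrow> plane \<Rightarrow> plane set \<Rightarrow> bool"
  where "points_into z v U \<longleftrightarrow> (\<exists>\<epsilon>>0. \<forall>s. 0 < s \<and> s < \<epsilon> \<longrightarrow> z + s *\<^sub>R v \<in> U)"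

definition leaf_sides :: "(plane \<Rightarrow> plane) \<Rightarrow> plane set \<Rightarrow> plane set \<Rightarrow> plane set \<Rightarrow> plane set \<Rightarrow> bool"
  where "leaf_sides \<xi> C L U1 U2 \<longleftrightarrow>
    components (C - L) = {U1, U2} \<and> U1 \<noteq> U2 \<and> (\<forall>z\<in>L. points_into z (perp \<xi> z) U2)"

text \<open>The components are determined by \<open>leaf_sides\<close>, so the existential quantifier only names
  them. A leaf \<open>M\<close> without two such sides would not be above any leaf.\<close>

definition leaf_less :: "(plane \<Rightarrow> plane) \<Rightarrow> plane set \<Rightarrow> (plane set \<times> plane set) set"
  where "leaf_less \<xi> C = {(L, M). L \<in> leaves \<xi> C \<and> M \<in> leaves \<xi> C \<and>
    (\<exists>U1 U2. leaf_sides \<xi> C M U1 U2 \<and> L \<subseteq> U1)}"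

end

theory Submission
  imports Defs
begin

text \<open>The plane is cut so that the signs of \<open>a\<^sub>1\<close> and \<open>a\<^sub>2\<close> are constant on every cell and the sign of
  \<open>a\<^sub>2 - \<phi>' a\<^sub>1\<close> is constant on, just above and just below every bounding graph \<open>y = \<phi> x\<close>. On an open
  regular cell with \<open>a\<^sub>1 > 0\<close> a leaf is the graph of a solution of \<open>dy/dx = a\<^sub>2 / a\<^sub>1\<close> over an open
  interval; it leaves every compact subset of the cell, so it tends to a bounding function wherever it
  ends inside the base. Extended by that bounding function, it separates the cell into the part above
  and the part below, and a curve crossing it transversally cannot return: leaves are Rolle leaves. The
  sign condition at the bounding graphs excludes that one leaf ends at a bounding graph and another one
  starts there; consequently the extended functions of any two leaves are comparable, and pointwise
  comparison of these functions is the ordering of the leaves.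

  As the underlying field is the field of real numbers, o-minimality can be combined with
  countability: an interval covered by countably many definable sets contains a subinterval lying in
  one of them. This replaces the monotonicity theorem and shortens the proof of uniform finiteness.\<close>

section \<open>Definability by formulas\<close>

text \<open>The obstacle is comparability of leaves. Suppose the field points to the right, a leaf
  \<open>M\<close> ends at the lower boundary of a cell, and a leaf \<open>L\<close> starts at that
  boundary further right. Then each of them lies above the extended function of the other, so each
  would be smaller than the other. This is why the direction in which the field crosses the vertical
  translates of a boundary graph has to be the same along the whole base. The expression
  \<open>a2 - \<phi>' a1\<close> is \<open>a1\<close> times the derivative of the height of a leaf
  over the graph of \<open>\<phi>\<close>, so a constant sign makes this height monotone. At an
  infinite boundary the exponential of plus or minus the height replaces it, and the sign of
  \<open>a2\<close> is enough. Along a leaf the abscissa and the height vary together, so a sign for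
  small heights on each single vertical line does not suffice: it has to hold on a one-sided
  neighbourhood of every boundary point. Hence germs of definable families must be made locally
  uniform, which costs finitely many abscissas.\<close>

context real_structure begin

text \<open>The free variables of a formula are the values of an environment at the numbers below \<open>n\<close>, so
  that a quantifier binds the fresh variable with number \<open>n\<close>.\<close>

definition def_pred :: "nat \<Rightarrow> ((nat \<Rightarrow> real) \<Rightarrow> bool) \<Rightarrow> bool"
  where "def_pred n P \<longleftrightarrow> (\<exists>A\<in>Def n. \<forall>v. P v \<longleftrightarrow> map v [0..<n] \<in> A)"

text \<open>The graph condition is stated for every \<open>y\<close>, not only for
  \<open>y = v n\<close>. This forces \<open>t\<close> to read no value of the environment from
  position \<open>n\<close> on (see \<open>def_term_local\<close>), so locality is built into the
  definition.\<close>

definition def_term :: "nat \<Rightarrow> ((nat \<Rightarrow> real) \<Rightarrow> real) \<Rightarrow> bool"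
  where "def_term n t \<longleftrightarrow> (\<exists>A\<in>Def (Suc n). \<forall>v y. t v = y \<longleftrightarrow> map v [0..<n] @ [y] \<in> A)"

lemma inter: "A \<in> Def n \<Longrightarrow> B \<in> Def n \<Longrightarrow> A \<inter> B \<in> Def n"
proof -
  assume A: "A \<in> Def n" "B \<in> Def n"
  let ?U = "{xs::real list. length xs = n}"
  have "A \<inter> B = ?U - ((?U - A) \<union> (?U - B))"
    using arity[OF A(1)] arity[OF A(2)] by auto
  then show ?thesis using A complement union by metis
qed

lemma def_predE:
  assumes "def_pred n P"
  obtains A where "A \<in> Def n" "\<And>v. P v \<longleftrightarrow> map v [0..<n] \<in> A"
  using assms unfolding def_pred_def by (elim bexE) (rule that, auto)

lemma def_termE:
  assumes "def_term n t"
  obtains A where "A \<in> Def (Suc n)" "\<And>v y. t v = y \<longleftrightarrow> map v [0..<n] @ [y] \<in> A"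
  using assms unfolding def_term_def by (elim bexE) (rule that, auto)

lemma def_pred_not:
  assumes "def_pred n P" shows "def_pred n (\<lambda>v. \<not> P v)"
proof -
  from assms obtain A where A: "A \<in> Def n" "\<And>v. P v \<longleftrightarrow> map v [0..<n] \<in> A" by (rule def_predE) (rule that)
  show ?thesis unfolding def_pred_def by (rule bexI[OF _ complement[OF A(1)]]) (simp add: A(2))
qed

lemma def_pred_conj:
  assumes "def_pred n P" "def_pred n Q" shows "def_pred n (\<lambda>v. P v \<and> Q v)"
proof -
  from assms(1) obtain A where A: "A \<in> Def n" "\<And>v. P v \<longleftrightarrow> map v [0..<n] \<in> A" by (rule def_predE) (rule that)
  from assms(2) obtain B where B: "B \<in> Def n" "\<And>v. Q v \<longleftrightarrow> map v [0..<n] \<in> B" by (rule def_predE) (rule that)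
  show ?thesis unfolding def_pred_def by (rule bexI[OF _ inter[OF A(1) B(1)]]) (simp add: A(2) B(2))
qed

lemma def_pred_disj: "def_pred n P \<Longrightarrow> def_pred n Q \<Longrightarrow> def_pred n (\<lambda>v. P v \<or> Q v)"
  using def_pred_not[OF def_pred_conj[OF def_pred_not def_pred_not], of n P Q] by simp

lemma def_pred_imp: "def_pred n P \<Longrightarrow> def_pred n Q \<Longrightarrow> def_pred n (\<lambda>v. P v \<longrightarrow> Q v)"
  using def_pred_disj[OF def_pred_not, of n P Q] by simp

lemma def_pred_True: "def_pred n (\<lambda>v. True)"
  unfolding def_pred_def by (rule bexI[OF _ whole_space]) auto

lemma def_pred_const: "def_pred n (\<lambda>v. b)"
  using def_pred_True[of n] def_pred_not[OF def_pred_True, of n] by (cases b) auto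

text \<open>\<open>butlast\<close> projects along the last coordinate, so the bound variable is the
  one numbered \<open>n\<close>. Its value is handed to \<open>Q\<close> as a separate argument;
  thus the rule matches an ordinary quantifier by unification, and \<open>indep\<close> says that
  the rest of the formula does not read position \<open>n\<close>.\<close>

lemma def_pred_ex:
  assumes indep: "\<And>v y. Q (v(n := y)) y = Q v y" and Q: "def_pred (Suc n) (\<lambda>v. Q v (v n))"
  shows "def_pred n (\<lambda>v. \<exists>y. Q v y)"
proof -
  obtain A where A: "A \<in> Def (Suc n)" "\<And>v. Q v (v n) \<longleftrightarrow> map v [0..<Suc n] \<in> A"
    using Q by (rule def_predE) (rule that)
  have eq: "map (v(n := y)) [0..<Suc n] = map v [0..<n] @ [y]" for v :: "nat \<Rightarrow> real" and y
    by simp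
  have "(\<exists>y. Q v y) \<longleftrightarrow> map v [0..<n] \<in> butlast ` A" for v
  proof
    assume "\<exists>y. Q v y"
    then obtain y where "Q (v(n := y)) ((v(n := y)) n)" using indep by auto
    then have "map v [0..<n] @ [y] \<in> A" unfolding A(2) eq .
    then show "map v [0..<n] \<in> butlast ` A" by (metis butlast_snoc imageI)
  next
    assume "map v [0..<n] \<in> butlast ` A"
    then obtain xs where xs: "xs \<in> A" "map v [0..<n] = butlast xs" by auto
    then have "xs \<noteq> []" using arity[OF A(1)] by auto
    then have "xs = map v [0..<n] @ [last xs]" using xs(2) by simp
    then have "map (v(n := last xs)) [0..<Suc n] \<in> A" using xs(1) eq by simp
    then have "Q (v(n := last xs)) (last xs)" using A(2)[of "v(n := last xs)"] by simp
    then show "\<exists>y. Q v y" using indep by auto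
  qed
  then show ?thesis unfolding def_pred_def by (intro bexI[OF _ projection[OF A(1)]]) simp
qed

lemma def_pred_all:
  assumes "\<And>v y. Q (v(n := y)) y = Q v y" and "def_pred (Suc n) (\<lambda>v. Q v (v n))"
  shows "def_pred n (\<lambda>v. \<forall>y. Q v y)"
  using def_pred_not[OF def_pred_ex[where Q = "\<lambda>v y. \<not> Q v y"]] def_pred_not assms by auto

lemma def_pred_weaken_Suc: "def_pred n P \<Longrightarrow> def_pred (Suc n) P"
proof -
  assume "def_pred n P"
  then obtain A where A: "A \<in> Def n" "\<And>v. P v \<longleftrightarrow> map v [0..<n] \<in> A"
    by (rule def_predE) (rule that)
  have "P v \<longleftrightarrow> map v [0..<Suc n] \<in> {xs @ [x] | x xs. xs \<in> A}" for v
    using A(2) by auto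
  then show ?thesis unfolding def_pred_def by (intro bexI[OF _ cylinder_right[OF A(1)]]) simp
qed

lemma def_pred_weaken: "def_pred n P \<Longrightarrow> n \<le> m \<Longrightarrow> def_pred m P"
  by (induction m) (auto simp: le_Suc_eq intro: def_pred_weaken_Suc)

text \<open>A left cylinder prepends one coordinate, which raises every variable number by one;
  \<open>n\<close> such steps free the first \<open>n\<close> positions.\<close>

lemma def_pred_shift: "def_pred k P \<Longrightarrow> def_pred (n + k) (\<lambda>v. P (\<lambda>i. v (n + i)))"
proof (induction n)
  case (Suc n)
  then obtain A where A: "A \<in> Def (n + k)" "\<And>v. P (\<lambda>i. v (n + i)) \<longleftrightarrow> map v [0..<n + k] \<in> A"
    using Suc.IH[OF Suc.prems] by (elim def_predE) (rule that)
  have "P (\<lambda>i. v (Suc n + i)) \<longleftrightarrow> map v [0..<Suc (n + k)] \<in> {x # xs | x xs. xs \<in> A}" for v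
  proof -
    have "map v [0..<Suc (n + k)] = v 0 # map (\<lambda>i. v (Suc i)) [0..<n + k]"
      by (rule nth_equalityI) (auto simp: nth_Cons' simp del: upt_Suc)
    then show ?thesis using A(2)[of "\<lambda>i. v (Suc i)"] by simp
  qed
  then show ?case unfolding def_pred_def add_Suc by (intro bexI[OF _ cylinder_left[OF A(1)]]) simp
qed simp

text \<open>The axiom \<open>diagonal\<close> equates only the first and the last coordinate. It is
  applied to the block of variables from \<open>i\<close> to \<open>j\<close>, which has length
  \<open>j - i + 1\<close>, and the result is shifted by \<open>i\<close>.\<close>

lemma def_pred_eq_less:
  assumes "i < j"
  shows "def_pred (Suc j) (\<lambda>v. v i = v j)"
proof -
  let ?m = "Suc (j - i)"
  have *: "def_pred ?m (\<lambda>v. v (0::nat) = v (j - i))"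
    unfolding def_pred_def
  proof (rule bexI[OF _ diagonal[of ?m]], intro allI)
    fix v :: "nat \<Rightarrow> real"
    have "hd (map v [0..<?m]) = v 0" by (simp add: hd_map del: upt_Suc)
    moreover have "last (map v [0..<?m]) = v (j - i)" by simp
    moreover have "length (map v [0..<?m]) = ?m" by simp
    ultimately show "(v 0 = v (j - i)) = (map v [0..<?m] \<in> {xs. length xs = ?m \<and> hd xs = last xs})"
      unfolding mem_Collect_eq by argo
  qed simp
  have 1: "i + ?m = Suc j" using assms by arith
  have 2: "i + (j - i) = j" using assms by arith
  from def_pred_shift[OF *, of i] show ?thesis unfolding 1 2 add_0_right .
qed

lemma def_pred_eq_var:
  assumes "i < n" "j < n"
  shows "def_pred n (\<lambda>v. v i = v j)"
proof -
  consider "i < j" | "i = j" | "j < i" by linarith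
  then show ?thesis
  proof cases
    case 1
    then show ?thesis using def_pred_weaken[OF def_pred_eq_less[of i j], of n] assms by simp
  next
    case 2
    then show ?thesis using def_pred_True by simp
  next
    case 3
    then have "def_pred n (\<lambda>v. v j = v i)" using def_pred_weaken[OF def_pred_eq_less[of j i], of n] assms by simp
    moreover have "(\<lambda>v::nat \<Rightarrow> real. v i = v j) = (\<lambda>v. v j = v i)" by (rule ext) (rule eq_commute)
    ultimately show ?thesis by (simp only:)
  qed
qed

lemma def_pred_ball: "(\<And>i::nat. i < k \<Longrightarrow> def_pred n (P i)) \<Longrightarrow> def_pred n (\<lambda>v. \<forall>i<k. P i v)"
  by (induction k) (simp_all add: All_less_Suc def_pred_const def_pred_conj)

text \<open>The bound values are packed into one function \<open>w\<close>, of which only the first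
  \<open>k\<close> values are read; this avoids tuples whose length depends on
  \<open>k\<close>.\<close>

lemma def_pred_exs:
  assumes "def_pred (n + k) P"
  shows "def_pred n (\<lambda>v. \<exists>w. P (\<lambda>i. if n \<le> i \<and> i < n + k then w (i - n) else v i))"
  using assms
proof (induction k arbitrary: P)
  case 0
  then show ?case by (simp add: not_le[symmetric] cong: if_cong)
next
  case (Suc k)
  let ?Q = "\<lambda>v y. P (v(n + k := y))"
  have "def_pred (n + k) (\<lambda>v. \<exists>y. P (v(n + k := y)))"
    by (rule def_pred_ex) (use Suc.prems in auto)
  from Suc.IH[OF this]
  have *: "def_pred n (\<lambda>v. \<exists>w y. P ((\<lambda>i. if n \<le> i \<and> i < n + k then w (i - n) else v i)(n + k := y)))" .
  have "(\<exists>w y. P ((\<lambda>i. if n \<le> i \<and> i < n + k then w (i - n) else v i)(n + k := y)))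
     \<longleftrightarrow> (\<exists>w. P (\<lambda>i. if n \<le> i \<and> i < n + Suc k then w (i - n) else v i))" (is "?l \<longleftrightarrow> ?r") for v
  proof
    assume ?l
    then obtain w y where "P ((\<lambda>i. if n \<le> i \<and> i < n + k then w (i - n) else v i)(n + k := y))" by blast
    moreover have "(\<lambda>i. if n \<le> i \<and> i < n + k then w (i - n) else v i)(n + k := y)
      = (\<lambda>i. if n \<le> i \<and> i < n + Suc k then (w(k := y)) (i - n) else v i)"
      by (rule ext, rename_tac i, case_tac "i = n + k") (simp_all add: less_Suc_eq, arith)
    ultimately show ?r by (intro exI[of _ "w(k := y)"]) (simp only:)
  next
    assume ?r
    then obtain w where w: "P (\<lambda>i. if n \<le> i \<and> i < n + Suc k then w (i - n) else v i)" by blast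
    have "(\<lambda>i. if n \<le> i \<and> i < n + k then w (i - n) else v i)(n + k := w k)
      = (\<lambda>i. if n \<le> i \<and> i < n + Suc k then w (i - n) else v i)"
      by (rule ext, rename_tac i, case_tac "i = n + k") (simp_all add: less_Suc_eq)
    with w show ?l by (intro exI[of _ w] exI[of _ "w k"]) (simp only:)
  qed
  with * show ?case by simp
qed

lemma def_pred_local:
  assumes "def_pred n P" "\<And>i. i < n \<Longrightarrow> v i = w i"
  shows "P v = P w"
proof -
  from assms(1) obtain A where A: "A \<in> Def n" "\<And>v. P v \<longleftrightarrow> map v [0..<n] \<in> A"
    by (rule def_predE) (rule that)
  have "map v [0..<n] = map w [0..<n]" using assms(2) by simp
  then show ?thesis unfolding A(2) by (simp only:)
qed

text \<open>Permuting, repeating and dropping coordinates are all obtained in one way: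
  \<open>k\<close> fresh variables are required to satisfy \<open>P\<close>, they are equated with
  the chosen old ones, and the fresh ones are projected away.\<close>

lemma def_pred_reindex:
  assumes P: "def_pred k P" and \<sigma>: "\<And>i. i < k \<Longrightarrow> \<sigma> i < n"
  shows "def_pred n (\<lambda>v. P (\<lambda>i. v (\<sigma> i)))"
proof -
  have "def_pred (n + k) (\<lambda>v. P (\<lambda>i. v (n + i)) \<and> (\<forall>i<k. v (\<sigma> i) = v (n + i)))"
    by (intro def_pred_conj def_pred_shift[OF P] def_pred_ball def_pred_eq_var) (auto dest: \<sigma>)
  from def_pred_exs[OF this]
  have *: "def_pred n (\<lambda>v. \<exists>w. P (\<lambda>i. if i < k then w i else v (n + i)) \<and> (\<forall>i<k. v (\<sigma> i) = w i))"
    using \<sigma> by (simp add: not_le[symmetric] cong: if_cong)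
  have "(\<exists>w. P (\<lambda>i. if i < k then w i else v (n + i)) \<and> (\<forall>i<k. v (\<sigma> i) = w i)) \<longleftrightarrow> P (\<lambda>i. v (\<sigma> i))"
    for v
  proof -
    have "P (\<lambda>i. if i < k then w i else v (n + i)) = P (\<lambda>i. v (\<sigma> i))" if "\<forall>i<k. v (\<sigma> i) = w i" for w
      by (rule def_pred_local[OF P]) (use that in auto)
    then show ?thesis by (auto intro!: exI[of _ "\<lambda>i. v (\<sigma> i)"])
  qed
  with * show ?thesis by simp
qed

lemma def_term_local: "def_term n t \<Longrightarrow> t (v(n := y)) = t v"
proof -
  assume "def_term n t"
  then obtain A where A: "\<And>v y. t v = y \<longleftrightarrow> map v [0..<n] @ [y] \<in> A" by (rule def_termE) (rule that)
  have "map (v(n := y)) [0..<n] = map v [0..<n]" by simp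
  then show ?thesis using A by metis
qed

lemma def_term_dp: "def_term n t \<Longrightarrow> def_pred (Suc n) (\<lambda>v. t v = v n)"
  by (elim def_termE) (auto simp: def_pred_def)

lemma def_term_I:
  assumes "\<And>v y. t (v(n := y)) = t v" "def_pred (Suc n) (\<lambda>v. t v = v n)"
  shows "def_term n t"
proof -
  obtain A where A: "A \<in> Def (Suc n)" "\<And>v. t v = v n \<longleftrightarrow> map v [0..<Suc n] \<in> A"
    using assms(2) by (rule def_predE) (rule that)
  have "t v = y \<longleftrightarrow> map v [0..<n] @ [y] \<in> A" for v y
    using A(2)[of "v(n := y)"] assms(1) by simp
  then show ?thesis unfolding def_term_def by (intro bexI[OF _ A(1)]) simp
qed

text \<open>Substitution of a term is the formula \<open>\<exists>y. t v = y \<and> Q v y\<close>,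
  so it reduces to the quantifier rule.\<close>

lemma def_pred_term:
  assumes t: "def_term n t" and Q: "\<And>v y z. Q (v(n := y)) z = Q v z" "def_pred (Suc n) (\<lambda>v. Q v (v n))"
  shows "def_pred n (\<lambda>v. Q v (t v))"
proof -
  have "def_pred n (\<lambda>v. \<exists>y. t v = y \<and> Q v y)"
    by (intro def_pred_ex def_pred_conj def_term_dp t Q(2)) (simp add: def_term_local[OF t] Q(1))
  then show ?thesis by simp
qed

lemma def_term_var: "i < n \<Longrightarrow> def_term n (\<lambda>v. v i)"
  by (rule def_term_I) (auto intro: def_pred_eq_var)

lemma def_term_Suc: 
  assumes t: "def_term n t" shows "def_term (Suc n) t"
proof -
  obtain A where A: "A \<in> Def (Suc n)" "\<And>v y. t v = y \<longleftrightarrow> map v [0..<n] @ [y] \<in> A"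
    using t by (rule def_termE) (rule that)
  have "t (v(Suc n := y)) = t v" for v y
  proof -
    have "map (v(Suc n := y)) [0..<n] = map v [0..<n]" by simp
    then show ?thesis using A(2) by metis
  qed
  moreover have "def_pred (Suc (Suc n)) (\<lambda>v. t v = v (Suc n))"
  proof -
    have "def_pred (Suc (Suc n)) (\<lambda>v. t (\<lambda>i. v (if i = n then Suc n else i)) = v (if n = n then Suc n else n))"
      by (rule def_pred_reindex[OF def_term_dp[OF t], where \<sigma> = "\<lambda>i. if i = n then Suc n else i"]) auto
    moreover have "t (\<lambda>i. v (if i = n then Suc n else i)) = t v" for v
    proof -
      have "map (\<lambda>i. v (if i = n then Suc n else i)) [0..<n] = map v [0..<n]" by simp
      then show ?thesis using A(2) by metis
    qed
    ultimately show ?thesis by simp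
  qed
  ultimately show ?thesis by (rule def_term_I)
qed

lemma def_pred_app1:
  assumes R: "def_pred 1 (\<lambda>v. R (v 0))" and s: "def_term n s"
  shows "def_pred n (\<lambda>v. R (s v))"
  by (rule def_pred_term[OF s]) (use def_pred_reindex[OF R, of "\<lambda>_. n" "Suc n"] in simp_all)

lemma def_pred_app2:
  assumes R: "def_pred 2 (\<lambda>v. R (v 0) (v 1))" and s: "def_term n s" and t: "def_term n t"
  shows "def_pred n (\<lambda>v. R (s v) (t v))"
proof (rule def_pred_term[OF s])
  show "def_pred (Suc n) (\<lambda>v. R (v n) (t v))"
  proof (rule def_pred_term[OF def_term_Suc[OF t]])
    show "def_pred (Suc (Suc n)) (\<lambda>v. R (v n) (v (Suc n)))"
      using def_pred_reindex[OF R, of "\<lambda>i. if i = 0 then n else Suc n" "Suc (Suc n)"] by simp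
  qed simp
qed (simp only: fun_upd_other n_not_Suc_n simp_thms def_term_local[OF t])

lemma def_pred_app3:
  assumes R: "def_pred 3 (\<lambda>v. R (v 0) (v 1) (v 2))" and s: "def_term n s" and t: "def_term n t" and u: "def_term n u"
  shows "def_pred n (\<lambda>v. R (s v) (t v) (u v))"
proof (rule def_pred_term[OF s])
  show "def_pred (Suc n) (\<lambda>v. R (v n) (t v) (u v))"
  proof (rule def_pred_term[OF def_term_Suc[OF t]])
    show "def_pred (Suc (Suc n)) (\<lambda>v. R (v n) (v (Suc n)) (u v))"
    proof (rule def_pred_term[OF def_term_Suc[OF def_term_Suc[OF u]]])
      show "def_pred (Suc (Suc (Suc n))) (\<lambda>v. R (v n) (v (Suc n)) (v (Suc (Suc n))))"
        using def_pred_reindex[OF R, of "\<lambda>i. if i = 0 then n else if i = 1 then Suc n else Suc (Suc n)" "Suc (Suc (Suc n))"]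
        by simp
    qed simp
  qed (simp only: fun_upd_other n_not_Suc_n simp_thms def_term_local[OF def_term_Suc[OF u]])
qed (simp only: fun_upd_other n_not_Suc_n simp_thms def_term_local[OF t] def_term_local[OF u])

definition def_set :: "real set \<Rightarrow> bool" where "def_set S \<longleftrightarrow> def_pred 1 (\<lambda>v. v 0 \<in> S)"
definition def_family :: "(real \<Rightarrow> real set) \<Rightarrow> bool" where "def_family A \<longleftrightarrow> def_pred 2 (\<lambda>v. v 1 \<in> A (v 0))"
definition def_fun :: "(real \<Rightarrow> real) \<Rightarrow> bool" where "def_fun f \<longleftrightarrow> def_pred 2 (\<lambda>v. f (v 0) = v 1)"
definition def_fun2 :: "(real \<Rightarrow> real \<Rightarrow> real) \<Rightarrow> bool" where "def_fun2 f \<longleftrightarrow> def_pred 3 (\<lambda>v. f (v 0) (v 1) = v 2)"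

lemma def_pred_mem: "def_set S \<Longrightarrow> def_term n s \<Longrightarrow> def_pred n (\<lambda>v. s v \<in> S)"
  unfolding def_set_def by (rule def_pred_app1)

lemma def_pred_mem2: "def_family A \<Longrightarrow> def_term n s \<Longrightarrow> def_term n t \<Longrightarrow> def_pred n (\<lambda>v. t v \<in> A (s v))"
  unfolding def_family_def by (rule def_pred_app2)

lemma def_term_app:
  assumes f: "def_fun f" and s: "def_term n s"
  shows "def_term n (\<lambda>v. f (s v))"
proof (rule def_term_I)
  show "def_pred (Suc n) (\<lambda>v. f (s v) = v n)"
    by (rule def_pred_app2[where R = "\<lambda>a b. f a = b"]) (use f s in \<open>auto simp: def_fun_def intro: def_term_Suc def_term_var\<close>)
qed (simp only: def_term_local[OF s])

lemma def_term_app2: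
  assumes f: "def_fun2 f" and s: "def_term n s" and t: "def_term n t"
  shows "def_term n (\<lambda>v. f (s v) (t v))"
proof (rule def_term_I)
  show "def_pred (Suc n) (\<lambda>v. f (s v) (t v) = v n)"
    by (rule def_pred_app3[where R = "\<lambda>a b c. f a b = c"]) (use f s t in \<open>auto simp: def_fun2_def intro: def_term_Suc def_term_var\<close>)
qed (simp only: def_term_local[OF s] def_term_local[OF t])

lemma def_pred_eq: "def_term n s \<Longrightarrow> def_term n t \<Longrightarrow> def_pred n (\<lambda>v. s v = t v)"
  by (rule def_pred_app2[where R = "(=)"]) (auto intro: def_pred_eq_var)

end

section \<open>Formulas with order and arithmetic\<close>

context o_minimal_real_field begin

lemma def_pred_less: "def_term n s \<Longrightarrow> def_term n t \<Longrightarrow> def_pred n (\<lambda>v. s v < t v)"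
proof (rule def_pred_app2[where R = "(<)"])
  show "def_pred 2 (\<lambda>v. v 0 < v 1)" unfolding def_pred_def
    by (rule bexI[OF _ less]) (auto simp: numeral_2_eq_2)
qed

lemma def_pred_le: "def_term n s \<Longrightarrow> def_term n t \<Longrightarrow> def_pred n (\<lambda>v. s v \<le> t v)"
  using def_pred_not[OF def_pred_less, of n t s] by (simp add: not_less)

lemma def_fun2_add: "def_fun2 (+)"
  unfolding def_fun2_def def_pred_def by (rule bexI[OF _ add]) (auto simp: numeral_3_eq_3 numeral_2_eq_2)

lemma def_fun2_mult: "def_fun2 (*)"
  unfolding def_fun2_def def_pred_def by (rule bexI[OF _ mult]) (auto simp: numeral_3_eq_3 numeral_2_eq_2)

lemmas def_term_add = def_term_app2[OF def_fun2_add] and def_term_mult = def_term_app2[OF def_fun2_mult]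

lemma def_set_iff: "def_set S \<longleftrightarrow> (\<exists>\<B>. finite \<B> \<and> (\<forall>B\<in>\<B>. \<exists>d. line_cell d B) \<and> S = \<Union>\<B>)"
proof -
  have inj: "inj (\<lambda>x::real. [x])" by (auto simp: inj_on_def)
  have "def_set S \<longleftrightarrow> (\<lambda>x. [x]) ` S \<in> Def 1"
  proof
    assume "def_set S"
    then obtain A where A: "A \<in> Def 1" "\<And>v. v 0 \<in> S \<longleftrightarrow> map v [0..<1] \<in> A"
      unfolding def_set_def by (rule def_predE) (rule that)
    have "A = (\<lambda>x. [x]) ` S"
    proof (intro set_eqI iffI)
      fix xs assume xs: "xs \<in> A"
      then obtain x where "xs = [x]" using arity[OF A(1)] by (auto simp: length_Suc_conv)
      then show "xs \<in> (\<lambda>x. [x]) ` S" using A(2)[of "\<lambda>_. x"] xs by auto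
    next
      fix xs assume "xs \<in> (\<lambda>x. [x]) ` S"
      then obtain x where "xs = [x]" "x \<in> S" by auto
      then show "xs \<in> A" using A(2)[of "\<lambda>_. x"] by auto
    qed
    then show "(\<lambda>x. [x]) ` S \<in> Def 1" using A(1) by simp
  next
    assume "(\<lambda>x. [x]) ` S \<in> Def 1"
    then show "def_set S" unfolding def_set_def def_pred_def by (rule bexI[rotated]) auto
  qed
  also have "\<dots> \<longleftrightarrow> (\<exists>\<B>. finite \<B> \<and> (\<forall>B\<in>\<B>. \<exists>d. line_cell d B) \<and> S = \<Union>\<B>)"
    unfolding o_minimal using inj_image_eq_iff[OF inj] by metis
  finally show ?thesis .
qed

lemma def_set_line_cell: "line_cell d B \<Longrightarrow> def_set B"
  unfolding def_set_iff by (rule exI[of _ "{B}"]) auto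

text \<open>Every point is a cell of the line, so all real constants may serve as
  parameters.\<close>

lemma def_term_const: "def_term n (\<lambda>v. c)"
proof (rule def_term_I)
  have "def_pred (Suc n) (\<lambda>v. v n \<in> {c})"
    by (rule def_pred_mem[OF def_set_line_cell[OF line_cell.point]]) (auto intro: def_term_var)
  then show "def_pred (Suc n) (\<lambda>v. c = v n)" by (simp add: eq_commute)
qed simp

lemma def_term_diff: 
  assumes "def_term n s" "def_term n t" shows "def_term n (\<lambda>v. s v - t v)"
proof (rule def_term_I)
  have "def_pred (Suc n) (\<lambda>v. s v = v n + t v)"
    by (intro def_pred_eq def_term_add def_term_Suc assms def_term_var) simp
  then show "def_pred (Suc n) (\<lambda>v. s v - t v = v n)" by (simp add: algebra_simps)
qed (simp add: assms def_term_local)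

lemma def_pred_abs_less:
  assumes "def_term n s" "def_term n t" shows "def_pred n (\<lambda>v. \<bar>s v\<bar> < t v)"
proof -
  have "def_pred n (\<lambda>v. s v < t v \<and> 0 - s v < t v)"
    by (intro def_pred_conj def_pred_less def_term_diff def_term_const assms)
  then show ?thesis by (simp add: abs_less_iff)
qed

lemma def_setI: "def_pred 1 (\<lambda>v. P (v 0)) \<Longrightarrow> def_set {x. P x}"
  by (simp add: def_set_def)

lemmas def_pred_rules = def_pred_not def_pred_conj def_pred_disj def_pred_imp def_pred_ex def_pred_all def_pred_less def_pred_le def_pred_eq def_pred_abs_less
  def_term_const def_term_add def_term_mult def_term_diff def_term_var

end

section \<open>Cells, intervals and finite sets on the line\<close>

lemma line_cell_open:
  assumes "open B" "is_interval B" "B \<noteq> {}"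
  shows "line_cell 1 (B :: real set)"
proof -
  let ?a = "Inf (ereal ` B)" and ?b = "Sup (ereal ` B)"
  have lt: "?a < ereal x" "ereal x < ?b" if xB: "x \<in> B" for x
  proof -
    obtain e where "e > 0" "ball x e \<subseteq> B" using assms(1) xB unfolding open_contains_ball by blast
    moreover have "x - e/2 \<in> ball x e" "x + e/2 \<in> ball x e" using \<open>e > 0\<close> by (simp_all add: dist_real_def)
    ultimately have "x - e/2 \<in> B" "x + e/2 \<in> B" by blast+
    then have "?a \<le> ereal (x - e/2)" "ereal (x + e/2) \<le> ?b" by (simp_all add: Inf_lower Sup_upper)
    moreover have "ereal (x - e/2) < ereal x" "ereal x < ereal (x + e/2)" using \<open>e > 0\<close> by simp_all
    ultimately show "?a < ereal x" "ereal x < ?b" by (metis le_less_trans, metis less_le_trans)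
  qed
  have "x \<in> B" if x: "?a < ereal x" "ereal x < ?b" for x
  proof -
    obtain u where u: "u \<in> B" "u < x" using x(1) unfolding Inf_less_iff by auto
    obtain w where w: "w \<in> B" "x < w" using x(2) unfolding less_Sup_iff by auto
    show ?thesis using assms(2)[unfolded is_interval_1, rule_format, OF u(1) w(1)] u(2) w(2) by simp
  qed
  with lt have eq: "{x. ?a < ereal x \<and> ereal x < ?b} = B" by blast
  obtain x where "x \<in> B" using assms(3) by auto
  then have "?a < ?b" using less_trans[OF lt] by blast
  from line_cell.interval[OF this] show ?thesis unfolding eq .
qed

lemma line_cell_cases:
  assumes "line_cell d B"
  obtains (point) r where "d = 0" "B = {r}" | (interval) "d = 1" "open B" "is_interval B" "B \<noteq> {}"
  using assms
proof cases
  case (interval a b)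
  have "open B" unfolding interval by (intro open_Collect_conj open_Collect_less continuous_intros)
  moreover have "is_interval B" unfolding interval is_interval_1
    by (metis (no_types, lifting) ereal_less_eq(3) le_less_trans less_le_trans mem_Collect_eq)
  moreover have "B \<noteq> {}" using ereal_dense2[OF interval(3)] interval(2) by auto
  ultimately show ?thesis using that(2) interval(1) by blast
qed (use that(1) in auto)

text \<open>A frontier point strictly between two others would be interior, because points of
  \<open>B\<close> close to the outer two enclose it. Hence there are at most two frontier
  points.\<close>

lemma finite_frontier_interval:
  assumes "is_interval (B :: real set)" shows "finite (frontier B)"
proof -
  have *: "\<not> (x < y \<and> y < z)" if fr: "x \<in> frontier B" "y \<in> frontier B" "z \<in> frontier B" for x y z
  proof
    assume xyz: "x < y \<and> y < z"
    have "x \<in> closure B" "z \<in> closure B" using fr by (auto simp: frontier_def)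
    then obtain u where u: "u \<in> B" "dist u x < y - x"
      using xyz unfolding closure_approachable by (meson diff_gt_0_iff_gt)
    obtain w where w: "w \<in> B" "dist w z < z - y"
      using xyz \<open>z \<in> closure B\<close> unfolding closure_approachable by (meson diff_gt_0_iff_gt)
    note uw = u w
    then have "u < y" "y < w" by (auto simp: dist_real_def)
    moreover have "{u<..<w} \<subseteq> B"
      using assms[unfolded is_interval_1, rule_format, OF u(1) w(1)] by (simp add: subset_eq)
    ultimately have "{u<..<w} \<subseteq> B" "y \<in> {u<..<w}" by simp_all
    then have "y \<in> interior B" by (meson interior_maximal open_greaterThanLessThan subsetD)
    with fr(2) show False by (simp add: frontier_def)
  qed
  show ?thesis
    proof (cases "\<exists>a b. a \<in> frontier B \<and> b \<in> frontier B \<and> a < b")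
      case True
      then obtain a b where "a \<in> frontier B" "b \<in> frontier B" "a < b" by blast
      then have "frontier B \<subseteq> {a, b}" using * by (metis insertI1 insertI2 linorder_less_linear subsetI)
      then show ?thesis using finite_subset by blast
    next
      case False
      then have "frontier B \<subseteq> {SOME a. a \<in> frontier B}"
        by (metis linorder_less_linear singleton_iff someI_ex subsetI)
      then show ?thesis using finite_subset by blast
    qed
qed

lemma finite_frontier_line_cell:
  assumes "line_cell d B" shows "finite (frontier B)"
proof -
  have "is_interval B" using assms by (rule line_cell_cases) (simp_all add: is_interval_convex_1)
  then show ?thesis by (rule finite_frontier_interval)
qed

lemma finite_frontier_Union:
  "finite \<B> \<Longrightarrow> (\<And>B. B \<in> \<B> \<Longrightarrow> finite (frontier B)) \<Longrightarrow> finite (frontier (\<Union>\<B>))"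
proof (induction rule: finite_induct)
  case (insert B \<B>)
  then show ?case using finite_subset[OF frontier_Un_subset[of B "\<Union>\<B>"]] by auto
qed simp

lemma interval_avoiding_finite:
  fixes c d :: real
  assumes "finite F" "c < d"
  obtains c' d' where "c \<le> c'" "c' < d'" "d' \<le> d" "{c'<..<d'} \<inter> F = {}"
proof -
  have "infinite {c<..<d}" using assms(2) by (simp add: infinite_Ioo)
  then obtain x where x: "x \<in> {c<..<d}" "x \<notin> F" using assms(1) by (meson finite_subset subsetI)
  have "open ({c<..<d} - F)" using assms(1) by (intro open_Diff finite_imp_closed) auto
  then obtain e where e: "e > 0" "ball x e \<subseteq> {c<..<d} - F" using x unfolding open_contains_ball by blast
  have sub: "{x - e <..< x + e} \<subseteq> {c<..<d} - F" using e(2) by (simp add: ball_eq_greaterThanLessThan)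
  moreover from this have "c \<le> x - e" "x + e \<le> d"
    using e(1) greaterThanLessThan_subseteq_greaterThanLessThan[of "x - e" "x + e" c d] by auto
  ultimately show ?thesis using that[of "x - e" "x + e"] e(1) by auto
qed

text \<open>A supremum argument: the set of \<open>s\<close> up to which the estimate holds is
  closed, and local growth pushes its supremum up to \<open>b\<close>. The local hypothesis concerns
  the right side only, since one-sided germs are what \<open>def_set_germ\<close> provides.\<close>

lemma right_growth:
  fixes f :: "real \<Rightarrow> real"
  assumes cont: "continuous_on {a..b} f" and ab: "a \<le> b"
    and gr: "\<And>x. a \<le> x \<Longrightarrow> x < b \<Longrightarrow> \<exists>e>0. \<forall>h. 0 < h \<and> h < e \<longrightarrow> K * h \<le> f (x + h) - f x"
  shows "K * (b - a) \<le> f b - f a"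
proof -
  define S where "S = {s\<in>{a..b}. K * (s - a) \<le> f s - f a}"
  have S: "a \<in> S" "bdd_above S" "S \<noteq> {}" "S \<subseteq> {a..b}" using ab by (auto simp: S_def)
  have "closed S" unfolding S_def
    by (intro continuous_on_closed_Collect_le) (auto intro!: continuous_intros cont)
  then have s: "Sup S \<in> S" using closed_contains_Sup S by blast
  have "Sup S = b"
  proof (rule ccontr)
    assume "Sup S \<noteq> b"
    then have *: "a \<le> Sup S" "Sup S < b" using s S by auto
    then obtain e where e: "e > 0" "\<forall>h. 0 < h \<and> h < e \<longrightarrow> K * h \<le> f (Sup S + h) - f (Sup S)"
      using gr by blast
    define h where "h = min (e/2) (b - Sup S)"
    have h: "0 < h" "h < e" "Sup S + h \<le> b" using e * by (auto simp: h_def)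
    have "K * (Sup S + h - a) \<le> f (Sup S + h) - f a"
      using e(2)[rule_format, of h] h s by (auto simp: S_def algebra_simps)
    then have "Sup S + h \<in> S" using h * by (auto simp: S_def)
    then have "Sup S + h \<le> Sup S" using S(2) cSup_upper by blast
    then show False using h by simp
  qed
  then show ?thesis using s by (simp add: S_def)
qed

lemma right_growth_le:
  fixes f :: "real \<Rightarrow> real"
  assumes cont: "continuous_on {a..b} f" and ab: "a \<le> b"
    and gr: "\<And>x. a \<le> x \<Longrightarrow> x < b \<Longrightarrow> \<exists>e>0. \<forall>h. 0 < h \<and> h < e \<longrightarrow> f (x + h) - f x \<le> K * h"
  shows "f b - f a \<le> K * (b - a)"
proof -
  have "(- K) * (b - a) \<le> (- f b) - (- f a)"
  proof (rule right_growth)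
    fix x assume "a \<le> x" "x < b"
    from gr[OF this] obtain e where "e > 0" "\<forall>h. 0 < h \<and> h < e \<longrightarrow> f (x + h) - f x \<le> K * h" by blast
    then show "\<exists>e>0. \<forall>h. 0 < h \<and> h < e \<longrightarrow> - K * h \<le> - f (x + h) - - f x"
      by (intro exI[of _ e]) (auto simp: algebra_simps)
  qed (use assms in \<open>auto intro: continuous_intros\<close>)
  then show ?thesis by simp
qed

section \<open>Counting the smaller elements of a finite set\<close>

definition num_below :: "real set \<Rightarrow> real \<Rightarrow> nat" where "num_below A y = card {z\<in>A. z < y}"

text \<open>Recursion through the largest element \<open>z\<close> of \<open>A\<close> below
  \<open>y\<close>. It replaces the cardinality by quantifiers over points, so that for each fixed
  \<open>k\<close> the rank condition becomes a definable formula.\<close>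

lemma num_below_Suc:
  assumes "finite A"
  shows "num_below A y = Suc k \<longleftrightarrow> (\<exists>z. z \<in> A \<and> z < y \<and> num_below A z = k \<and> \<not> (\<exists>w. w \<in> A \<and> z < w \<and> w < y))"
proof
  assume r: "num_below A y = Suc k"
  let ?S = "{z\<in>A. z < y}"
  have S: "finite ?S" "?S \<noteq> {}" using r assms unfolding num_below_def by (auto simp del: Collect_empty_eq)
  define z where "z = Max ?S"
  have z: "z \<in> A" "z < y" using Max_in[OF S] by (auto simp: z_def)
  have nb: "\<not> (\<exists>w. w \<in> A \<and> z < w \<and> w < y)"
    using Max_ge[OF S(1)] by (fastforce simp: z_def not_less)
  then have "?S = insert z {w\<in>A. w < z}" using z by (auto; metis linorder_neqE)
  then have "num_below A y = Suc (num_below A z)" using assms by (simp add: num_below_def)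
  with r z nb show "\<exists>z. z \<in> A \<and> z < y \<and> num_below A z = k \<and> \<not> (\<exists>w. w \<in> A \<and> z < w \<and> w < y)" by auto
next
  assume "\<exists>z. z \<in> A \<and> z < y \<and> num_below A z = k \<and> \<not> (\<exists>w. w \<in> A \<and> z < w \<and> w < y)"
  then obtain z where z: "z \<in> A" "z < y" "num_below A z = k" "\<not> (\<exists>w. w \<in> A \<and> z < w \<and> w < y)" by blast
  then have "{z\<in>A. z < y} = insert z {w\<in>A. w < z}" by (auto; metis linorder_neqE)
  then show "num_below A y = Suc k" using assms z(3) by (simp add: num_below_def)
qed

lemma num_below_0: "finite A \<Longrightarrow> num_below A y = 0 \<longleftrightarrow> \<not> (\<exists>z. z \<in> A \<and> z < y)"
  by (auto simp: num_below_def)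

lemma num_below_mono: "finite A \<Longrightarrow> y \<le> z \<Longrightarrow> num_below A y \<le> num_below A z"
  unfolding num_below_def by (intro card_mono) auto

lemma num_below_strict_mono: "finite A \<Longrightarrow> y \<in> A \<Longrightarrow> y < z \<Longrightarrow> num_below A y < num_below A z"
  unfolding num_below_def by (intro psubset_card_mono) auto

lemma num_below_less_iff: "finite A \<Longrightarrow> y \<in> A \<Longrightarrow> z \<in> A \<Longrightarrow> num_below A y < num_below A z \<longleftrightarrow> y < z"
  by (meson not_le num_below_mono num_below_strict_mono)

lemma num_below_inj: "finite A \<Longrightarrow> y \<in> A \<Longrightarrow> z \<in> A \<Longrightarrow> num_below A y = num_below A z \<Longrightarrow> y = z"
  by (metis less_irrefl linorder_less_linear num_below_strict_mono)

lemma num_below_le_card: "finite A \<Longrightarrow> num_below A y \<le> card A"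
  unfolding num_below_def by (intro card_mono) auto

lemma num_below_less_card: "finite A \<Longrightarrow> y \<in> A \<Longrightarrow> num_below A y < card A"
  unfolding num_below_def by (intro psubset_card_mono) auto

lemma ex_num_below: "finite A \<Longrightarrow> k < card A \<Longrightarrow> \<exists>y. y \<in> A \<and> num_below A y = k"
proof (induction A arbitrary: k rule: finite_linorder_max_induct)
  case (insert b A)
  have eq: "num_below (insert b A) y = num_below A y" if "y \<in> A \<or> y = b" for y
    using that insert.hyps unfolding num_below_def by (metis (mono_tags, lifting) insert_iff less_asym less_irrefl)
  show ?case
  proof (cases "k < card A")
    case True
    then show ?thesis using insert.IH eq by (metis insertI2)
  next
    case False
    then have "k = card A" using insert by (auto simp: card_insert_if split: if_splits)
    moreover have "num_below A b = card A" unfolding num_below_def using insert.hyps by (metis (no_types, lifting) Collect_cong Collect_mem_eq)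
    ultimately show ?thesis using eq by auto
  qed
qed simp

lemma less_card_iff_num_below: "finite A \<Longrightarrow> k < card A \<longleftrightarrow> (\<exists>y. y \<in> A \<and> num_below A y = k)"
  using ex_num_below num_below_less_card by blast

text \<open>Counting starts at \<open>0\<close>. The value \<open>0\<close> for indices out of range
  makes the function total, as \<open>def_fun\<close> demands; the cells built later refer only to
  indices below the cardinality.\<close>

definition nth_smallest :: "real set \<Rightarrow> nat \<Rightarrow> real"
  where "nth_smallest A k = (if k < card A then THE y. y \<in> A \<and> num_below A y = k else 0)"

lemma nth_smallest_eq:
  assumes "finite A" "y \<in> A" "num_below A y = k" shows "nth_smallest A k = y"
proof -
  have "k < card A" using num_below_less_card[OF assms(1,2)] assms(3) by simp
  moreover have "(THE y. y \<in> A \<and> num_below A y = k) = y"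
    by (rule the_equality) (use assms num_below_inj[OF assms(1)] in blast)+
  ultimately show ?thesis by (simp add: nth_smallest_def)
qed

lemma nth_smallest:
  assumes "finite A" "k < card A" shows "nth_smallest A k \<in> A" "num_below A (nth_smallest A k) = k"
  using ex_num_below[OF assms] nth_smallest_eq[OF assms(1)] by auto

lemma nth_smallest_iff:
  assumes "finite A"
  shows "nth_smallest A k = y \<longleftrightarrow> (y \<in> A \<and> num_below A y = k) \<or> (\<not> (\<exists>y. y \<in> A \<and> num_below A y = k) \<and> y = 0)"
proof (cases "k < card A")
  case True
  then show ?thesis using nth_smallest[OF assms True] nth_smallest_eq[OF assms] by blast
next
  case False
  then show ?thesis using less_card_iff_num_below[OF assms, of k] by (auto simp: nth_smallest_def)
qed

section \<open>One-variable o-minimality\<close>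

context o_minimal_real_field begin

lemma def_set_frontier: "def_set S \<Longrightarrow> finite (frontier S)"
  unfolding def_set_iff using finite_frontier_Union finite_frontier_line_cell by metis

text \<open>A set with empty interior is contained in its frontier, which is finite here.\<close>

lemma def_set_infinite:
  assumes "def_set S" "infinite S" obtains c d where "c < d" "{c<..<d} \<subseteq> S"
proof -
  have "interior S \<noteq> {}"
  proof
    assume "interior S = {}"
    then have "S \<subseteq> frontier S" using closure_subset by (auto simp: frontier_def)
    then show False using assms def_set_frontier finite_subset by blast
  qed
  then obtain x where "x \<in> interior S" by auto
  then obtain e where "e > 0" "ball x e \<subseteq> S" using mem_interior by metis
  then show ?thesis using that[of "x - e" "x + e"] by (simp add: ball_eq_greaterThanLessThan)
qed

text \<open>The scheme behind all statements of the form "at all but finitely many points": an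
  infinite definable exceptional set would contain an interval, so it is enough to exhibit one good
  point in every interval.\<close>

lemma def_set_cofinite:
  assumes S: "def_set S" and "\<And>c d. c < d \<Longrightarrow> \<exists>x\<in>{c<..<d}. x \<in> S"
  shows "finite (- S)"
proof (rule ccontr)
  assume inf: "infinite (- S)"
  have "def_set {x. \<not> x \<in> S}" by (intro def_setI def_pred_not def_pred_mem[OF S] def_term_var) simp
  then have "def_set (- S)" by (simp add: Compl_eq)
  with inf obtain c d where "c < d" "{c<..<d} \<subseteq> - S" using def_set_infinite by blast
  with assms(2) show False by blast
qed

text \<open>An interval is uncountable, so it meets one of the countably many sets in an infinite
  definable set, and this contains an interval. The index type is general because it is instantiated
  with \<open>nat\<close>, \<open>int\<close>, \<open>bool\<close> and pairs of natural
  numbers.\<close>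

lemma countable_cover:
  fixes E :: "'i::countable \<Rightarrow> real set"
  assumes E: "\<And>i. def_set (E i)" and cd: "c < d" and cov: "{c<..<d} \<subseteq> (\<Union>i. E i)"
  obtains i c' d' where "c \<le> c'" "c' < d'" "d' \<le> d" "{c'<..<d'} \<subseteq> E i"
proof -
  have "\<exists>i. infinite ({c<..<d} \<inter> E i)"
  proof (rule ccontr)
    assume "\<not> ?thesis"
    then have "countable (\<Union>i. {c<..<d} \<inter> E i)" by (intro countable_UN) (auto intro: countable_finite)
    moreover have "(\<Union>i. {c<..<d} \<inter> E i) = {c<..<d}" using cov by auto
    ultimately show False using uncountable_open_interval[of c d] cd by auto
  qed
  then obtain i where i: "infinite ({c<..<d} \<inter> E i)" by blast
  have "def_set {x. (c < x \<and> x < d) \<and> x \<in> E i}"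
    by (intro def_setI def_pred_rules def_pred_mem[OF E]) simp_all
  then have "def_set ({c<..<d} \<inter> E i)" by (simp add: Int_def conj_assoc)
  then obtain c' d' where *: "c' < d'" "{c'<..<d'} \<subseteq> {c<..<d} \<inter> E i" using i def_set_infinite by blast
  then have "c \<le> c'" "d' \<le> d" by (auto simp: greaterThanLessThan_subseteq_greaterThanLessThan)
  then show ?thesis using that * by blast
qed

lemma def_set_germ:
  assumes "def_set S"
  shows "\<exists>e>0. (\<forall>h. 0 < h \<and> h < e \<longrightarrow> h \<in> S) \<or> (\<forall>h. 0 < h \<and> h < e \<longrightarrow> h \<notin> S)"
proof -
  have fin: "finite (frontier S)" by (rule def_set_frontier[OF assms])
  \<comment> \<open>The element \<open>1\<close> keeps the minimum meaningful if no frontier point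
    is positive.\<close>
  define e where "e = Min (insert 1 {x\<in>frontier S. x > 0})"
  have "e > 0" using fin by (auto simp: e_def)
  have "x \<notin> frontier S" if "0 < x" "x < e" for x
  proof
    assume "x \<in> frontier S"
    then have "e \<le> x" unfolding e_def using fin that by (intro Min_le) auto
    with that show False by simp
  qed
  then have "{0<..<e} \<inter> frontier S = {}" by auto
  then have "{0<..<e} \<inter> S = {} \<or> {0<..<e} - S = {}"
    using connected_Int_frontier[of "{0<..<e}" S] by auto
  with \<open>e > 0\<close> show ?thesis by (intro exI[of _ e]) auto
qed

text \<open>If \<open>f\<close> were discontinuous throughout an interval, countability would first
  give a subinterval with jumps of at least a fixed size \<open>\<epsilon>\<close> arbitrarily close
  to each of its points, and then a smaller one on which all values lie in one half-open slab of
  height \<open>\<epsilon>\<close>. The two contradict each other.\<close>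

lemma def_fun_continuous:
  assumes f: "def_fun f" shows "finite {x. \<not> isCont f x}"
proof -
  define S where "S = {x. \<forall>e. 0 < e \<longrightarrow> (\<exists>d. 0 < d \<and> (\<forall>x'. \<bar>x' - x\<bar> < d \<longrightarrow> \<bar>f x' - f x\<bar> < e))}"
  have S: "def_set S" unfolding S_def by (intro def_setI def_pred_rules def_term_app[OF f]) simp_all
  have "finite (- S)"
  proof (rule def_set_cofinite[OF S], rule ccontr)
    fix c d :: real assume cd: "c < d" and no: "\<not> (\<exists>x\<in>{c<..<d}. x \<in> S)"
    define E where "E n = {x. \<forall>d. 0 < d \<longrightarrow> (\<exists>x'. \<bar>x' - x\<bar> < d \<and> \<not> \<bar>f x' - f x\<bar> < inverse (real (Suc n)))}" for n
    have E: "def_set (E n)" for n unfolding E_def by (intro def_setI def_pred_rules def_term_app[OF f]) simp_all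
    have "{c<..<d} \<subseteq> (\<Union>n. E n)"
    proof
      fix x assume "x \<in> {c<..<d}"
      then have "x \<notin> S" using no by blast
      then obtain e where e: "e > 0" "\<And>d. 0 < d \<Longrightarrow> \<exists>x'. \<bar>x' - x\<bar> < d \<and> \<not> \<bar>f x' - f x\<bar> < e"
        unfolding S_def by blast
      obtain n where "inverse (real (Suc n)) < e" using reals_Archimedean[OF e(1)] by blast
      then have "x \<in> E n" unfolding E_def using e(2) by (smt (verit) mem_Collect_eq)
      then show "x \<in> (\<Union>n. E n)" by blast
    qed
    from countable_cover[OF E cd this] obtain n c' d' where 1: "c' < d'" "{c'<..<d'} \<subseteq> E n" by metis
    define \<epsilon> where "\<epsilon> = inverse (real (Suc n))"
    have \<epsilon>: "\<epsilon> > 0" by (simp add: \<epsilon>_def)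
    define G where "G k = {x. real_of_int k * \<epsilon> \<le> f x \<and> f x < (real_of_int k + 1) * \<epsilon>}" for k
    have G: "def_set (G k)" for k unfolding G_def by (intro def_setI def_pred_rules def_term_app[OF f]) simp_all
    have "{c'<..<d'} \<subseteq> (\<Union>k. G k)"
    proof
      fix x
      have "x \<in> G \<lfloor>f x / \<epsilon>\<rfloor>" unfolding G_def using \<epsilon> 
        using floor_correct[of "f x / \<epsilon>"]
        by (simp add: pos_le_divide_eq[symmetric] pos_divide_less_eq[symmetric])
      then show "x \<in> (\<Union>k. G k)" by blast
    qed
    from countable_cover[OF G 1(1) this] obtain k c2 d2 where
      2: "c' \<le> c2" "c2 < d2" "d2 \<le> d'" "{c2<..<d2} \<subseteq> G k" by metis
    define x where "x = (c2 + d2) / 2"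
    have x: "x \<in> {c2<..<d2}" using 2 by (auto simp: x_def)
    then have "x \<in> E n" using 1 2 by auto
    moreover have "0 < (d2 - c2) / 2" using 2 by simp
    ultimately obtain x' where x': "\<bar>x' - x\<bar> < (d2 - c2) / 2" "\<not> \<bar>f x' - f x\<bar> < \<epsilon>"
      unfolding E_def \<epsilon>_def by blast
    have "x' \<in> {c2<..<d2}" using x'(1) by (auto simp: x_def abs_less_iff field_simps)
    then have "x \<in> G k" "x' \<in> G k" using x 2 by auto
    then show False using x'(2) by (auto simp: G_def algebra_simps)
  qed
  moreover have "{x. \<not> isCont f x} \<subseteq> - S"
    unfolding S_def continuous_at_eps_delta
    by (simp add: dist_real_def subset_eq)
  ultimately show ?thesis using finite_subset by blast
qed

end

section \<open>Separated and close finite sets\<close>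

lemma finite_separation:
  fixes A :: "real set"
  assumes "finite A"
  shows "\<exists>e>0. \<forall>y z. y \<in> A \<and> z \<in> A \<and> y < z \<longrightarrow> e \<le> z - y"
proof -
  \<comment> \<open>The element \<open>1\<close> covers sets with fewer than two points, which have
    no gaps.\<close>
  define D where "D = insert 1 ((\<lambda>(y, z). z - y) ` {(y, z). y \<in> A \<and> z \<in> A \<and> y < z})"
  have "finite {(y, z). y \<in> A \<and> z \<in> A \<and> y < z}"
    by (rule finite_subset[of _ "A \<times> A"]) (use assms in auto)
  then have fin: "finite D" by (simp add: D_def)
  have "Min D \<in> D" using Min_in[OF fin] by (auto simp: D_def)
  then have "Min D > 0" by (auto simp: D_def)
  moreover have "Min D \<le> z - y" if "y \<in> A" "z \<in> A" "y < z" for y z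
    by (rule Min_le[OF fin]) (use that in \<open>auto simp: D_def intro!: image_eqI[of _ _ "(y, z)"]\<close>)
  ultimately show ?thesis by blast
qed

text \<open>One point of \<open>B\<close> cannot be \<open>e\<close>-close to two points of
  \<open>A\<close> whose distance is at least \<open>2 * e\<close>, so the choice of close points is
  injective.\<close>

lemma card_le_of_close:
  fixes A B :: "real set"
  assumes fin: "finite B" and sep: "\<And>y z. y \<in> A \<Longrightarrow> z \<in> A \<Longrightarrow> y < z \<Longrightarrow> 2 * e \<le> z - y"
    and close: "\<And>y. y \<in> A \<Longrightarrow> \<exists>y'. y' \<in> B \<and> \<bar>y - y'\<bar> < e"
  shows "card A \<le> card B"
proof -
  obtain g where g: "\<And>y. y \<in> A \<Longrightarrow> g y \<in> B \<and> \<bar>y - g y\<bar> < e" using close by metis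
  have "inj_on g A"
  proof (rule inj_onI)
    fix y z assume yz: "y \<in> A" "z \<in> A" "g y = g z"
    have "\<bar>y - g y\<bar> < e" "\<bar>z - g y\<bar> < e" using g[OF yz(1)] g[OF yz(2)] yz(3) by auto
    then have "\<bar>y - z\<bar> < 2 * e" by linarith
    then show "y = z" using sep[OF yz(1,2)] sep[OF yz(2,1)] by linarith
  qed
  then show ?thesis using g fin by (intro card_inj_on_le[of g]) auto
qed

section \<open>Partition of the line by a finite set\<close>

text \<open>The classes are the points of \<open>F\<close> and the open intervals between them,
  described by two invariants instead of by end points. The partition property is then immediate,
  and unbounded intervals are no special case.\<close>

definition line_class :: "real set \<Rightarrow> real \<Rightarrow> real set"
  where "line_class F x = {y. (y \<in> F) = (x \<in> F) \<and> num_below F y = num_below F x}"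

lemma line_class_point: "finite F \<Longrightarrow> x \<in> F \<Longrightarrow> line_class F x = {x}"
  unfolding line_class_def using num_below_inj by blast

lemma num_below_eq_iff_no_between:
  assumes "finite F" "x \<notin> F" "y \<notin> F" "x \<le> y"
  shows "num_below F x = num_below F y \<longleftrightarrow> F \<inter> {x..y} = {}"
proof
  assume r: "num_below F x = num_below F y"
  show "F \<inter> {x..y} = {}"
  proof (rule ccontr)
    assume "F \<inter> {x..y} \<noteq> {}"
    then obtain z where z: "z \<in> F" "x \<le> z" "z \<le> y" by auto
    then have "z < y" using assms by (metis le_less)
    have "num_below F x \<le> num_below F z" by (rule num_below_mono[OF assms(1) z(2)])
    also have "\<dots> < num_below F y" by (rule num_below_strict_mono[OF assms(1) z(1) \<open>z < y\<close>])
    finally show False using r by simp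
  qed
next
  assume "F \<inter> {x..y} = {}"
  then have "{z\<in>F. z < x} = {z\<in>F. z < y}" using assms by (auto simp: disjoint_iff not_less) 
  then show "num_below F x = num_below F y" by (simp add: num_below_def)
qed

lemma line_class_interval:
  assumes F: "finite F" and x: "x \<notin> F"
  shows "open (line_class F x)" "is_interval (line_class F x)" "line_class F x \<inter> F = {}"
    "x \<in> line_class F x"
proof -
  show "line_class F x \<inter> F = {}" "x \<in> line_class F x" using x by (auto simp: line_class_def)
  have btw: "z \<in> line_class F x" if "y \<in> line_class F x" "y' \<in> line_class F x" "y \<le> z" "z \<le> y'" for y y' z
  proof -
    have y: "y \<notin> F" "y' \<notin> F" "num_below F y = num_below F x" "num_below F y' = num_below F x"
      using that x by (auto simp: line_class_def)
    have e: "F \<inter> {y..y'} = {}" using num_below_eq_iff_no_between[OF F y(1,2)] that y by auto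
    then have z: "z \<notin> F" using that by auto
    have "F \<inter> {y..z} = {}" using e that by auto
    then have "num_below F y = num_below F z" using num_below_eq_iff_no_between[OF F y(1) z that(3)] by simp
    then show ?thesis using x y z by (simp add: line_class_def)
  qed
  then show "is_interval (line_class F x)" unfolding is_interval_1 by blast
  show "open (line_class F x)" unfolding open_contains_ball
  proof
    fix y assume y: "y \<in> line_class F x"
    then have yF: "y \<in> - F" "num_below F y = num_below F x" using x by (auto simp: line_class_def)
    have "open (- F)" using F by (simp add: finite_imp_closed open_Compl)
    then obtain e where e: "e > 0" "ball y e \<subseteq> - F" using yF(1) unfolding open_contains_ball by blast
    have "ball y e \<subseteq> line_class F x"
    proof
      fix z assume z: "z \<in> ball y e"
      then have zF: "z \<notin> F" using e by blast
      have "{min y z..max y z} \<subseteq> ball y e" using z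
        by (auto simp: dist_real_def abs_less_iff min_def max_def split: if_splits)
      then have "F \<inter> {min y z..max y z} = {}" using e(2) by blast
      then have "num_below F z = num_below F y"
        using num_below_eq_iff_no_between[OF F, of y z] num_below_eq_iff_no_between[OF F, of z y] yF zF
        by (auto simp: min_def max_def split: if_splits)
      then show "z \<in> line_class F x" using yF zF x by (simp add: line_class_def)
    qed
    with e(1) show "\<exists>e>0. ball y e \<subseteq> line_class F x" by blast
  qed
qed

lemma line_class_cell:
  assumes F: "finite F" shows "\<exists>d. line_cell d (line_class F x)"
proof (cases "x \<in> F")
  case True
  then show ?thesis using line_class_point[OF F] line_cell.point by metis
next
  case False
  then show ?thesis using line_class_interval[OF F False] line_cell_open by blast
qed

lemma line_class_decomposition:
  assumes F: "finite F" shows "line_decomposition (range (line_class F))"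
proof -
  have "range (line_class F) \<subseteq> (\<lambda>(b, n). {y. (y \<in> F) = b \<and> num_below F y = n}) ` (UNIV \<times> {..card F})"
    unfolding line_class_def using num_below_le_card[OF F]
    by (auto intro!: image_eqI[of _ _ "(_ \<in> F, num_below F _)"])
  then have "finite (range (line_class F))" by (rule finite_subset) simp
  moreover have "partition_on UNIV (range (line_class F))"
    by (rule partition_onI) (auto simp: line_class_def disjnt_def)
  ultimately show ?thesis using line_class_cell[OF F] unfolding line_decomposition_def by blast
qed

section \<open>Differentiability of definable functions\<close>

context o_minimal_real_field begin

text \<open>The right derivative comes first, because for a definable function the sign of
  \<open>f (x + h) - f x - K * h\<close> settles for small positive \<open>h\<close>. An infinite
  right derivative on a whole interval contradicts \<open>right_growth\<close>. The right derivative
  is itself definable, hence continuous off a finite set, and where a continuous function has a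
  continuous right derivative, this is a two-sided derivative.\<close>

lemma def_fun_C1:
  assumes f: "def_fun f"
  obtains f' F where "def_fun f'" "finite F"
    "\<And>x. x \<notin> F \<Longrightarrow> (f has_real_derivative f' x) (at x)" "\<And>x. x \<notin> F \<Longrightarrow> isCont f' x"
proof -
  define F0 where "F0 = {x. \<not> isCont f x}"
  have F0: "finite F0" unfolding F0_def by (rule def_fun_continuous[OF f])
  \<comment> \<open>The right difference quotient with the denominator multiplied out, so that only
    sums and products occur in the formula.\<close>
  define Lim where "Lim x L \<longleftrightarrow> (\<forall>e. 0 < e \<longrightarrow> (\<exists>d. 0 < d \<and> (\<forall>h. 0 < h \<and> h < d \<longrightarrow>
      \<bar>(f (x + h) - f x) - L * h\<bar> < e * h)))" for x L
  define T where "T = {x. \<exists>L. Lim x L}"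
  have T: "def_set T" unfolding T_def Lim_def by (intro def_setI def_pred_rules def_term_app[OF f]) simp_all
  have unique: "L = L'" if lim: "Lim x L" "Lim x L'" for x L L'
  proof (rule ccontr)
    assume ne: "L \<noteq> L'"
    define e where "e = \<bar>L - L'\<bar> / 2"
    have "e > 0" using ne by (simp add: e_def)
    obtain d where d: "d > 0" "\<And>h. 0 < h \<and> h < d \<Longrightarrow> \<bar>(f (x + h) - f x) - L * h\<bar> < e * h"
      using lim(1) \<open>e > 0\<close> unfolding Lim_def by blast
    obtain d' where d': "d' > 0" "\<And>h. 0 < h \<and> h < d' \<Longrightarrow> \<bar>(f (x + h) - f x) - L' * h\<bar> < e * h"
      using lim(2) \<open>e > 0\<close> unfolding Lim_def by blast
    define h where "h = min d d' / 2"
    have h: "0 < h" "h < d" "h < d'" using d d' by (auto simp: h_def)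
    have "\<bar>L * h - L' * h\<bar> < 2 * e * h" using d(2)[of h] d'(2)[of h] h by linarith
    also have "\<bar>L * h - L' * h\<bar> = \<bar>L - L'\<bar> * h" using h by (simp add: abs_mult left_diff_distrib[symmetric])
    finally show False using h by (simp add: e_def)
  qed
  have "finite (- T)"
  proof (rule def_set_cofinite[OF T], rule ccontr)
    fix c d :: real assume cd: "c < d" and no: "\<not> (\<exists>x\<in>{c<..<d}. x \<in> T)"
    from interval_avoiding_finite[OF F0 cd] obtain c1 d1 where
      1: "c \<le> c1" "c1 < d1" "d1 \<le> d" "{c1<..<d1} \<inter> F0 = {}" .
    \<comment> \<open>The \<open>K\<close> with \<open>U x K\<close> form a down-set. If it is
      neither empty nor everything, its supremum is the right derivative at \<open>x\<close>;
      everything means slope plus infinity and the empty set slope minus infinity, and these two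
      cases are the sets \<open>E b\<close> below.\<close>
    define U where "U x K \<longleftrightarrow> (\<exists>e. 0 < e \<and> (\<forall>h. 0 < h \<and> h < e \<longrightarrow> K * h < f (x + h) - f x))" for x K
    have notU: "\<exists>e. 0 < e \<and> (\<forall>h. 0 < h \<and> h < e \<longrightarrow> f (x + h) - f x \<le> K * h)" if nU: "\<not> U x K" for x K
    proof -
      have "def_set {h. K * h < f (x + h) - f x}" by (intro def_setI def_pred_rules def_term_app[OF f]) simp_all
      from def_set_germ[OF this] obtain e where e: "e > 0" and
        "(\<forall>h. 0 < h \<and> h < e \<longrightarrow> K * h < f (x + h) - f x) \<or> (\<forall>h. 0 < h \<and> h < e \<longrightarrow> \<not> K * h < f (x + h) - f x)"
        by auto
      moreover have "\<not> (\<forall>h. 0 < h \<and> h < e \<longrightarrow> K * h < f (x + h) - f x)"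
        using nU e unfolding U_def by blast
      ultimately have "\<forall>h. 0 < h \<and> h < e \<longrightarrow> f (x + h) - f x \<le> K * h" by (meson not_less)
      with e show ?thesis by blast
    qed
    have Udown: "U x K'" if UK: "U x K" "K' \<le> K" for x K K'
    proof -
      obtain e where e: "e > 0" "\<And>h. 0 < h \<and> h < e \<Longrightarrow> K * h < f (x + h) - f x"
        using UK(1) unfolding U_def by blast
      have "K' * h < f (x + h) - f x" if "0 < h \<and> h < e" for h
        using e(2)[OF that] mult_right_mono[OF UK(2), of h] that by linarith
      with e(1) show ?thesis unfolding U_def by blast
    qed
    define E where "E b = (if b then {x. \<forall>K. U x K} else {x. \<forall>K. \<not> U x K})" for b
    have "def_set {x. \<forall>K. U x K}" "def_set {x. \<forall>K. \<not> U x K}"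
      unfolding U_def by (intro def_setI def_pred_rules def_term_app[OF f]; simp)+
    then have E: "def_set (E b)" for b by (simp add: E_def)
    have "{c1<..<d1} \<subseteq> (\<Union>b. E b)"
    proof
      fix x assume x: "x \<in> {c1<..<d1}"
      show "x \<in> (\<Union>b. E b)"
      proof (rule ccontr)
        assume "x \<notin> (\<Union>b. E b)"
        then have "x \<notin> E True" "x \<notin> E False" by auto
        then obtain K1 K2 where K: "U x K1" "\<not> U x K2" unfolding E_def by auto
        define S where "S = {K. U x K}"
        have "K \<le> K2" if "K \<in> S" for K
          using Udown[of x K K2] that K(2) unfolding S_def by (meson linear mem_Collect_eq)
        then have "bdd_above S" by (rule bdd_aboveI)
        moreover have "S \<noteq> {}" using K(1) unfolding S_def by blast
        ultimately have S: "S \<noteq> {}" "bdd_above S" by simp_all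
        \<comment> \<open>Slopes slightly below the supremum are exceeded to the right of
          \<open>x\<close>, slopes slightly above it are not; with a margin \<open>e/2\<close> on
          both sides this is the limit condition.\<close>
        have "Lim x (Sup S)" unfolding Lim_def
        proof (intro allI impI)
          fix e :: real assume e: "e > 0"
          have "\<exists>K. K \<in> S \<and> Sup S - e/2 < K" using less_cSup_iff[OF S, of "Sup S - e/2"] e by auto
          then obtain K where "K \<in> S" "Sup S - e/2 < K" by blast
          then have "U x (Sup S - e/2)" using Udown[of x K "Sup S - e/2"] by (simp add: S_def)
          then obtain d1 where d1: "d1 > 0" "\<And>h. 0 < h \<and> h < d1 \<Longrightarrow> (Sup S - e/2) * h < f (x + h) - f x"
            unfolding U_def by blast
          have "Sup S + e/2 \<notin> S" using cSup_upper[OF _ S(2), of "Sup S + e/2"] e by auto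
          then have "\<not> U x (Sup S + e/2)" by (simp add: S_def)
          from notU[OF this] obtain d2 where d2: "d2 > 0" "\<And>h. 0 < h \<and> h < d2 \<Longrightarrow> f (x + h) - f x \<le> (Sup S + e/2) * h"
            by blast
          have "\<bar>(f (x + h) - f x) - Sup S * h\<bar> < e * h" if "0 < h \<and> h < min d1 d2" for h
          proof -
            have "0 < h * e" using that e by simp
            then show ?thesis using d1(2)[of h] d2(2)[of h] that by (simp add: algebra_simps abs_less_iff)
          qed
          then show "\<exists>d. 0 < d \<and> (\<forall>h. 0 < h \<and> h < d \<longrightarrow> \<bar>(f (x + h) - f x) - Sup S * h\<bar> < e * h)"
            using d1(1) d2(1) by (intro exI[of _ "min d1 d2"]) auto
        qed
        then have "x \<in> T" by (auto simp: T_def)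
        moreover have "x \<in> {c<..<d}" using x 1 by auto
        ultimately show False using no by blast
      qed
    qed
    from countable_cover[OF E 1(2) this] obtain b c2 d2 where
      2: "c1 \<le> c2" "c2 < d2" "d2 \<le> d1" "{c2<..<d2} \<subseteq> E b" by metis
    \<comment> \<open>Points at one third and two thirds, so that the closed interval between them
      lies in the open interval contained in \<open>E b\<close>.\<close>
    define p where "p = c2 + (d2 - c2) / 3"
    define q where "q = c2 + 2 * (d2 - c2) / 3"
    have pq: "c2 < p" "p < q" "q < d2" using 2(2) by (auto simp: p_def q_def field_simps)
    have "isCont f x" if "x \<in> {p..q}" for x
    proof -
      have "x \<in> {c1<..<d1}" using that pq 2 by auto
      then have "x \<notin> F0" using 1(4) by blast
      then show ?thesis by (simp add: F0_def)
    qed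
    then have cont: "continuous_on {p..q} f" by (simp add: continuous_at_imp_continuous_on)
    have in_E: "x \<in> E b" if "p \<le> x" "x < q" for x using that pq 2 by auto
    show False
    proof (cases b)
      case True
      \<comment> \<open>The slope of the chord with its end raised by one unit: growth at this rate
        contradicts the value at \<open>q\<close>. The other case lowers the end by one
        unit.\<close>
      define K where "K = (f q - f p + 1) / (q - p)"
      have "K * (q - p) \<le> f q - f p"
      proof (rule right_growth[OF cont])
        fix x assume "p \<le> x" "x < q"
        then have "U x K" using in_E True by (auto simp: E_def)
        then show "\<exists>e>0. \<forall>h. 0 < h \<and> h < e \<longrightarrow> K * h \<le> f (x + h) - f x"
          unfolding U_def by (auto intro: less_imp_le)
      qed (use pq in simp)
      then show False using pq by (simp add: K_def)
    next
      case False
      define K where "K = (f q - f p - 1) / (q - p)"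
      have "f q - f p \<le> K * (q - p)"
      proof (rule right_growth_le[OF cont])
        fix x assume "p \<le> x" "x < q"
        then have "\<not> U x K" using in_E False by (auto simp: E_def)
        then show "\<exists>e>0. \<forall>h. 0 < h \<and> h < e \<longrightarrow> f (x + h) - f x \<le> K * h"
          using notU by blast
      qed (use pq in simp)
      then show False using pq by (simp add: K_def)
    qed
  qed
  \<comment> \<open>The default \<open>0\<close> outside \<open>T\<close> keeps \<open>f'\<close>
    total and definable; the exceptional set \<open>F\<close> below contains these points.\<close>
  define f' where "f' x = (if x \<in> T then THE L. Lim x L else 0)" for x
  have f'_Lim: "Lim x (f' x)" if xT: "x \<in> T" for x
  proof -
    obtain L where L: "Lim x L" using xT by (auto simp: T_def)
    have "(THE L. Lim x L) = L" by (rule the_equality[where P = "Lim x", OF L unique[OF _ L]])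
    then show ?thesis using xT L by (simp add: f'_def)
  qed
  have f'_iff: "f' x = y \<longleftrightarrow> Lim x y \<or> (x \<notin> T \<and> y = 0)" for x y
  proof (cases "x \<in> T")
    case True
    then show ?thesis using f'_Lim[OF True] unique[of x] by blast
  next
    case False
    then have "\<not> Lim x y" "f' x = 0" by (auto simp: T_def f'_def)
    then show ?thesis using False by auto
  qed
  have "def_pred 2 (\<lambda>v. Lim (v 0) (v 1) \<or> (\<not> v 0 \<in> T \<and> v 1 = 0))"
    unfolding Lim_def by (intro def_pred_rules def_term_app[OF f] def_pred_mem[OF T]) simp_all
  then have f': "def_fun f'" unfolding def_fun_def f'_iff .
  define F where "F = F0 \<union> - T \<union> {x. \<not> isCont f' x}"
  have F: "finite F" unfolding F_def using F0 \<open>finite (- T)\<close> def_fun_continuous[OF f'] by simp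
  have der: "(f has_real_derivative f' x) (at x)" if x: "x \<notin> F" for x
  proof -
    have "open (- F)" using F by (simp add: finite_imp_closed open_Compl)
    then obtain r where r: "r > 0" "ball x r \<subseteq> - F" using x unfolding open_contains_ball by blast
    have "\<exists>d>0. \<forall>y. norm (y - x) < d \<longrightarrow> norm (f y - f x - f' x * (y - x)) \<le> e * norm (y - x)" if e: "e > 0" for e
    proof -
      have "isCont f' x" using x by (simp add: F_def)
      then obtain s where s: "s > 0" "\<And>y. \<bar>y - x\<bar> < s \<Longrightarrow> \<bar>f' y - f' x\<bar> < e/2"
        using e unfolding continuous_at_eps_delta dist_real_def by (meson half_gt_zero)
      define d where "d = min r s"
      have d: "d > 0" using r s by (simp add: d_def)
      \<comment> \<open>Near \<open>x\<close> the right derivatives differ from \<open>f' x\<close>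
        by less than \<open>e/2\<close>, so the growth lemmas enclose the increment between the
        slopes \<open>f' x - e\<close> and \<open>f' x + e\<close>. With \<open>x\<close> as left or
        as right end of the interval this yields the derivative from both sides.\<close>
      have bound: "\<bar>f b - f a - f' x * (b - a)\<bar> \<le> e * (b - a)" if "x - d < a" "a \<le> b" "b < x + d" for a b
      proof -
        have near: "z \<notin> F" "\<bar>f' z - f' x\<bar> < e/2" if "a \<le> z" "z \<le> b" for z
        proof -
          have "\<bar>z - x\<bar> < d" using that \<open>x - d < a\<close> \<open>b < x + d\<close> by linarith
          then have "\<bar>z - x\<bar> < r" "\<bar>z - x\<bar> < s" by (simp_all add: d_def)
          moreover from this have "z \<in> ball x r" by (simp add: dist_real_def abs_minus_commute)
          ultimately show "z \<notin> F" "\<bar>f' z - f' x\<bar> < e/2" using r(2) s(2)[of z] by blast+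
        qed
        have cont: "continuous_on {a..b} f"
          using near by (intro continuous_at_imp_continuous_on) (auto simp: F_def F0_def)
        have step: "\<exists>\<delta>>0. \<forall>h. 0 < h \<and> h < \<delta> \<longrightarrow>
            (f' x - e) * h \<le> f (z + h) - f z \<and> f (z + h) - f z \<le> (f' x + e) * h" if z: "a \<le> z" "z < b" for z
        proof -
          have "z \<in> T" using near[of z] z by (auto simp: F_def)
          moreover have "e / 2 > 0" using e by simp
          ultimately obtain \<delta> where \<delta>: "\<delta> > 0"
            "\<And>h. 0 < h \<and> h < \<delta> \<Longrightarrow> \<bar>(f (z + h) - f z) - f' z * h\<bar> < (e/2) * h"
            using f'_Lim[of z] unfolding Lim_def by blast
          have "(f' x - e) * h \<le> f (z + h) - f z \<and> f (z + h) - f z \<le> (f' x + e) * h" if h: "0 < h \<and> h < \<delta>" for h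
          proof -
            have "\<bar>f' z * h - f' x * h\<bar> \<le> (e/2) * h"
              using near(2)[of z] z h by (simp add: abs_mult left_diff_distrib[symmetric])
            moreover have "\<bar>f (z + h) - f z - f' x * h\<bar> \<le> \<bar>f (z + h) - f z - f' z * h\<bar> + \<bar>f' z * h - f' x * h\<bar>"
              using dist_triangle[of "f (z + h) - f z" "f' x * h" "f' z * h"] unfolding dist_real_def .
            ultimately have "\<bar>f (z + h) - f z - f' x * h\<bar> \<le> e * h" using \<delta>(2)[OF h] by simp
            then show ?thesis by (simp add: abs_le_iff algebra_simps)
          qed
          with \<delta>(1) show ?thesis by blast
        qed
        have "(f' x - e) * (b - a) \<le> f b - f a"
          by (rule right_growth[OF cont that(2)]) (use step in meson)
        moreover have "f b - f a \<le> (f' x + e) * (b - a)"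
          by (rule right_growth_le[OF cont that(2)]) (use step in meson)
        ultimately show ?thesis by (simp add: algebra_simps abs_le_iff)
      qed
      have "norm (f y - f x - f' x * (y - x)) \<le> e * norm (y - x)" if y: "norm (y - x) < d" for y
      proof (cases "x \<le> y")
        case True
        then show ?thesis using bound[of x y] y d by simp
      next
        case False
        have "\<bar>f x - f y - f' x * (x - y)\<bar> = \<bar>f y - f x - f' x * (y - x)\<bar>"
          by (simp add: algebra_simps abs_if)
        then show ?thesis using bound[of y x] y d False by (simp add: abs_less_iff)
      qed
      with d show ?thesis by blast
    qed
    then show ?thesis unfolding has_field_derivative_def has_derivative_at_alt
      by (auto intro: bounded_linear_mult_right)
  qed
  show ?thesis by (rule that[OF f' F der]) (auto simp: F_def)
qed

section \<open>Families of finite sets\<close>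

lemma def_pred_rank:
  assumes Z: "def_family Z" and fin: "\<And>x. finite (Z x)"
  shows "def_pred 2 (\<lambda>v. num_below (Z (v 0)) (v 1) = k)"
proof (induction k)
  case 0
  show ?case unfolding num_below_0[OF fin] by (intro def_pred_rules def_pred_mem2[OF Z]) simp_all
next
  case (Suc k)
  show ?case unfolding num_below_Suc[OF fin]
    by (intro def_pred_rules def_pred_mem2[OF Z] def_pred_app2[OF Suc]) simp_all
qed

lemma def_set_less_card:
  assumes Z: "def_family Z" and fin: "\<And>x. finite (Z x)"
  shows "def_set {x. k < card (Z x)}"
  unfolding less_card_iff_num_below[OF fin]
  by (intro def_setI def_pred_rules def_pred_mem2[OF Z] def_pred_app2[OF def_pred_rank[OF Z fin]]) simp_all

lemma def_set_card_eq:
  assumes Z: "def_family Z" and fin: "\<And>x. finite (Z x)"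
  shows "def_set {x. card (Z x) = k}"
proof -
  have "def_set {x. \<not> x \<in> {x. k < card (Z x)} \<and> (k = 0 \<or> x \<in> {x. k - 1 < card (Z x)})}"
    by (intro def_setI def_pred_not def_pred_conj def_pred_disj def_pred_const def_pred_mem[OF def_set_less_card[OF Z fin]] def_term_var) simp_all
  also have "{x. \<not> x \<in> {x. k < card (Z x)} \<and> (k = 0 \<or> x \<in> {x. k - 1 < card (Z x)})} = {x. card (Z x) = k}"
    by auto
  finally show ?thesis .
qed

lemma def_fun_nth_elem:
  assumes Z: "def_family Z" and fin: "\<And>x. finite (Z x)"
  shows "def_fun (\<lambda>x. nth_smallest (Z x) k)"
  unfolding def_fun_def nth_smallest_iff[OF fin]
  by (intro def_pred_rules def_pred_mem2[OF Z] def_pred_app2[OF def_pred_rank[OF Z fin]]) simp_all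

text \<open>\<open>S\<close> consists of the points near which the sets \<open>Z x'\<close> are
  uniformly separated and converge to \<open>Z x\<close> in the Hausdorff sense. This is a single
  formula, whereas an unbounded cardinality is not, and it forces the cardinality to be locally
  constant. So the cardinality is constant on each of the finitely many classes cut out by the
  complement of \<open>S\<close>.\<close>

lemma uniform_finiteness:
  assumes Z: "def_family Z" and fin: "\<And>x. finite (Z x)"
  obtains N where "\<And>x. card (Z x) \<le> N"
proof -
  define S where "S = {x. (\<exists>e. 0 < e \<and> (\<exists>d. 0 < d \<and> (\<forall>x' y z. \<bar>x' - x\<bar> < d \<and> y \<in> Z x' \<and> z \<in> Z x' \<and> y < z \<longrightarrow> e \<le> z - y)))
    \<and> (\<forall>e. 0 < e \<longrightarrow> (\<exists>d. 0 < d \<and> (\<forall>x'. \<bar>x' - x\<bar> < d \<longrightarrow>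
        (\<forall>y. y \<in> Z x \<longrightarrow> (\<exists>y'. y' \<in> Z x' \<and> \<bar>y - y'\<bar> < e)) \<and>
        (\<forall>y. y \<in> Z x' \<longrightarrow> (\<exists>y'. y' \<in> Z x \<and> \<bar>y - y'\<bar> < e)))))}"
  have S: "def_set S" unfolding S_def by (intro def_setI def_pred_rules def_pred_mem2[OF Z]) simp_all
  have "finite (- S)"
  proof (rule def_set_cofinite[OF S])
    fix c d :: real assume cd: "c < d"
    \<comment> \<open>On each piece the cardinality \<open>n\<close> and a lower bound
      \<open>1 / (m + 1)\<close> for the gaps are fixed. Every \<open>x\<close> belongs to some
      piece because \<open>Z x\<close> is finite.\<close>
    define E where "E = (\<lambda>(n, m). {x. x \<in> {x. card (Z x) = n} \<and>
      (\<forall>y z. y \<in> Z x \<and> z \<in> Z x \<and> y < z \<longrightarrow> inverse (real (Suc m)) \<le> z - y)})"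
    have E: "def_set (E i)" for i unfolding E_def
      by (cases i) (simp only: prod.case, intro def_setI def_pred_rules def_pred_mem2[OF Z] def_pred_mem[OF def_set_card_eq[OF Z fin]]; simp)
    have "{c<..<d} \<subseteq> (\<Union>i. E i)"
    proof
      fix x
      obtain e where e: "e > 0" "\<And>y z. y \<in> Z x \<and> z \<in> Z x \<and> y < z \<Longrightarrow> e \<le> z - y"
        using finite_separation[OF fin[of x]] by blast
      obtain m where m: "inverse (real (Suc m)) < e" using reals_Archimedean[OF e(1)] by blast
      have "x \<in> E (card (Z x), m)" unfolding E_def using e(2) m by (auto intro: order_trans less_imp_le)
      then show "x \<in> (\<Union>i. E i)" by blast
    qed
    from countable_cover[OF E cd this] obtain i c1 d1 where
      1: "c \<le> c1" "c1 < d1" "d1 \<le> d" "{c1<..<d1} \<subseteq> E i" by metis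
    obtain n m where i: "i = (n, m)" by (cases i)
    define \<epsilon> where "\<epsilon> = inverse (real (Suc m))"
    have \<epsilon>: "\<epsilon> > 0" by (simp add: \<epsilon>_def)
    have 2: "card (Z x) = n" "\<And>y z. y \<in> Z x \<and> z \<in> Z x \<and> y < z \<Longrightarrow> \<epsilon> \<le> z - y" if "x \<in> {c1<..<d1}" for x
      using 1(4) that unfolding i E_def \<epsilon>_def by auto
    define g where "g k x = nth_smallest (Z x) k" for k x
    have "finite (\<Union>k<n. {x. \<not> isCont (g k) x})"
      unfolding g_def by (intro finite_UN_I def_fun_continuous def_fun_nth_elem Z fin) simp
    from interval_avoiding_finite[OF this 1(2)] obtain c2 d2 where
      3: "c1 \<le> c2" "c2 < d2" "d2 \<le> d1" "{c2<..<d2} \<inter> (\<Union>k<n. {x. \<not> isCont (g k) x}) = {}" .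
    define x where "x = (c2 + d2) / 2"
    have x: "x \<in> {c2<..<d2}" using 3 by (auto simp: x_def)
    have cont: "isCont (g k) x" if "k < n" for k using x 3(4) that by blast
    define r where "r = (d2 - c2) / 2"
    have r: "r > 0" using 3 by (simp add: r_def)
    have near: "x' \<in> {c1<..<d1}" if "\<bar>x' - x\<bar> < r" for x'
    proof -
      have "c2 < x'" "x' < d2" using that unfolding x_def r_def by (auto simp: abs_less_iff field_simps)
      then show ?thesis using 3 by auto
    qed
    have xx: "x \<in> {c1<..<d1}" using near[of x] r by simp
    have sep: "\<exists>e. 0 < e \<and> (\<exists>d. 0 < d \<and> (\<forall>x' y z. \<bar>x' - x\<bar> < d \<and> y \<in> Z x' \<and> z \<in> Z x' \<and> y < z \<longrightarrow> e \<le> z - y))"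
      using \<epsilon> r near 2(2) by meson
    have hausdorff: "\<exists>d. 0 < d \<and> (\<forall>x'. \<bar>x' - x\<bar> < d \<longrightarrow>
        (\<forall>y. y \<in> Z x \<longrightarrow> (\<exists>y'. y' \<in> Z x' \<and> \<bar>y - y'\<bar> < e)) \<and>
        (\<forall>y. y \<in> Z x' \<longrightarrow> (\<exists>y'. y' \<in> Z x \<and> \<bar>y - y'\<bar> < e)))" if e: "e > 0" for e
    proof -
      have "\<forall>\<^sub>F x' in nhds x. \<forall>k\<in>{..<n}. \<bar>g k x' - g k x\<bar> < e"
      proof (rule eventually_ball_finite)
        show "\<forall>k\<in>{..<n}. \<forall>\<^sub>F x' in nhds x. \<bar>g k x' - g k x\<bar> < e"
        proof
          fix k assume "k \<in> {..<n}"
          then have "isCont (g k) x" using cont by simp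
          then obtain \<delta> where "\<delta> > 0" "\<And>y. \<bar>y - x\<bar> < \<delta> \<Longrightarrow> \<bar>g k y - g k x\<bar> < e"
            using e unfolding continuous_at_eps_delta dist_real_def by blast
          then show "\<forall>\<^sub>F x' in nhds x. \<bar>g k x' - g k x\<bar> < e"
            unfolding eventually_nhds_metric dist_real_def by blast
        qed
      qed simp
      then obtain \<delta> where \<delta>: "\<delta> > 0" "\<And>x' k. \<bar>x' - x\<bar> < \<delta> \<Longrightarrow> k < n \<Longrightarrow> \<bar>g k x' - g k x\<bar> < e"
        unfolding eventually_nhds_metric dist_real_def by (metis lessThan_iff)
      \<comment> \<open>The partner of \<open>y\<close> is the element of the same rank. Letting
        either \<open>a\<close> or \<open>b\<close> be the point \<open>x\<close> yields both halves
        of the Hausdorff condition.\<close>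
      have match: "\<exists>y'. y' \<in> Z b \<and> \<bar>y - y'\<bar> < e"
        if y: "y \<in> Z a" and ab: "\<bar>a - x\<bar> < min r \<delta>" "\<bar>b - x\<bar> < min r \<delta>" "a = x \<or> b = x" for a b y
      proof -
        define k where "k = num_below (Z a) y"
        have ga: "g k a = y" unfolding g_def k_def by (rule nth_smallest_eq[OF fin y refl])
        have "k < n" using num_below_less_card[OF fin y] 2(1)[OF near[of a]] ab(1) by (simp add: k_def)
        moreover have "card (Z b) = n" using 2(1)[OF near[of b]] ab(2) by simp
        ultimately have "g k b \<in> Z b" unfolding g_def using nth_smallest(1)[OF fin] by simp
        moreover have "\<bar>y - g k b\<bar> < e" using \<delta>(2)[of a k] \<delta>(2)[of b k] \<open>k < n\<close> ab ga by (auto simp: abs_minus_commute)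
        ultimately show ?thesis by blast
      qed
      show ?thesis
      proof (rule exI[of _ "min r \<delta>"], intro conjI allI impI)
        show "0 < min r \<delta>" using r \<delta>(1) by simp
        then have xx: "\<bar>x - x\<bar> < min r \<delta>" by simp
        fix x' y assume x': "\<bar>x' - x\<bar> < min r \<delta>"
        show "\<exists>y'. y' \<in> Z x' \<and> \<bar>y - y'\<bar> < e" if "y \<in> Z x" using match[OF that xx x'] by simp
        show "\<exists>y'. y' \<in> Z x \<and> \<bar>y - y'\<bar> < e" if "y \<in> Z x'" using match[OF that x' xx] by simp
      qed
    qed
    have "x \<in> S" unfolding S_def using sep hausdorff by (intro CollectI conjI allI impI)
    moreover have "x \<in> {c<..<d}" using xx 1 by auto
    ultimately show "\<exists>x\<in>{c<..<d}. x \<in> S" by blast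
  qed
  have loc: "\<exists>d>0. \<forall>x'. \<bar>x' - x\<bar> < d \<longrightarrow> card (Z x') = card (Z x)" if x: "x \<in> S" for x
  proof -
    obtain e d where e: "0 < e" "0 < d"
      "\<And>x' y z. \<bar>x' - x\<bar> < d \<and> y \<in> Z x' \<and> z \<in> Z x' \<and> y < z \<Longrightarrow> e \<le> z - y"
      using x unfolding S_def by blast
    \<comment> \<open>Half the separation, since \<open>card_le_of_close\<close> asks for gaps of
      twice the tolerance. It is applied with \<open>Z x\<close> and with \<open>Z x'\<close> in the
      role of the separated set.\<close>
    have "0 < e / 2" using e by simp
    from x[unfolded S_def, THEN CollectD, THEN conjunct2, THEN spec, THEN mp, OF this]
    obtain d' where d'0: "0 < d'" "\<forall>x'. \<bar>x' - x\<bar> < d' \<longrightarrow>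
        (\<forall>y. y \<in> Z x \<longrightarrow> (\<exists>y'. y' \<in> Z x' \<and> \<bar>y - y'\<bar> < e/2)) \<and>
        (\<forall>y. y \<in> Z x' \<longrightarrow> (\<exists>y'. y' \<in> Z x \<and> \<bar>y - y'\<bar> < e/2))" by (elim exE conjE)
    have d': "0 < d'"
      "\<And>x' y. \<bar>x' - x\<bar> < d' \<Longrightarrow> y \<in> Z x \<Longrightarrow> \<exists>y'. y' \<in> Z x' \<and> \<bar>y - y'\<bar> < e/2"
      "\<And>x' y. \<bar>x' - x\<bar> < d' \<Longrightarrow> y \<in> Z x' \<Longrightarrow> \<exists>y'. y' \<in> Z x \<and> \<bar>y - y'\<bar> < e/2"
      using d'0 by simp_all
    have "card (Z x') = card (Z x)" if x': "\<bar>x' - x\<bar> < min d d'" for x'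
    proof (rule antisym)
      show "card (Z x') \<le> card (Z x)"
      proof (rule card_le_of_close[OF fin, where e = "e/2"])
        show "2 * (e/2) \<le> z - y" if "y \<in> Z x'" "z \<in> Z x'" "y < z" for y z
          using e(3)[of x' y z] x' that by simp
        show "\<exists>y'. y' \<in> Z x \<and> \<bar>y - y'\<bar> < e/2" if "y \<in> Z x'" for y
          using d'(3)[OF _ that] x' by simp
      qed
      show "card (Z x) \<le> card (Z x')"
      proof (rule card_le_of_close[OF fin, where e = "e/2"])
        show "2 * (e/2) \<le> z - y" if "y \<in> Z x" "z \<in> Z x" "y < z" for y z
          using e(3)[of x y z] e(2) that by simp
        show "\<exists>y'. y' \<in> Z x' \<and> \<bar>y - y'\<bar> < e/2" if "y \<in> Z x" for y
          using d'(2)[OF _ that] x' by simp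
      qed
    qed
    moreover have "0 < min d d'" using e(2) d'(1) by simp
    ultimately show ?thesis by blast
  qed
  let ?F = "- S"
  have const: "card (Z y) = card (Z x)" if "y \<in> line_class ?F x" for x y
  proof (cases "x \<in> ?F")
    case True
    then show ?thesis using that line_class_point[OF \<open>finite ?F\<close>] by simp
  next
    case False
    note I = line_class_interval[OF \<open>finite ?F\<close> False]
    have "connected (line_class ?F x)" using I(2) by (simp add: is_interval_connected_1)
    moreover have "\<exists>T. openin (top_of_set (line_class ?F x)) T \<and> a \<in> T \<and> (\<forall>u\<in>T. card (Z u) = card (Z a))"
      if a: "a \<in> line_class ?F x" for a
    proof -
      have "a \<in> S" using a I(3) by blast
      from loc[OF this] obtain d where "d > 0" "\<forall>x'. \<bar>x' - a\<bar> < d \<longrightarrow> card (Z x') = card (Z a)" by blast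
      moreover have "\<bar>u - a\<bar> < d" if "u \<in> ball a d" for u
        using that by (simp add: dist_real_def abs_minus_commute)
      ultimately show ?thesis using a
        by (intro exI[of _ "line_class ?F x \<inter> ball a d"] conjI ballI) (simp add: openin_open_Int, simp, blast)
    qed
    ultimately have "(\<lambda>u. card (Z u)) constant_on line_class ?F x"
      by (rule locally_constant_imp_constant)
    then show ?thesis using that I(4) unfolding constant_on_def by metis
  qed
  \<comment> \<open>One representative of each of the finitely many classes already yields every
    value of the cardinality.\<close>
  have "range (\<lambda>x. card (Z x)) \<subseteq> (\<lambda>B. card (Z (SOME y. y \<in> B))) ` range (line_class ?F)"
  proof
    fix n assume "n \<in> range (\<lambda>x. card (Z x))"
    then obtain x where n: "n = card (Z x)" by blast
    have "x \<in> line_class ?F x" by (simp add: line_class_def)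
    then have "(SOME y. y \<in> line_class ?F x) \<in> line_class ?F x" by (rule someI)
    from const[OF this] show "n \<in> (\<lambda>B. card (Z (SOME y. y \<in> B))) ` range (line_class ?F)"
      unfolding n by (metis rangeI image_eqI)
  qed
  moreover have "finite (range (line_class ?F))"
    using line_class_decomposition[OF \<open>finite ?F\<close>] by (simp add: line_decomposition_def)
  ultimately have "finite (range (\<lambda>x. card (Z x)))" using finite_subset by blast
  then show ?thesis using that[of "Max (range (\<lambda>x. card (Z x)))"] by (metis Max_ge rangeI)
qed

text \<open>If every point of an interval were exceptional, countability would give a subinterval on
  which the germ condition holds up to one common height \<open>1 / (n + 1)\<close>; but then its
  midpoint is not exceptional.\<close>

lemma germ_locally_uniform:
  assumes A: "def_family A"
  shows "finite {x. (\<exists>e>0. \<forall>h. 0 < h \<and> h < e \<longrightarrow> h \<in> A x) \<and>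
    \<not> (\<exists>e>0. \<exists>d>0. \<forall>x' h. \<bar>x' - x\<bar> < d \<and> 0 < h \<and> h < e \<longrightarrow> h \<in> A x')}"
proof -
  define G where "G x \<longleftrightarrow> (\<exists>e. 0 < e \<and> (\<forall>h. 0 < h \<and> h < e \<longrightarrow> h \<in> A x))" for x
  define L where "L x \<longleftrightarrow> (\<exists>e. 0 < e \<and> (\<exists>d. 0 < d \<and> (\<forall>x' h. \<bar>x' - x\<bar> < d \<and> 0 < h \<and> h < e \<longrightarrow> h \<in> A x')))" for x
  define S where "S = {x. G x \<longrightarrow> L x}"
  have S: "def_set S" unfolding S_def G_def L_def by (intro def_setI def_pred_rules def_pred_mem2[OF A]) simp_all
  have "finite (- S)"
  proof (rule def_set_cofinite[OF S], rule ccontr)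
    fix c d :: real assume cd: "c < d" and no: "\<not> (\<exists>x\<in>{c<..<d}. x \<in> S)"
    define E where "E n = {x. \<forall>h. 0 < h \<and> h < inverse (real (Suc n)) \<longrightarrow> h \<in> A x}" for n
    have E: "def_set (E n)" for n unfolding E_def by (intro def_setI def_pred_rules def_pred_mem2[OF A]) simp_all
    have "{c<..<d} \<subseteq> (\<Union>n. E n)"
    proof
      fix x assume "x \<in> {c<..<d}"
      then have "G x" using no by (auto simp: S_def)
      then obtain e where e: "e > 0" "\<And>h. 0 < h \<and> h < e \<Longrightarrow> h \<in> A x" unfolding G_def by blast
      obtain n where "inverse (real (Suc n)) < e" using reals_Archimedean[OF e(1)] by blast
      then have "x \<in> E n" unfolding E_def using e(2) by auto
      then show "x \<in> (\<Union>n. E n)" by blast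
    qed
    from countable_cover[OF E cd this] obtain n c1 d1 where
      1: "c \<le> c1" "c1 < d1" "d1 \<le> d" "{c1<..<d1} \<subseteq> E n" by metis
    define x where "x = (c1 + d1) / 2"
    have x: "x \<in> {c<..<d}" using 1 by (auto simp: x_def)
    have "x' \<in> E n" if "\<bar>x' - x\<bar> < (d1 - c1) / 2" for x'
    proof -
      have "c1 < x'" "x' < d1" using that unfolding x_def by (auto simp: abs_less_iff field_simps)
      then show ?thesis using 1(4) by auto
    qed
    then have "\<forall>x' h. \<bar>x' - x\<bar> < (d1 - c1) / 2 \<and> 0 < h \<and> h < inverse (real (Suc n)) \<longrightarrow> h \<in> A x'"
      unfolding E_def by blast
    moreover have "0 < (d1 - c1) / 2" "0 < inverse (real (Suc n))" using 1 by simp_all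
    ultimately have "L x" unfolding L_def by blast
    then show False using no x by (auto simp: S_def)
  qed
  moreover have "{x. (\<exists>e>0. \<forall>h. 0 < h \<and> h < e \<longrightarrow> h \<in> A x) \<and>
    \<not> (\<exists>e>0. \<exists>d>0. \<forall>x' h. \<bar>x' - x\<bar> < d \<and> 0 < h \<and> h < e \<longrightarrow> h \<in> A x')} \<subseteq> - S"
    unfolding S_def G_def L_def by blast
  ultimately show ?thesis using finite_subset by blast
qed

end

section \<open>Local existence and uniqueness of integral curves\<close>

text \<open>Required on all closed balls, not only on small ones. For C1 maps this holds because
  closed balls are compact and convex, and it allows \<open>local_flow\<close> to cut the field off
  at a ball of given radius.\<close>

definition locally_lipschitz :: "('a::metric_space \<Rightarrow> 'b::metric_space) \<Rightarrow> bool"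
  where "locally_lipschitz f \<longleftrightarrow> (\<forall>p R. \<exists>K\<ge>0. \<forall>x\<in>cball p R. \<forall>y\<in>cball p R. dist (f x) (f y) \<le> K * dist x y)"

lemma locally_lipschitz_C1:
  fixes f :: "'a::euclidean_space \<Rightarrow> 'b::real_normed_vector"
  assumes "C1_on UNIV f" shows "locally_lipschitz f"
  unfolding locally_lipschitz_def
proof (intro allI)
  fix p :: 'a and R :: real
  obtain f' :: "'a \<Rightarrow> 'a \<Rightarrow>\<^sub>L 'b" where f': "\<And>z. (f has_derivative blinfun_apply (f' z)) (at z)" "continuous_on UNIV f'"
    using assms unfolding C1_on_def by auto
  have "compact (f' ` cball p R)"
    by (intro compact_continuous_image continuous_on_subset[OF f'(2)]) auto
  then obtain K where K: "K > 0" "\<And>z. z \<in> cball p R \<Longrightarrow> norm (f' z) \<le> K"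
    using compact_imp_bounded[of "f' ` cball p R"] unfolding bounded_pos by blast
  have "dist (f x) (f y) \<le> K * dist x y" if "x \<in> cball p R" "y \<in> cball p R" for x y
    unfolding dist_norm
    by (rule differentiable_bound[of "cball p R" f "\<lambda>z. blinfun_apply (f' z)"])
      (use that K f'(1) in \<open>auto simp: norm_blinfun.rep_eq[symmetric] intro: has_derivative_at_withinI\<close>)
  with K(1) show "\<exists>K\<ge>0. \<forall>x\<in>cball p R. \<forall>y\<in>cball p R. dist (f x) (f y) \<le> K * dist x y"
    by (intro exI[of _ K]) auto
qed

lemma locally_lipschitz_Pair:
  fixes f :: "'a::metric_space \<Rightarrow> 'b::real_normed_vector" and g :: "'a \<Rightarrow> 'c::real_normed_vector"
  assumes "locally_lipschitz f" "locally_lipschitz g"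
  shows "locally_lipschitz (\<lambda>x. (f x, g x))"
  unfolding locally_lipschitz_def
proof (intro allI)
  fix p :: 'a and R :: real
  obtain K where K: "K \<ge> 0" "\<And>x y. x \<in> cball p R \<Longrightarrow> y \<in> cball p R \<Longrightarrow> dist (f x) (f y) \<le> K * dist x y"
    using assms(1) unfolding locally_lipschitz_def by blast
  obtain L where L: "L \<ge> 0" "\<And>x y. x \<in> cball p R \<Longrightarrow> y \<in> cball p R \<Longrightarrow> dist (g x) (g y) \<le> L * dist x y"
    using assms(2) unfolding locally_lipschitz_def by blast
  have "dist (f x, g x) (f y, g y) \<le> (K + L) * dist x y" if "x \<in> cball p R" "y \<in> cball p R" for x y
  proof -
    have "dist (f x, g x) (f y, g y) \<le> dist (f x) (f y) + dist (g x) (g y)"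
      unfolding dist_prod_def by (simp add: sqrt_sum_squares_le_sum)
    then show ?thesis using K(2)[OF that] L(2)[OF that] by (simp add: algebra_simps)
  qed
  with K(1) L(1) show "\<exists>K\<ge>0. \<forall>x\<in>cball p R. \<forall>y\<in>cball p R. dist (f x, g x) (f y, g y) \<le> K * dist x y"
    by (intro exI[of _ "K + L"]) auto
qed

lemma locally_lipschitz_uminus:
  fixes f :: "'a::metric_space \<Rightarrow> 'b::real_normed_vector"
  shows "locally_lipschitz f \<Longrightarrow> locally_lipschitz (\<lambda>x. - f x)"
  unfolding locally_lipschitz_def by (simp add: dist_minus)

lemma locally_lipschitz_continuous:
  assumes "locally_lipschitz f" shows "isCont f x"
proof -
  obtain K where K: "K \<ge> 0" "\<forall>x'\<in>cball x 1. \<forall>y\<in>cball x 1. dist (f x') (f y) \<le> K * dist x' y"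
    using assms unfolding locally_lipschitz_def by blast
  show ?thesis unfolding continuous_at_eps_delta
  proof (intro allI impI)
    fix e :: real assume e: "e > 0"
    have "dist (f y) (f x) < e" if y: "dist y x < min 1 (e / (K + 1))" for y
    proof -
      have "dist (f y) (f x) \<le> K * dist y x" using K(2) y by (auto simp: dist_commute)
      also have "\<dots> \<le> (K + 1) * dist y x" by (simp add: mult_right_mono)
      also have "\<dots> < (K + 1) * (e / (K + 1))" using y K(1) by (intro mult_strict_left_mono) auto
      finally show ?thesis using K(1) by simp
    qed
    moreover have "min 1 (e / (K + 1)) > 0" using e K(1) by simp
    ultimately show "\<exists>d>0. \<forall>x'. dist x' x < d \<longrightarrow> dist (f x') (f x) < e" by blast
  qed
qed

lemma vector_derivative_bound:
  fixes \<gamma> :: "real \<Rightarrow> 'a::real_normed_vector"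
  assumes "convex S" and "\<And>t. t \<in> S \<Longrightarrow> (\<gamma> has_vector_derivative \<gamma>' t) (at t within S)"
    and "\<And>t. t \<in> S \<Longrightarrow> norm (\<gamma>' t) \<le> B" and "s \<in> S" "t \<in> S"
  shows "norm (\<gamma> t - \<gamma> s) \<le> B * \<bar>t - s\<bar>"
proof -
  have "norm (\<gamma> t - \<gamma> s) \<le> B * norm (t - s)"
  proof (rule differentiable_bound[OF assms(1)])
    show "(\<gamma> has_derivative (\<lambda>h. h *\<^sub>R \<gamma>' x)) (at x within S)" if "x \<in> S" for x
      using assms(2)[OF that] by (simp add: has_vector_derivative_def)
    show "onorm (\<lambda>h. h *\<^sub>R \<gamma>' x) \<le> B" if "x \<in> S" for x
      using assms(3)[OF that] by (intro onorm_le) (simp add: mult.commute[of B] mult_left_mono)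
  qed (use assms in auto)
  then show ?thesis by simp
qed

text \<open>Picard iteration. The paths are bounded continuous functions on the whole line, a
  complete type to which the fixed point theorem applies; for this purpose the time is clamped to
  \<open>{-\<tau>..\<tau>}\<close> by \<open>c\<close>. The integrals start at
  \<open>-\<tau>\<close>, so two of them, each over a length of at most \<open>2 * \<tau>\<close>,
  enter the estimate; hence the factor \<open>4 * \<tau> * K\<close>.\<close>

lemma lipschitz_solution:
  fixes X :: "'a::euclidean_space \<Rightarrow> 'a"
  assumes lip: "\<And>x y. dist (X x) (X y) \<le> K * dist x y" and K: "K \<ge> 0" and \<tau>: "\<tau> > 0" "4 * \<tau> * K < 1"
  obtains \<sigma> where "\<sigma> 0 = q" "\<And>t. t \<in> {-\<tau><..<\<tau>} \<Longrightarrow> (\<sigma> has_vector_derivative X (\<sigma> t)) (at t)"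
proof -
  have contX: "continuous_on UNIV X"
    by (rule lipschitz_on_continuous_on[of K]) (use lip K in \<open>auto simp: lipschitz_on_def\<close>)
  define c where "c t = max (-\<tau>) (min t \<tau>)" for t
  have c: "c t \<in> {-\<tau>..\<tau>}" for t using \<tau> by (auto simp: c_def)
  have contc: "continuous_on UNIV c" unfolding c_def by (intro continuous_intros)
  define F where "F \<phi> t = q + integral {-\<tau>..c t} (\<lambda>s. X (apply_bcontfun \<phi> s)) - integral {-\<tau>..0} (\<lambda>s. X (apply_bcontfun \<phi> s))" for \<phi> :: "real \<Rightarrow>\<^sub>C 'a" and t
  have contXp: "continuous_on S (\<lambda>s. X (apply_bcontfun \<phi> s))" for \<phi> :: "real \<Rightarrow>\<^sub>C 'a" and S
    by (rule continuous_on_compose2[OF contX]) (auto intro: continuous_intros)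
  have int: "(\<lambda>s. X (apply_bcontfun \<phi> s)) integrable_on {a..b}" for \<phi> :: "real \<Rightarrow>\<^sub>C 'a" and a b
    by (rule integrable_continuous_real[OF contXp])
  have contI: "continuous_on {-\<tau>..\<tau>} (\<lambda>u. integral {-\<tau>..u} (\<lambda>s. X (apply_bcontfun \<phi> s)))" for \<phi> :: "real \<Rightarrow>\<^sub>C 'a"
    by (rule indefinite_integral_continuous_1[OF int])
  have F: "F \<phi> \<in> bcontfun" for \<phi>
  proof -
    have "continuous_on UNIV (F \<phi>)" unfolding F_def
      by (intro continuous_intros continuous_on_compose2[OF contI contc]) (use c in auto)
    moreover have "bounded (range (F \<phi>))"
    proof -
      have "bounded ((\<lambda>u. q + integral {-\<tau>..u} (\<lambda>s. X (apply_bcontfun \<phi> s)) - integral {-\<tau>..0} (\<lambda>s. X (apply_bcontfun \<phi> s))) ` {-\<tau>..\<tau>})"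
        by (intro compact_imp_bounded compact_continuous_image continuous_intros contI) auto
      then show ?thesis by (rule bounded_subset) (use c in \<open>auto simp: F_def\<close>)
    qed
    ultimately show ?thesis by (simp add: bcontfun_def)
  qed
  define T where "T \<phi> = Bcontfun (F \<phi>)" for \<phi>
  have T: "apply_bcontfun (T \<phi>) t = F \<phi> t" for \<phi> t unfolding T_def by (simp add: Bcontfun_inverse F)
  have "dist (T \<phi>) (T \<psi>) \<le> (4 * \<tau> * K) * dist \<phi> \<psi>" for \<phi> \<psi>
  proof (rule dist_bound)
    fix t
    let ?d = "\<lambda>s. X (apply_bcontfun \<phi> s) - X (apply_bcontfun \<psi> s)"
    have bd: "norm (integral {-\<tau>..u} ?d) \<le> (K * dist \<phi> \<psi>) * (2 * \<tau>)" if u: "u \<in> {-\<tau>..\<tau>}" for u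
    proof -
      have "norm (integral {-\<tau>..u} ?d) \<le> (K * dist \<phi> \<psi>) * (u - (-\<tau>))"
      proof (rule integral_bound)
        show "continuous_on {-\<tau>..u} ?d" by (intro continuous_intros contXp)
        fix s
        have "norm (?d s) \<le> K * dist (apply_bcontfun \<phi> s) (apply_bcontfun \<psi> s)"
          using lip by (simp add: dist_norm)
        also have "\<dots> \<le> K * dist \<phi> \<psi>" by (intro mult_left_mono dist_bounded K)
        finally show "norm (?d s) \<le> K * dist \<phi> \<psi>" .
      qed (use u in auto)
      also have "\<dots> \<le> (K * dist \<phi> \<psi>) * (2 * \<tau>)" using u K by (intro mult_left_mono) auto
      finally show ?thesis .
    qed
    have "F \<phi> t - F \<psi> t = integral {-\<tau>..c t} ?d - integral {-\<tau>..0} ?d"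
      unfolding F_def by (simp add: integral_diff int)
    then have "dist (F \<phi> t) (F \<psi> t) \<le> norm (integral {-\<tau>..c t} ?d) + norm (integral {-\<tau>..0} ?d)"
      by (simp add: dist_norm norm_triangle_ineq4)
    also have "\<dots> \<le> (K * dist \<phi> \<psi>) * (2 * \<tau>) + (K * dist \<phi> \<psi>) * (2 * \<tau>)"
      using bd[OF c[of t]] bd[of 0] \<tau> by (intro add_mono) auto
    also have "\<dots> = (4 * \<tau> * K) * dist \<phi> \<psi>" by simp
    finally show "dist (apply_bcontfun (T \<phi>) t) (apply_bcontfun (T \<psi>) t) \<le> (4 * \<tau> * K) * dist \<phi> \<psi>"
      unfolding T .
  qed
  then obtain \<phi> where \<phi>: "T \<phi> = \<phi>"
    using banach_fix_type[of "4 * \<tau> * K" T] K \<tau> by auto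
  define \<sigma> where "\<sigma> = apply_bcontfun \<phi>"
  have \<sigma>: "\<sigma> t = F \<phi> t" for t using T[of \<phi> t] \<phi> by (simp add: \<sigma>_def)
  show thesis
  proof (rule that[of \<sigma>])
    have "c 0 = 0" using \<tau> by (simp add: c_def)
    then show "\<sigma> 0 = q" by (simp add: \<sigma> F_def)
    fix t assume t: "t \<in> {-\<tau><..<\<tau>}"
    have "((\<lambda>u. integral {-\<tau>..u} (\<lambda>s. X (apply_bcontfun \<phi> s))) has_vector_derivative X (apply_bcontfun \<phi> t)) (at t within {-\<tau>..\<tau>})"
      by (rule integral_has_vector_derivative[OF contXp]) (use t in auto)
    then have "((\<lambda>u. integral {-\<tau>..u} (\<lambda>s. X (apply_bcontfun \<phi> s))) has_vector_derivative X (\<sigma> t)) (at t)"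
      using t by (simp add: at_within_Icc_at \<sigma>_def)
    then have "((\<lambda>u. q + integral {-\<tau>..u} (\<lambda>s. X (apply_bcontfun \<phi> s)) - integral {-\<tau>..0} (\<lambda>s. X (apply_bcontfun \<phi> s))) has_vector_derivative X (\<sigma> t)) (at t)"
      by (auto intro!: derivative_eq_intros)
    then show "(\<sigma> has_vector_derivative X (\<sigma> t)) (at t)"
    proof (rule has_vector_derivative_transform_within_open[of _ _ _ "{-\<tau><..<\<tau>}"])
      show "q + integral {-\<tau>..u} (\<lambda>s. X (apply_bcontfun \<phi> s)) - integral {-\<tau>..0} (\<lambda>s. X (apply_bcontfun \<phi> s)) = \<sigma> u"
        if "u \<in> {-\<tau><..<\<tau>}" for u
        using that by (simp add: \<sigma> F_def c_def)
    qed (use t in auto)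
  qed
qed

text \<open>Composed with the projection onto the closed ball the field becomes globally Lipschitz
  and bounded, and solutions that stay in the ball solve the original equation. What matters later
  is that \<open>\<tau>\<close> and \<open>M\<close> serve all starting points in the half
  ball.\<close>

lemma local_flow:
  fixes \<xi> :: "'a::euclidean_space \<Rightarrow> 'a"
  assumes lip: "locally_lipschitz \<xi>" and R: "R > 0"
  obtains \<tau> M where "\<tau> > 0" "M \<ge> 0"
    "\<And>q. q \<in> ball p (R/2) \<Longrightarrow> \<exists>\<sigma>. \<sigma> 0 = q \<and> (\<forall>t\<in>{-\<tau><..<\<tau>}. \<sigma> t \<in> ball p R \<and>
      (\<sigma> has_vector_derivative \<xi> (\<sigma> t)) (at t) \<and> dist (\<sigma> t) q \<le> M * \<bar>t\<bar>)"
proof -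
  define P where "P = closest_point (cball p R)"
  define X where "X z = \<xi> (P z)" for z
  obtain K where K: "K \<ge> 0" "\<And>x y. x \<in> cball p R \<Longrightarrow> y \<in> cball p R \<Longrightarrow> dist (\<xi> x) (\<xi> y) \<le> K * dist x y"
    using lip unfolding locally_lipschitz_def by blast
  have Pin: "P z \<in> cball p R" for z unfolding P_def using R by (intro closest_point_in_set) auto
  have Pid: "P z = z" if "z \<in> cball p R" for z unfolding P_def using that by (rule closest_point_self)
  have Plip: "dist (P x) (P y) \<le> dist x y" for x y
    unfolding P_def using R by (intro closest_point_lipschitz) auto
  have Xlip: "dist (X x) (X y) \<le> K * dist x y" for x y
  proof -
    have "dist (X x) (X y) \<le> K * dist (P x) (P y)" unfolding X_def by (rule K(2)[OF Pin Pin])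
    also have "\<dots> \<le> K * dist x y" by (rule mult_left_mono[OF Plip K(1)])
    finally show ?thesis .
  qed
  define M where "M = norm (\<xi> p) + K * R"
  have M: "M \<ge> 0" using K R by (simp add: M_def)
  have XM: "norm (X z) \<le> M" for z
  proof -
    have "dist (X z) (\<xi> p) \<le> K * dist (P z) p" unfolding X_def using Pin R by (intro K(2)) auto
    also have "\<dots> \<le> K * R" using Pin[of z] K by (intro mult_left_mono) (auto simp: dist_commute)
    finally have "norm (X z - \<xi> p) \<le> K * R" by (simp add: dist_norm)
    then show ?thesis using norm_triangle_sub[of "X z" "\<xi> p"] by (simp add: M_def)
  qed
  \<comment> \<open>The first bound gives the contraction condition
    \<open>4 * \<tau> * K < 1\<close>, the second one keeps a solution within \<open>R / 2\<close>
    of its start.\<close>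
  define \<tau> where "\<tau> = min (1 / (8 * (K + 1))) (R / (2 * (M + 1)))"
  have \<tau>: "\<tau> > 0" using K M R by (simp add: \<tau>_def)
  have "4 * \<tau> * K \<le> 4 * (1 / (8 * (K + 1))) * K" using K by (intro mult_right_mono) (auto simp: \<tau>_def)
  also have "\<dots> < 1" using K by (simp add: field_simps)
  finally have \<tau>K: "4 * \<tau> * K < 1" .
  have \<tau>M: "M * \<tau> < R / 2"
  proof -
    have "M * \<tau> \<le> M * (R / (2 * (M + 1)))" using M by (intro mult_left_mono) (auto simp: \<tau>_def)
    also have "\<dots> < R / 2" using M R by (simp add: field_simps)
    finally show ?thesis .
  qed
  show thesis
  proof (rule that[OF \<tau> M])
    fix q assume q: "q \<in> ball p (R/2)"
    obtain \<sigma> where \<sigma>: "\<sigma> 0 = q" "\<And>t. t \<in> {-\<tau><..<\<tau>} \<Longrightarrow> (\<sigma> has_vector_derivative X (\<sigma> t)) (at t)"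
      by (rule lipschitz_solution[OF Xlip K(1) \<tau> \<tau>K, of q]) (rule that)
    have near: "dist (\<sigma> t) q \<le> M * \<bar>t\<bar>" if "t \<in> {-\<tau><..<\<tau>}" for t
    proof -
      have "norm (\<sigma> t - \<sigma> 0) \<le> M * \<bar>t - 0\<bar>"
        by (rule vector_derivative_bound[of "{-\<tau><..<\<tau>}" \<sigma> "\<lambda>t. X (\<sigma> t)"])
          (use that \<tau> XM \<sigma>(2) in \<open>auto intro: has_vector_derivative_at_within\<close>)
      then show ?thesis by (simp add: \<sigma>(1) dist_norm)
    qed
    have in_ball: "\<sigma> t \<in> ball p R" if t: "t \<in> {-\<tau><..<\<tau>}" for t
    proof -
      have "M * \<bar>t\<bar> \<le> M * \<tau>" using t M by (intro mult_left_mono) auto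
      then have "dist (\<sigma> t) q < R / 2" using near[OF t] \<tau>M by linarith
      moreover have "dist p q < R / 2" using q by simp
      ultimately have "dist p (\<sigma> t) < R" using dist_triangle[of p "\<sigma> t" q] by (simp add: dist_commute)
      then show ?thesis by simp
    qed
    have "(\<sigma> has_vector_derivative \<xi> (\<sigma> t)) (at t)" if t: "t \<in> {-\<tau><..<\<tau>}" for t
      using \<sigma>(2)[OF t] Pid[of "\<sigma> t"] in_ball[OF t] by (simp add: X_def)
    then show "\<exists>\<sigma>. \<sigma> 0 = q \<and> (\<forall>t\<in>{-\<tau><..<\<tau>}. \<sigma> t \<in> ball p R \<and>
      (\<sigma> has_vector_derivative \<xi> (\<sigma> t)) (at t) \<and> dist (\<sigma> t) q \<le> M * \<bar>t\<bar>)"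
      using \<sigma>(1) in_ball near by blast
  qed
qed

text \<open>The set of agreement is closed and open in \<open>I\<close>. For openness let the
  distance of the two curves be maximal at \<open>m\<close> on an interval of radius
  \<open>d < 1 / (K + 1)\<close>: the mean value inequality bounds the maximum by itself times
  \<open>K * d < 1\<close>, so it is zero.\<close>

lemma flow_unique:
  fixes \<xi> :: "'a::euclidean_space \<Rightarrow> 'a"
  assumes lip: "locally_lipschitz \<xi>" and I: "open I" "is_interval I"
    and \<alpha>: "\<And>t. t \<in> I \<Longrightarrow> (\<alpha> has_vector_derivative \<xi> (\<alpha> t)) (at t)"
    and \<beta>: "\<And>t. t \<in> I \<Longrightarrow> (\<beta> has_vector_derivative \<xi> (\<beta> t)) (at t)"
    and t0: "t0 \<in> I" "\<alpha> t0 = \<beta> t0" and t: "t \<in> I"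
  shows "\<alpha> t = \<beta> t"
proof -
  define S where "S = {s\<in>I. \<alpha> s = \<beta> s}"
  have cont: "continuous_on I \<alpha>" "continuous_on I \<beta>"
    using \<alpha> \<beta> by (auto intro!: continuous_at_imp_continuous_on has_vector_derivative_continuous)
  have "closedin (top_of_set I) S"
    using continuous_closedin_preimage_constant[OF continuous_on_diff[OF cont], of 0] by (simp add: S_def)
  moreover have "open S" unfolding open_contains_ball
  proof
    fix s assume "s \<in> S"
    then have s: "s \<in> I" "\<alpha> s = \<beta> s" by (auto simp: S_def)
    obtain K where K: "K \<ge> 0" "\<And>x y. x \<in> cball (\<alpha> s) 1 \<Longrightarrow> y \<in> cball (\<alpha> s) 1 \<Longrightarrow> dist (\<xi> x) (\<xi> y) \<le> K * dist x y"
      using lip unfolding locally_lipschitz_def by blast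
    obtain r where r: "r > 0" "ball s r \<subseteq> I" using I(1) s(1) unfolding open_contains_ball by blast
    have "isCont \<alpha> s" "isCont \<beta> s" using \<alpha>[OF s(1)] \<beta>[OF s(1)] has_vector_derivative_continuous by blast+
    then obtain da db where d: "da > 0" "db > 0" "\<And>u. dist u s < da \<Longrightarrow> dist (\<alpha> u) (\<alpha> s) < 1"
      "\<And>u. dist u s < db \<Longrightarrow> dist (\<beta> u) (\<alpha> s) < 1"
      unfolding continuous_at_eps_delta s(2) by (metis zero_less_one)
    define e where "e = 1 / (K + 1)"
    have "e > 0" using K(1) by (simp add: e_def)
    define d where "d = min (min r da) (min db e) / 2"
    have dpos: "d > 0" using r d \<open>e > 0\<close> by (simp add: d_def)
    have dle: "d < r" "d < da" "d < db" "d < e" unfolding d_def min_def using \<open>e > 0\<close> r(1) d(1,2) by (simp_all split: if_splits)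
    let ?J = "{s - d..s + d}"
    have J: "u \<in> I" "\<alpha> u \<in> cball (\<alpha> s) 1" "\<beta> u \<in> cball (\<alpha> s) 1" if "u \<in> ?J" for u
    proof -
      have "\<bar>u - s\<bar> \<le> d" using that by auto
      then have *: "dist u s < r" "dist u s < da" "dist u s < db" using dle by (simp_all add: dist_real_def)
      then show "u \<in> I" using r by (auto simp: dist_commute)
      show "\<alpha> u \<in> cball (\<alpha> s) 1" "\<beta> u \<in> cball (\<alpha> s) 1"
        using d(3)[OF *(2)] d(4)[OF *(3)] by (simp_all add: dist_commute)
    qed
    have "continuous_on ?J (\<lambda>u. norm (\<alpha> u - \<beta> u))"
      by (intro continuous_intros continuous_on_subset[OF cont(1)] continuous_on_subset[OF cont(2)]) (use J in auto)
    then obtain m where m: "m \<in> ?J" "\<And>u. u \<in> ?J \<Longrightarrow> norm (\<alpha> u - \<beta> u) \<le> norm (\<alpha> m - \<beta> m)"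
      using continuous_attains_sup[of ?J "\<lambda>u. norm (\<alpha> u - \<beta> u)"] dpos by auto
    define W where "W = norm (\<alpha> m - \<beta> m)"
    have "norm ((\<alpha> m - \<beta> m) - (\<alpha> s - \<beta> s)) \<le> (K * W) * \<bar>m - s\<bar>"
    proof (rule vector_derivative_bound[of ?J "\<lambda>u. \<alpha> u - \<beta> u" "\<lambda>u. \<xi> (\<alpha> u) - \<xi> (\<beta> u)"])
      show "((\<lambda>u. \<alpha> u - \<beta> u) has_vector_derivative \<xi> (\<alpha> u) - \<xi> (\<beta> u)) (at u within ?J)" if "u \<in> ?J" for u
        using has_vector_derivative_diff[OF \<alpha> \<beta>, OF J(1)[OF that] J(1)[OF that]] has_vector_derivative_at_within by blast
      show "norm (\<xi> (\<alpha> u) - \<xi> (\<beta> u)) \<le> K * W" if "u \<in> ?J" for u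
      proof -
        have "dist (\<xi> (\<alpha> u)) (\<xi> (\<beta> u)) \<le> K * dist (\<alpha> u) (\<beta> u)" by (rule K(2)[OF J(2,3)[OF that]])
        also have "\<dots> \<le> K * W" using m(2)[OF that] K(1) by (intro mult_left_mono) (auto simp: W_def dist_norm)
        finally show ?thesis by (simp add: dist_norm)
      qed
    qed (use m dpos in auto)
    then have "W \<le> (K * W) * \<bar>m - s\<bar>" using s(2) by (simp add: W_def)
    also have "\<dots> \<le> (K * W) * d" using m(1) K(1) by (intro mult_left_mono) (auto simp: W_def)
    finally have "W * (1 - K * d) \<le> 0" by (simp add: algebra_simps)
    moreover have "K * d < 1"
    proof -
      have "K * d \<le> K * (1 / (K + 1))" using dle(4) K(1) by (intro mult_left_mono) (auto simp: e_def)
      also have "\<dots> < 1" using K(1) by (simp add: field_simps)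
      finally show ?thesis .
    qed
    ultimately have "W \<le> 0" by (simp add: mult_le_0_iff)
    then have "\<alpha> u = \<beta> u" if "u \<in> ?J" for u using m(2)[OF that] by (simp add: W_def)
    moreover have "ball s d \<subseteq> ?J" by (auto simp: dist_real_def)
    ultimately have "ball s d \<subseteq> S" using J(1) unfolding S_def by blast
    with dpos show "\<exists>e>0. ball s e \<subseteq> S" by blast
  qed
  then have "openin (top_of_set I) S" by (simp add: open_subset S_def)
  ultimately have "S = {} \<or> S = I"
    using I(2) connected_clopen unfolding is_interval_connected_1 by blast
  moreover have "t0 \<in> S" using t0 by (simp add: S_def)
  ultimately show ?thesis using t by (auto simp: S_def)
qed

section \<open>Leaves\<close>

text \<open>A translation of time makes the two parametrizations agree at a common point; by
  uniqueness they agree on the intersection of the parameter intervals and can be glued.\<close>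

lemma integral_curve_Un:
  fixes \<xi> :: "plane \<Rightarrow> plane"
  assumes lip: "locally_lipschitz \<xi>" and L: "integral_curve \<xi> U L" and M: "integral_curve \<xi> U M"
    and "L \<inter> M \<noteq> {}"
  shows "integral_curve \<xi> U (L \<union> M)"
proof -
  obtain I \<alpha> where I: "open I" "is_interval I" "I \<noteq> {}" "L = \<alpha> ` I"
    and \<alpha>: "\<And>t. t \<in> I \<Longrightarrow> \<alpha> t \<in> U - sing \<xi>" "\<And>t. t \<in> I \<Longrightarrow> (\<alpha> has_vector_derivative \<xi> (\<alpha> t)) (at t)"
    using L unfolding integral_curve_def by blast
  obtain J0 \<beta>0 where J0: "open J0" "is_interval J0" "J0 \<noteq> {}" "M = \<beta>0 ` J0"
    and \<beta>0: "\<And>t. t \<in> J0 \<Longrightarrow> \<beta>0 t \<in> U - sing \<xi>" "\<And>t. t \<in> J0 \<Longrightarrow> (\<beta>0 has_vector_derivative \<xi> (\<beta>0 t)) (at t)"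
    using M unfolding integral_curve_def by blast
  obtain t1 t2 where t12: "t1 \<in> I" "t2 \<in> J0" "\<alpha> t1 = \<beta>0 t2" using assms(4) I(4) J0(4) by (metis disjoint_iff imageE)
  define c where "c = t1 - t2"
  define J where "J = (+) c ` J0"
  define \<beta> where "\<beta> t = \<beta>0 (t - c)" for t
  have J: "open J" "is_interval J" using J0 unfolding J_def by (auto intro: open_translation is_interval_translation)
  have Jiff: "t \<in> J \<longleftrightarrow> t - c \<in> J0" for t unfolding J_def by (auto intro!: image_eqI[of _ _ "t - c"])
  have MJ: "M = \<beta> ` J" unfolding J0(4) J_def \<beta>_def by (simp add: image_image)
  have \<beta>: "\<beta> t \<in> U - sing \<xi>" "(\<beta> has_vector_derivative \<xi> (\<beta> t)) (at t)" if t: "t \<in> J" for t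
  proof -
    show "\<beta> t \<in> U - sing \<xi>" unfolding \<beta>_def using \<beta>0(1) t Jiff by blast
    have "((\<beta>0 \<circ> (\<lambda>t. t - c)) has_vector_derivative 1 *\<^sub>R \<xi> (\<beta>0 (t - c))) (at t)"
      by (rule vector_diff_chain_at) (use \<beta>0(2) t Jiff in \<open>auto intro!: derivative_eq_intros\<close>)
    then show "(\<beta> has_vector_derivative \<xi> (\<beta> t)) (at t)" unfolding \<beta>_def o_def by simp
  qed
  have t1J: "t1 \<in> J" "\<beta> t1 = \<alpha> t1" using t12 by (simp_all add: Jiff \<beta>_def c_def)
  have eq: "\<alpha> t = \<beta> t" if "t \<in> I \<inter> J" for t
    by (rule flow_unique[OF lip, of "I \<inter> J" \<alpha> \<beta> t1])
      (use that I J \<alpha> \<beta> t1J t12 in \<open>auto intro: is_interval_Int\<close>)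
  define \<gamma> where "\<gamma> t = (if t \<in> I then \<alpha> t else \<beta> t)" for t
  have \<gamma>J: "\<gamma> t = \<beta> t" if "t \<in> J" for t using eq that by (auto simp: \<gamma>_def)
  have der: "(\<gamma> has_vector_derivative \<xi> (\<gamma> t)) (at t)" if "t \<in> I \<union> J" for t
  proof (cases "t \<in> I")
    case True
    then show ?thesis
      using has_vector_derivative_transform_within_open[OF \<alpha>(2)[OF True] I(1) True, of \<gamma>] by (simp add: \<gamma>_def)
  next
    case False
    then have "t \<in> J" using that by auto
    then show ?thesis
      using has_vector_derivative_transform_within_open[OF \<beta>(2) J(1), of t \<gamma>] \<gamma>J by simp
  qed
  have "connected (I \<union> J)"
    by (rule connected_Un) (use I J t1J t12 is_interval_connected_1 in auto)
  then have int: "is_interval (I \<union> J)" by (simp add: is_interval_connected_1)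
  have img: "L \<union> M = \<gamma> ` (I \<union> J)"
    unfolding I(4) MJ image_Un using \<gamma>J by (auto simp: \<gamma>_def)
  have inU: "\<gamma> t \<in> U - sing \<xi>" if "t \<in> I \<union> J" for t
    using that \<alpha>(1)[of t] \<beta>(1)[of t] unfolding \<gamma>_def by (cases "t \<in> I") simp_all
  show ?thesis unfolding integral_curve_def
  proof (rule exI[of _ "I \<union> J"], rule exI[of _ \<gamma>], intro conjI ballI)
    show "open (I \<union> J)" "I \<union> J \<noteq> {}" using I J by auto
    show "\<gamma> t \<in> U - sing \<xi>" "(\<gamma> has_vector_derivative \<xi> (\<gamma> t)) (at t)" if "t \<in> I \<union> J" for t
      by (fact inU[OF that], fact der[OF that])
  qed (fact int, fact img)
qed

lemma leaf_integral_curve: "L \<in> leaves \<xi> U \<Longrightarrow> integral_curve \<xi> U L"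
  by (simp add: leaves_def)

lemma leaf_absorbs:
  assumes "locally_lipschitz \<xi>" "L \<in> leaves \<xi> U" "integral_curve \<xi> U M" "L \<inter> M \<noteq> {}"
  shows "M \<subseteq> L"
proof -
  have "integral_curve \<xi> U (L \<union> M)"
    by (rule integral_curve_Un[OF assms(1) leaf_integral_curve[OF assms(2)] assms(3,4)])
  then have "L \<union> M = L" using assms(2) by (simp add: leaves_def)
  then show ?thesis by blast
qed

lemma leaves_disjoint:
  assumes "locally_lipschitz \<xi>" "L \<in> leaves \<xi> U" "M \<in> leaves \<xi> U" "L \<noteq> M"
  shows "L \<inter> M = {}"
proof (rule ccontr)
  assume *: "L \<inter> M \<noteq> {}"
  have "M \<subseteq> L" by (rule leaf_absorbs[OF assms(1,2) leaf_integral_curve[OF assms(3)] *])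
  moreover have "L \<subseteq> M" using leaf_absorbs[OF assms(1,3) leaf_integral_curve[OF assms(2)]] * by (simp add: Int_commute)
  ultimately show False using assms(4) by blast
qed

lemma integral_curve_uminus:
  assumes "integral_curve \<xi> U L" shows "integral_curve (\<lambda>z. - \<xi> z) U L"
proof -
  obtain I \<alpha> where I: "open I" "is_interval I" "I \<noteq> {}" "L = \<alpha> ` I"
    and \<alpha>: "\<And>t. t \<in> I \<Longrightarrow> \<alpha> t \<in> U - sing \<xi>" "\<And>t. t \<in> I \<Longrightarrow> (\<alpha> has_vector_derivative \<xi> (\<alpha> t)) (at t)"
    using assms unfolding integral_curve_def by blast
  have "((\<alpha> \<circ> uminus) has_vector_derivative (-1) *\<^sub>R \<xi> (\<alpha> (- t))) (at t)" if "t \<in> uminus ` I" for t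
    by (rule vector_diff_chain_at) (use \<alpha>(2) that in \<open>auto intro!: derivative_eq_intros\<close>)
  moreover have "L = (\<alpha> \<circ> uminus) ` uminus ` I" unfolding I(4) by (simp add: image_image)
  moreover have "sing (\<lambda>z. - \<xi> z) = sing \<xi>" by (simp add: sing_def)
  ultimately show ?thesis unfolding integral_curve_def using I(1-3) \<alpha>(1)
    by (intro exI[of _ "uminus ` I"] exI[of _ "\<alpha> \<circ> uminus"]) (auto simp: open_negations)
qed

text \<open>Leaves are sets of points, so reversing time does not change them. This permits
  normalizing the sign of the field.\<close>

lemma leaves_uminus: "leaves (\<lambda>z. - \<xi> z) U = leaves \<xi> U"
proof -
  have "integral_curve (\<lambda>z. - \<xi> z) U = integral_curve \<xi> U"
    using integral_curve_uminus[of \<xi> U] integral_curve_uminus[of "\<lambda>z. - \<xi> z" U] by auto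
  then show ?thesis by (simp add: leaves_def)
qed

lemma leaf_parametrization:
  assumes "L \<in> leaves \<xi> C"
  obtains I \<gamma> where "open I" "is_interval I" "I \<noteq> {}" "L = \<gamma> ` I" "\<And>t. t \<in> I \<Longrightarrow> \<gamma> t \<in> C"
    "\<And>t. t \<in> I \<Longrightarrow> (\<gamma> has_vector_derivative \<xi> (\<gamma> t)) (at t)"
  using assms unfolding leaves_def integral_curve_def by blast

lemma leaf_nonempty_connected:
  assumes "L \<in> leaves \<xi> C" shows "L \<noteq> {}" "L \<subseteq> C" "connected L"
proof -
  obtain I \<gamma> where I: "open I" "is_interval I" "I \<noteq> {}" "L = \<gamma> ` I" "\<And>t. t \<in> I \<Longrightarrow> \<gamma> t \<in> C"
    "\<And>t. t \<in> I \<Longrightarrow> (\<gamma> has_vector_derivative \<xi> (\<gamma> t)) (at t)"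
    by (rule leaf_parametrization[OF assms]) (rule that)
  have "continuous_on I \<gamma>"
    using I(6) by (auto intro!: continuous_at_imp_continuous_on has_vector_derivative_continuous)
  with I show "L \<noteq> {}" "L \<subseteq> C" "connected L"
    by (auto simp: is_interval_connected_1 intro: connected_continuous_image)
qed

text \<open>The derivative of \<open>\<omega> \<bullet> \<gamma> t\<close> is at least
  \<open>c\<close>. In \<open>leaf_closed\<close> this bounds the time that a curve needs to reach a
  given level of \<open>\<omega>\<close>.\<close>

lemma strict_increasing_along:
  fixes \<gamma> :: "real \<Rightarrow> plane"
  assumes "is_interval I" "\<And>t. t \<in> I \<Longrightarrow> (\<gamma> has_vector_derivative \<xi> (\<gamma> t)) (at t)"
    and "\<And>t. t \<in> I \<Longrightarrow> c \<le> \<omega> \<bullet> \<xi> (\<gamma> t)" and "s \<in> I" "t \<in> I" "s \<le> t"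
  shows "c * (t - s) \<le> \<omega> \<bullet> \<gamma> t - \<omega> \<bullet> \<gamma> s"
proof -
  have sub: "u \<in> I" if "s \<le> u" "u \<le> t" for u
    using assms(1,4,5) that unfolding is_interval_1 by blast
  have "\<omega> \<bullet> \<gamma> s - c * s \<le> \<omega> \<bullet> \<gamma> t - c * t"
  proof (rule DERIV_nonneg_imp_nondecreasing[OF assms(6)])
    fix u assume u: "s \<le> u" "u \<le> t"
    have "((\<lambda>u. \<omega> \<bullet> \<gamma> u) has_vector_derivative \<omega> \<bullet> \<xi> (\<gamma> u)) (at u)"
      by (rule bounded_linear.has_vector_derivative[OF bounded_linear_inner_right assms(2)[OF sub[OF u]]])
    then have "((\<lambda>u. \<omega> \<bullet> \<gamma> u - c * u) has_real_derivative \<omega> \<bullet> \<xi> (\<gamma> u) - c) (at u)"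
      unfolding has_real_derivative_iff_has_vector_derivative by (auto intro!: derivative_eq_intros)
    then show "\<exists>y. ((\<lambda>u. \<omega> \<bullet> \<gamma> u - c * u) has_real_derivative y) (at u) \<and> 0 \<le> y"
      using assms(3)[OF sub[OF u]] by auto
  qed
  then show ?thesis by (simp add: algebra_simps)
qed

lemma strict_mono_along:
  fixes \<gamma> :: "real \<Rightarrow> plane"
  assumes "is_interval I" "\<And>t. t \<in> I \<Longrightarrow> (\<gamma> has_vector_derivative \<xi> (\<gamma> t)) (at t)"
    and pos: "\<And>t. t \<in> I \<Longrightarrow> 0 < \<omega> \<bullet> \<xi> (\<gamma> t)" and st: "s \<in> I" "t \<in> I" "s < t"
  shows "\<omega> \<bullet> \<gamma> s < \<omega> \<bullet> \<gamma> t"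
proof (rule DERIV_pos_imp_increasing[OF st(3)])
  fix u assume u: "s \<le> u" "u \<le> t"
  then have uI: "u \<in> I" using assms(1) st unfolding is_interval_1 by blast
  have "((\<lambda>u. \<omega> \<bullet> \<gamma> u) has_vector_derivative \<omega> \<bullet> \<xi> (\<gamma> u)) (at u)"
    by (rule bounded_linear.has_vector_derivative[OF bounded_linear_inner_right assms(2)[OF uI]])
  then show "\<exists>y. ((\<lambda>u. \<omega> \<bullet> \<gamma> u) has_real_derivative y) (at u) \<and> 0 < y"
    using pos[OF uI] unfolding has_real_derivative_iff_has_vector_derivative by blast
qed

text \<open>The linear function given by \<open>\<omega>\<close> increases along leaves, so a leaf
  meets each of its levels at most once. A point of \<open>L\<close> close to \<open>p\<close> can
  be moved along \<open>L\<close> to the level of \<open>p\<close>, and it lands at a distance from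
  \<open>p\<close> that is at most a fixed multiple of the original one. All these landing points
  coincide, so they are equal to \<open>p\<close>.\<close>

lemma leaf_closed:
  assumes lip: "locally_lipschitz \<xi>" and C: "open C" and pos: "\<And>z. z \<in> C \<Longrightarrow> 0 < \<omega> \<bullet> \<xi> z"
    and L: "L \<in> leaves \<xi> C" and p: "p \<in> C" "p \<in> closure L"
  shows "p \<in> L"
proof (rule ccontr)
  assume pL: "p \<notin> L"
  obtain I \<gamma> where I: "open I" "is_interval I" "I \<noteq> {}" "L = \<gamma> ` I" "\<And>t. t \<in> I \<Longrightarrow> \<gamma> t \<in> C"
    "\<And>t. t \<in> I \<Longrightarrow> (\<gamma> has_vector_derivative \<xi> (\<gamma> t)) (at t)"
    by (rule leaf_parametrization[OF L]) (rule that)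
  have single: "z = z'" if "z \<in> L" "z' \<in> L" "\<omega> \<bullet> z = \<omega> \<bullet> z'" for z z'
  proof -
    obtain t t' where t: "t \<in> I" "t' \<in> I" "z = \<gamma> t" "z' = \<gamma> t'" using \<open>z \<in> L\<close> \<open>z' \<in> L\<close> I(4) by auto
    have mono: "\<omega> \<bullet> \<gamma> u < \<omega> \<bullet> \<gamma> u'" if "u \<in> I" "u' \<in> I" "u < u'" for u u'
      by (rule strict_mono_along[OF I(2) I(6) pos[OF I(5)] that])
    have "t = t'" using mono[of t t'] mono[of t' t] t \<open>\<omega> \<bullet> z = \<omega> \<bullet> z'\<close> by (cases t t' rule: linorder_cases) auto
    then show ?thesis using t by simp
  qed
  obtain R where R: "R > 0" "cball p R \<subseteq> C" using C p(1) unfolding open_contains_cball by blast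
  have "continuous_on (cball p R) (\<lambda>z. \<omega> \<bullet> \<xi> z)"
    by (intro continuous_intros continuous_at_imp_continuous_on ballI locally_lipschitz_continuous[OF lip])
  then obtain m where m: "m \<in> cball p R" "\<And>z. z \<in> cball p R \<Longrightarrow> \<omega> \<bullet> \<xi> m \<le> \<omega> \<bullet> \<xi> z"
    using continuous_attains_inf[of "cball p R" "\<lambda>z. \<omega> \<bullet> \<xi> z"] R(1) by auto
  define c where "c = \<omega> \<bullet> \<xi> m"
  have c: "c > 0" unfolding c_def using m(1) R(2) pos by blast
  obtain \<tau> M where fl: "\<tau> > 0" "M \<ge> 0"
    "\<And>q. q \<in> ball p (R/2) \<Longrightarrow> \<exists>\<sigma>. \<sigma> 0 = q \<and> (\<forall>t\<in>{-\<tau><..<\<tau>}. \<sigma> t \<in> ball p R \<and>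
      (\<sigma> has_vector_derivative \<xi> (\<sigma> t)) (at t) \<and> dist (\<sigma> t) q \<le> M * \<bar>t\<bar>)"
    using local_flow[OF lip R(1), of p] by metis
  \<comment> \<open>Along the flow \<open>\<omega>\<close> grows at rate at least \<open>c\<close>,
    so the level of \<open>p\<close> is reached within time
    \<open>norm \<omega> * dist q p / c\<close>, and in time \<open>t\<close> a point moves by at
    most \<open>M * \<bar>t\<bar>\<close>.\<close>
  define B where "B = 1 + M * norm \<omega> / c"
  have B: "B \<ge> 1" using fl c by (simp add: B_def)
  have reach: "\<exists>z\<in>L. \<omega> \<bullet> z = \<omega> \<bullet> p \<and> dist z p \<le> B * dist q p"
    if q: "q \<in> L" "dist q p < R / 2" "norm \<omega> * dist q p < c * (\<tau> / 2)" for q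
  proof -
    have "q \<in> ball p (R/2)" using q by (simp add: dist_commute)
    then obtain \<sigma> where \<sigma>: "\<sigma> 0 = q" "\<And>t. t \<in> {-\<tau><..<\<tau>} \<Longrightarrow> \<sigma> t \<in> ball p R"
      "\<And>t. t \<in> {-\<tau><..<\<tau>} \<Longrightarrow> (\<sigma> has_vector_derivative \<xi> (\<sigma> t)) (at t)"
      "\<And>t. t \<in> {-\<tau><..<\<tau>} \<Longrightarrow> dist (\<sigma> t) q \<le> M * \<bar>t\<bar>"
      using fl(3) by metis
    have inC: "\<sigma> t \<in> C" if "t \<in> {-\<tau><..<\<tau>}" for t using \<sigma>(2)[OF that] R(2) by auto
    have "integral_curve \<xi> C (\<sigma> ` {-\<tau><..<\<tau>})" unfolding integral_curve_def
    proof (intro exI conjI ballI)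
      show "{-\<tau><..<\<tau>} \<noteq> {}" using fl(1) by auto
      show "\<sigma> t \<in> C - sing \<xi>" if "t \<in> {-\<tau><..<\<tau>}" for t
        using inC[OF that] pos[OF inC[OF that]] by (auto simp: sing_def inner_prod_def)
    qed (use \<sigma> in \<open>auto simp: is_interval_convex_1\<close>)
    moreover have "q \<in> \<sigma> ` {-\<tau><..<\<tau>}" using \<sigma>(1) fl(1) by (intro image_eqI[of _ _ 0]) auto
    ultimately have sub: "\<sigma> ` {-\<tau><..<\<tau>} \<subseteq> L" using leaf_absorbs[OF lip L] q(1) by blast
    have grow: "c * (t - s) \<le> \<omega> \<bullet> \<sigma> t - \<omega> \<bullet> \<sigma> s" if "s \<in> {-\<tau><..<\<tau>}" "t \<in> {-\<tau><..<\<tau>}" "s \<le> t" for s t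
      by (rule strict_increasing_along[of "{-\<tau><..<\<tau>}" \<sigma> \<xi>])
        (use that \<sigma> m(2) in \<open>auto simp: c_def is_interval_convex_1 less_imp_le\<close>)
    have pq: "\<bar>\<omega> \<bullet> p - \<omega> \<bullet> q\<bar> \<le> norm \<omega> * dist q p"
      using Cauchy_Schwarz_ineq2[of \<omega> "p - q"] by (simp add: inner_diff_right dist_norm norm_minus_commute)
    have "\<omega> \<bullet> \<sigma> (- (\<tau>/2)) \<le> \<omega> \<bullet> p" "\<omega> \<bullet> p \<le> \<omega> \<bullet> \<sigma> (\<tau>/2)"
      using grow[of "- (\<tau>/2)" 0] grow[of 0 "\<tau>/2"] fl(1) pq q(3) \<sigma>(1) by auto
    moreover have "continuous_on {- (\<tau>/2)..\<tau>/2} (\<lambda>t. \<omega> \<bullet> \<sigma> t)"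
      by (intro continuous_intros continuous_at_imp_continuous_on ballI has_vector_derivative_continuous[OF \<sigma>(3)])
        (use fl(1) in auto)
    ultimately obtain t where t: "- (\<tau>/2) \<le> t" "t \<le> \<tau>/2" "\<omega> \<bullet> \<sigma> t = \<omega> \<bullet> p"
      using IVT'[of "\<lambda>t. \<omega> \<bullet> \<sigma> t" "- (\<tau>/2)" "\<omega> \<bullet> p" "\<tau>/2"] fl(1) by auto
    then have tI: "t \<in> {-\<tau><..<\<tau>}" "0 \<in> {-\<tau><..<\<tau>}" using fl(1) by auto
    have "c * \<bar>t\<bar> \<le> \<bar>\<omega> \<bullet> p - \<omega> \<bullet> q\<bar>"
      using grow[of 0 t] grow[of t 0] tI \<sigma>(1) t(3) by (cases "0 \<le> t") auto
    then have "c * \<bar>t\<bar> \<le> norm \<omega> * dist q p" using pq by linarith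
    then have "\<bar>t\<bar> \<le> norm \<omega> * dist q p / c" using c by (simp add: field_simps)
    then have "M * \<bar>t\<bar> \<le> M * (norm \<omega> * dist q p / c)" using fl(2) by (rule mult_left_mono)
    then have "dist (\<sigma> t) p \<le> B * dist q p"
      using \<sigma>(4)[OF tI(1)] dist_triangle[of "\<sigma> t" p q] by (simp add: B_def algebra_simps)
    then show ?thesis using sub tI t(3) by blast
  qed
  \<comment> \<open>Small enough for the level of \<open>p\<close> to be reached within time
    \<open>\<tau> / 2\<close>; the summand \<open>1\<close> makes the denominator visibly
    positive.\<close>
  define \<rho> where "\<rho> = min (R/2) (c * (\<tau>/2) / (norm \<omega> + 1))"
  have "norm \<omega> + 1 > 0" by (simp add: add_nonneg_pos)
  then have \<rho>: "\<rho> > 0" using R(1) c fl(1) unfolding \<rho>_def by (simp only: min_less_iff_conj divide_pos_pos mult_pos_pos half_gt_zero simp_thms)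
  have reach': "\<exists>z\<in>L. \<omega> \<bullet> z = \<omega> \<bullet> p \<and> dist z p \<le> B * dist q p" if q: "q \<in> L" "dist q p < \<rho>" for q
  proof (rule reach[OF q(1)])
    show "dist q p < R / 2" using q(2) by (simp add: \<rho>_def)
    have "norm \<omega> * dist q p \<le> (norm \<omega> + 1) * dist q p" by (simp add: mult_right_mono)
    also have "\<dots> < (norm \<omega> + 1) * (c * (\<tau>/2) / (norm \<omega> + 1))"
      using q(2) by (intro mult_strict_left_mono) (auto simp: \<rho>_def add_nonneg_pos)
    also have "\<dots> = c * (\<tau> / 2)" using \<open>norm \<omega> + 1 > 0\<close> by (metis less_irrefl nonzero_mult_div_cancel_left times_divide_eq_right)
    finally show "norm \<omega> * dist q p < c * (\<tau> / 2)" .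
  qed
  obtain q0 where "q0 \<in> L" "dist q0 p < \<rho>" using p(2) \<rho> unfolding closure_approachable by blast
  with reach' obtain z0 where z0: "z0 \<in> L" "\<omega> \<bullet> z0 = \<omega> \<bullet> p" by blast
  then have "dist z0 p > 0" using pL by auto
  then have "min \<rho> (dist z0 p / B) > 0" using \<rho> B by simp
  then obtain q where q: "q \<in> L" "dist q p < min \<rho> (dist z0 p / B)"
    using p(2) unfolding closure_approachable by blast
  then obtain z where z: "z \<in> L" "\<omega> \<bullet> z = \<omega> \<bullet> p" "dist z p \<le> B * dist q p"
    using reach'[of q] by (metis min_less_iff_conj)
  have "z = z0" using single z z0 by simp
  moreover have "B * dist q p < dist z0 p" using q(2) B by (simp add: field_simps)
  ultimately show False using z(3) by simp
qed

section \<open>Leaves with two sides\<close>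

text \<open>\<open>H\<close> is a local defining function of the leaf through \<open>z\<close>, and
  its gradient there is a positive multiple of \<open>w\<close>, so \<open>w\<close> points from
  \<open>A\<close> to \<open>B\<close>. Unlike a condition on straight segments, this controls every
  differentiable curve through \<open>z\<close> whose velocity has a positive product with
  \<open>w\<close>.\<close>

definition side_at :: "plane \<Rightarrow> plane \<Rightarrow> plane set \<Rightarrow> plane set \<Rightarrow> bool"
  where "side_at z w A B \<longleftrightarrow> (\<exists>H e c. e > 0 \<and> c > 0 \<and> H z = 0 \<and>
    (H has_derivative (\<lambda>v. c * (w \<bullet> v))) (at z) \<and>
    (\<forall>p\<in>ball z e. (0 < H p \<longrightarrow> p \<in> B) \<and> (H p < (0::real) \<longrightarrow> p \<in> A)))"

text \<open>Compared with \<open>leaf_sides\<close>, the condition on the direction is replaced by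
  the stronger \<open>side_at\<close>, and \<open>C - L\<close> is open, so that both components are
  open, as the connectedness argument in \<open>no_return\<close> requires.\<close>

definition two_sided :: "(plane \<Rightarrow> plane) \<Rightarrow> plane set \<Rightarrow> plane set \<Rightarrow> plane set \<Rightarrow> plane set \<Rightarrow> bool"
  where "two_sided \<xi> C L U1 U2 \<longleftrightarrow> open (C - L) \<and> components (C - L) = {U1, U2} \<and> U1 \<noteq> U2 \<and>
    (\<forall>z\<in>L. side_at z (perp \<xi> z) U1 U2)"

lemma side_atI:
  fixes H :: "plane \<Rightarrow> real"
  assumes "0 < e" "0 < c" "H z = 0" "(H has_derivative (\<lambda>v. c * (w \<bullet> v))) (at z)"
    and "\<And>p. p \<in> ball z e \<Longrightarrow> 0 < H p \<Longrightarrow> p \<in> B" "\<And>p. p \<in> ball z e \<Longrightarrow> H p < 0 \<Longrightarrow> p \<in> A"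
  shows "side_at z w A B"
  unfolding side_at_def
  by (rule exI[of _ H], rule exI[of _ e], rule exI[of _ c], intro conjI ballI impI) (fact assms | rule assms)+

lemma side_at_uminus: "side_at z w A B \<Longrightarrow> side_at z (- w) B A"
proof -
  assume "side_at z w A B"
  then obtain H e c where H: "e > 0" "c > 0" "H z = 0" "(H has_derivative (\<lambda>v. c * (w \<bullet> v))) (at z)"
    "\<And>p. p \<in> ball z e \<Longrightarrow> (0 < H p \<longrightarrow> p \<in> B) \<and> (H p < (0::real) \<longrightarrow> p \<in> A)"
    unfolding side_at_def by blast
  have "((\<lambda>p. - H p) has_derivative (\<lambda>v. c * ((- w) \<bullet> v))) (at z)"
    using has_derivative_minus[OF H(4)] by simp
  with H show ?thesis unfolding side_at_def
    by (intro exI[of _ "\<lambda>p. - H p"] exI[of _ e] exI[of _ c]) simp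
qed

lemma two_sided_uminus: "two_sided (\<lambda>z. - \<xi> z) C L U1 U2 \<Longrightarrow> two_sided \<xi> C L U2 U1"
proof -
  have "perp (\<lambda>z. - \<xi> z) z = - perp \<xi> z" for z by (simp add: perp_def)
  then show "two_sided (\<lambda>z. - \<xi> z) C L U1 U2 \<Longrightarrow> two_sided \<xi> C L U2 U1"
    unfolding two_sided_def using side_at_uminus[of _ "- perp \<xi> _" U1 U2] by (auto simp: insert_commute)
qed

text \<open>By the chain rule \<open>H \<circ> \<delta>\<close> vanishes at \<open>t0\<close> and
  has a positive derivative there. The derivative is taken within \<open>S\<close>, so that the end
  points of a curve on \<open>{0..1}\<close> are covered.\<close>

lemma side_at_curve:
  assumes "side_at (\<delta> t0) w A B" and \<delta>: "(\<delta> has_vector_derivative v) (at t0 within S)" and pos: "0 < w \<bullet> v"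
  obtains d where "d > 0" "\<And>t. t \<in> S \<Longrightarrow> t0 < t \<Longrightarrow> t < t0 + d \<Longrightarrow> \<delta> t \<in> B"
    "\<And>t. t \<in> S \<Longrightarrow> t0 - d < t \<Longrightarrow> t < t0 \<Longrightarrow> \<delta> t \<in> A"
proof -
  obtain H e c where H: "e > 0" "c > 0" "H (\<delta> t0) = 0" "(H has_derivative (\<lambda>v. c * (w \<bullet> v))) (at (\<delta> t0))"
    "\<And>p. p \<in> ball (\<delta> t0) e \<Longrightarrow> (0 < H p \<longrightarrow> p \<in> B) \<and> (H p < (0::real) \<longrightarrow> p \<in> A)"
    using assms(1) unfolding side_at_def by blast
  have "((H \<circ> \<delta>) has_vector_derivative c * (w \<bullet> v)) (at t0 within S)"
    by (rule vector_derivative_diff_chain_within[OF \<delta> has_derivative_at_withinI[OF H(4)]])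
  then have der: "((H \<circ> \<delta>) has_real_derivative c * (w \<bullet> v)) (at t0 within S)"
    by (simp add: has_real_derivative_iff_has_vector_derivative)
  have "0 < c * (w \<bullet> v)" using H(2) pos by simp
  from has_real_derivative_pos_inc_right[OF der this] obtain d1 where
    d1: "d1 > 0" "\<And>h. h > 0 \<Longrightarrow> t0 + h \<in> S \<Longrightarrow> h < d1 \<Longrightarrow> H (\<delta> t0) < H (\<delta> (t0 + h))" by auto
  from has_real_derivative_pos_inc_left[OF der \<open>0 < c * (w \<bullet> v)\<close>] obtain d2 where
    d2: "d2 > 0" "\<And>h. h > 0 \<Longrightarrow> t0 - h \<in> S \<Longrightarrow> h < d2 \<Longrightarrow> H (\<delta> (t0 - h)) < H (\<delta> t0)" by auto
  have "continuous (at t0 within S) \<delta>" by (rule has_vector_derivative_continuous[OF \<delta>])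
  then obtain d3 where d3: "d3 > 0" "\<And>t. t \<in> S \<Longrightarrow> dist t t0 < d3 \<Longrightarrow> dist (\<delta> t) (\<delta> t0) < e"
    unfolding continuous_within_eps_delta using H(1) by blast
  show thesis
  proof (rule that[of "min (min d1 d2) d3"])
    show "0 < min (min d1 d2) d3" using d1 d2 d3 by simp
    fix t assume t: "t \<in> S"
    { assume "t0 < t" "t < t0 + min (min d1 d2) d3"
      then have "0 < H (\<delta> t)" "dist t t0 < d3" using d1(2)[of "t - t0"] t H(3) by (auto simp: dist_real_def)
      then show "\<delta> t \<in> B" using H(5)[of "\<delta> t"] d3(2)[OF t] by (simp add: dist_commute) }
    { assume "t0 - min (min d1 d2) d3 < t" "t < t0"
      then have "H (\<delta> t) < 0" "dist t t0 < d3" using d2(2)[of "t0 - t"] t H(3) by (auto simp: dist_real_def)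
      then show "\<delta> t \<in> A" using H(5)[of "\<delta> t"] d3(2)[OF t] by (simp add: dist_commute) }
  qed
qed

lemma two_sided_leaf_sides:
  assumes "two_sided \<xi> C L U1 U2" "L \<subseteq> C" "C \<inter> sing \<xi> = {}"
  shows "leaf_sides \<xi> C L U1 U2"
proof -
  have "points_into z (perp \<xi> z) U2" if z: "z \<in> L" for z
  proof -
    have side: "side_at z (perp \<xi> z) U1 U2" using assms(1) z by (simp add: two_sided_def)
    have "perp \<xi> z \<noteq> 0" using assms z by (auto simp: perp_def sing_def zero_prod_def)
    then have pos: "0 < perp \<xi> z \<bullet> perp \<xi> z" by simp
    have der: "((\<lambda>s. z + s *\<^sub>R perp \<xi> z) has_vector_derivative perp \<xi> z) (at 0 within UNIV)"
      by (auto intro!: derivative_eq_intros)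
    from side have "side_at (z + 0 *\<^sub>R perp \<xi> z) (perp \<xi> z) U1 U2" by simp
    from side_at_curve[of "\<lambda>s. z + s *\<^sub>R perp \<xi> z" 0, OF this der pos]
    obtain d where "d > 0" "\<And>t. 0 < t \<Longrightarrow> t < d \<Longrightarrow> z + t *\<^sub>R perp \<xi> z \<in> U2"
      by (metis UNIV_I add_0)
    then show ?thesis unfolding points_into_def by blast
  qed
  then show ?thesis using assms(1) unfolding leaf_sides_def two_sided_def by blast
qed

text \<open>A curve that crosses a leaf in the positive direction is afterwards on the side \<open>U2\<close>; just
  before its next visit to the leaf it would have to be on the side \<open>U1\<close>.\<close>

lemma no_return:
  assumes two: "two_sided \<xi> C L U1 U2" and LC: "L \<subseteq> C"
    and \<delta>: "\<And>t. t \<in> {0..1} \<Longrightarrow> (\<delta> has_vector_derivative \<delta>' t) (at t within {0..1})"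
    and \<delta>C: "\<delta> ` {0..1} \<subseteq> C" and ends: "\<delta> 0 \<in> L" "\<delta> 1 \<in> L"
    and pos: "\<And>t. t \<in> {0..1} \<Longrightarrow> 0 < perp \<xi> (\<delta> t) \<bullet> \<delta>' t"
  shows False
proof -
  have side: "side_at (\<delta> t) (perp \<xi> (\<delta> t)) U1 U2" if "\<delta> t \<in> L" for t
    using two that by (simp add: two_sided_def)
  have comp: "U1 \<in> components (C - L)" "U2 \<in> components (C - L)" and opn: "open (C - L)" and ne: "U1 \<noteq> U2"
    using two by (auto simp: two_sided_def)
  have "components (C - L) = {U1, U2}" using two by (simp add: two_sided_def)
  then have "\<Union>{U1, U2} = C - L" by (metis Union_components)
  then have "U1 \<union> U2 = C - L" by simp
  then have U: "open U1" "open U2" "U1 \<inter> U2 = {}" "U1 \<union> U2 = C - L"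
    using open_components[OF opn comp(1)] open_components[OF opn comp(2)] components_nonoverlap[OF comp] ne
    by simp_all
  have cont: "continuous_on {0..1} \<delta>"
    unfolding continuous_on_eq_continuous_within using has_vector_derivative_continuous[OF \<delta>] by blast
  have "0 \<in> {0..1::real}" by simp
  from side_at_curve[OF side[OF ends(1)] \<delta>[OF this] pos[OF this]]
  obtain d0 where d0: "d0 > 0" "\<And>t. t \<in> {0..1} \<Longrightarrow> 0 < t \<Longrightarrow> t < d0 \<Longrightarrow> \<delta> t \<in> U2"
    by (metis add_0)
  define a where "a = min (d0 / 2) 1"
  have a: "0 < a" "a < d0" "a \<le> 1" using d0 by (auto simp: a_def)
  define T where "T = {t\<in>{a..1}. \<delta> t \<in> L}"
  have "T = {t\<in>{a..1}. \<delta> t \<in> - (C - L)}" using \<delta>C a(1) by (auto simp: T_def image_subset_iff)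
  also have "closed \<dots>"
  proof -
    have "continuous_on {a..1} \<delta>" by (rule continuous_on_subset[OF cont]) (use a in auto)
    then have "closed ({a..1} \<inter> \<delta> -` (- (C - L)))"
      by (rule continuous_closed_preimage[OF _ closed_atLeastAtMost closed_Compl[OF opn]])
    moreover have "{a..1} \<inter> \<delta> -` (- (C - L)) = {t\<in>{a..1}. \<delta> t \<in> - (C - L)}" by blast
    ultimately show ?thesis by simp
  qed
  finally have "closed T" .
  moreover have T: "1 \<in> T" "bdd_below T" using ends a by (auto simp: T_def bdd_below_def)
  ultimately have "Inf T \<in> T" using closed_contains_Inf[of T] by blast
  define b where "b = Inf T"
  have b: "b \<in> T" "\<And>t. t \<in> T \<Longrightarrow> b \<le> t" using \<open>Inf T \<in> T\<close> T by (auto simp: b_def intro: cInf_lower)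
  then have b01: "b \<in> {0..1}" "\<delta> b \<in> L" "a \<le> b" using a by (auto simp: T_def)
  have free: "\<delta> t \<in> U1 \<union> U2" if "0 < t" "t < b" for t
  proof (cases "t < a")
    case True
    then show ?thesis using d0(2)[of t] that a by auto
  next
    case False
    then have "t \<notin> T" using b(2)[of t] that by auto
    then have "\<delta> t \<notin> L" using False that b01 by (auto simp: T_def)
    then show ?thesis unfolding U(4) using \<delta>C that b01 by auto
  qed
  from side_at_curve[OF side[OF b01(2)] \<delta>[OF b01(1)] pos[OF b01(1)]]
  obtain d1 where d1: "d1 > 0" "\<And>t. t \<in> {0..1} \<Longrightarrow> b - d1 < t \<Longrightarrow> t < b \<Longrightarrow> \<delta> t \<in> U1" by metis
  define t2 where "t2 = a / 2"
  define t1 where "t1 = max (b / 2) (b - d1 / 2)"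
  have t1: "0 < t1" "t1 < b" "\<delta> t1 \<in> U1" using d1(1) d1(2)[of t1] b01 a by (auto simp: t1_def)
  have t2: "0 < t2" "t2 < b" "\<delta> t2 \<in> U2" using d0(2)[of t2] b01 a by (auto simp: t2_def)
  have "connected (\<delta> ` {0<..<b})"
    by (intro connected_continuous_image continuous_on_subset[OF cont]) (use b01 in auto)
  then have "U1 \<inter> \<delta> ` {0<..<b} = {} \<or> U2 \<inter> \<delta> ` {0<..<b} = {}"
    using connectedD[of "\<delta> ` {0<..<b}" U1 U2] U free by (auto simp: image_subset_iff)
  then show False using t1 t2 by auto
qed

text \<open>Without a tangency the continuous function
  \<open>perp \<xi> (\<delta> t) \<bullet> \<delta>' t\<close> has constant sign. A positive sign
  contradicts \<open>no_return\<close>; a negative one becomes positive for the reversed field,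
  which exchanges the two sides.\<close>

lemma two_sided_rolle:
  assumes lip: "locally_lipschitz \<xi>" and two: "two_sided \<xi> C L U1 U2" and L: "L \<in> leaves \<xi> C"
  shows "rolle_leaf \<xi> C L"
  unfolding rolle_leaf_def
proof (intro conjI allI impI L, elim conjE)
  fix \<delta> \<delta>' :: "real \<Rightarrow> plane"
  assume \<delta>: "\<forall>t\<in>{0..1}. (\<delta> has_vector_derivative \<delta>' t) (at t within {0..1})"
    and \<delta>': "continuous_on {0..1} \<delta>'" and inC: "\<delta> ` {0..1} \<subseteq> C" and ends: "\<delta> 0 \<in> L" "\<delta> 1 \<in> L"
  have LC: "L \<subseteq> C" by (rule leaf_nonempty_connected(2)[OF L])
  have "continuous_on {0..1} \<delta>"
    unfolding continuous_on_eq_continuous_within using has_vector_derivative_continuous \<delta> by blast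
  moreover have "continuous_on UNIV \<xi>"
    using locally_lipschitz_continuous[OF lip] continuous_at_imp_continuous_on by blast
  then have "continuous_on UNIV (\<lambda>z. (snd (\<xi> z), - fst (\<xi> z)))" by (intro continuous_intros)
  then have "continuous_on UNIV (perp \<xi>)" by (simp add: perp_def[abs_def])
  ultimately have "continuous_on {0..1} (\<lambda>t. perp \<xi> (\<delta> t))"
    by (intro continuous_on_compose2[of UNIV "perp \<xi>" "{0..1}" \<delta>]) auto
  then have cont: "continuous_on {0..1} (\<lambda>t. perp \<xi> (\<delta> t) \<bullet> \<delta>' t)"
    using \<delta>' by (rule continuous_on_inner)
  show "\<exists>t\<in>{0..1}. perp \<xi> (\<delta> t) \<bullet> \<delta>' t = 0"
  proof (rule ccontr)
    assume no: "\<not> ?thesis"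
    let ?g = "\<lambda>t. perp \<xi> (\<delta> t) \<bullet> \<delta>' t"
    have conn: "connected (?g ` {0..1})" by (rule connected_continuous_image[OF cont]) simp
    have "0 \<notin> ?g ` {0..1}" using no by force
    moreover have "0 \<in> ?g ` {0..1}" if "s \<in> {0..1}" "t \<in> {0..1}" "?g s \<le> 0" "0 \<le> ?g t" for s t
      using conn[unfolded connected_iff_interval, rule_format, OF imageI[OF that(1)] imageI[OF that(2)] that(3,4)] .
    ultimately have "(\<forall>t\<in>{0..1}. 0 < ?g t) \<or> (\<forall>t\<in>{0..1}. ?g t < 0)" by (meson not_less)
    then show False
    proof
      assume "\<forall>t\<in>{0..1}. 0 < ?g t"
      then show False using no_return[OF two LC bspec[OF \<delta>] inC ends] by blast
    next
      assume neg: "\<forall>t\<in>{0..1}. ?g t < 0"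
      have two': "two_sided (\<lambda>z. - \<xi> z) C L U2 U1"
        by (rule two_sided_uminus) (use two in simp)
      have "perp (\<lambda>z. - \<xi> z) z = - perp \<xi> z" for z by (simp add: perp_def)
      then have "0 < perp (\<lambda>z. - \<xi> z) (\<delta> t) \<bullet> \<delta>' t" if "t \<in> {0..1}" for t
        using bspec[OF neg that] by (simp only: inner_minus_left neg_0_less_iff_less)
      then show False using no_return[OF two' LC bspec[OF \<delta>] inC ends] by blast
    qed
  qed
qed

text \<open>Inclusion in \<open>U1\<close> and inclusion in \<open>U2\<close> are both required to
  be linear orders. Since reversing the field exchanges the sides, this makes the notion symmetric,
  and \<open>ordered_sides_uminus\<close> can transfer it.\<close>

definition ordered_sides :: "(plane \<Rightarrow> plane) \<Rightarrow> plane set \<Rightarrow> (plane set \<Rightarrow> plane set) \<Rightarrow> (plane set \<Rightarrow> plane set) \<Rightarrow> bool"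
  where "ordered_sides \<xi> C U1 U2 \<longleftrightarrow> (\<forall>L\<in>leaves \<xi> C. two_sided \<xi> C L (U1 L) (U2 L)) \<and>
    strict_linear_order_on (leaves \<xi> C) {(L, M). L \<in> leaves \<xi> C \<and> M \<in> leaves \<xi> C \<and> L \<subseteq> U1 M} \<and>
    strict_linear_order_on (leaves \<xi> C) {(L, M). L \<in> leaves \<xi> C \<and> M \<in> leaves \<xi> C \<and> L \<subseteq> U2 M}"

lemma ordered_sides_uminus: "ordered_sides (\<lambda>z. - \<xi> z) C U1 U2 \<Longrightarrow> ordered_sides \<xi> C U2 U1"
  unfolding ordered_sides_def leaves_uminus using two_sided_uminus by blast

text \<open>\<open>leaf_less\<close> names the sides by an existential quantifier. They are unique:
  with the labels exchanged, short segments along \<open>perp \<xi> z\<close> would lie in two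
  disjoint components.\<close>

lemma ordered_sides_leaf_less:
  assumes ord: "ordered_sides \<xi> C U1 U2" and "C \<inter> sing \<xi> = {}"
  shows "strict_linear_order_on (leaves \<xi> C) (leaf_less \<xi> C)"
proof -
  have "(L, M) \<in> leaf_less \<xi> C \<longleftrightarrow> L \<in> leaves \<xi> C \<and> M \<in> leaves \<xi> C \<and> L \<subseteq> U1 M" for L M
  proof (cases "M \<in> leaves \<xi> C")
    case True
    have two: "two_sided \<xi> C M (U1 M) (U2 M)" using ord True by (simp add: ordered_sides_def)
    have sides: "leaf_sides \<xi> C M (U1 M) (U2 M)"
      by (rule two_sided_leaf_sides[OF two leaf_nonempty_connected(2)[OF True] assms(2)])
    have V1: "V1 = U1 M" if V: "leaf_sides \<xi> C M V1 V2" for V1 V2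
    proof (rule ccontr)
      assume "V1 \<noteq> U1 M"
      moreover have "{V1, V2} = {U1 M, U2 M}" using V sides by (simp add: leaf_sides_def)
      ultimately have V2: "V2 = U1 M" by (auto simp: doubleton_eq_iff)
      obtain z where z: "z \<in> M" using leaf_nonempty_connected(1)[OF True] by blast
      obtain e1 where e1: "e1 > 0" "\<And>s. 0 < s \<Longrightarrow> s < e1 \<Longrightarrow> z + s *\<^sub>R perp \<xi> z \<in> U1 M"
        using V z unfolding leaf_sides_def points_into_def V2 by blast
      obtain e2 where e2: "e2 > 0" "\<And>s. 0 < s \<Longrightarrow> s < e2 \<Longrightarrow> z + s *\<^sub>R perp \<xi> z \<in> U2 M"
        using sides z unfolding leaf_sides_def points_into_def by blast
      define s where "s = min e1 e2 / 2"
      have s: "0 < s" "s < e1" "s < e2" using e1 e2 by (auto simp: s_def)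
      have "U1 M \<inter> U2 M = {}"
        using two components_nonoverlap[of "U1 M" "C - M" "U2 M"] unfolding two_sided_def by blast
      then show False using e1(2)[OF s(1,2)] e2(2)[OF s(1,3)] by blast
    qed
    have "(\<exists>V1 V2. leaf_sides \<xi> C M V1 V2 \<and> L \<subseteq> V1) \<longleftrightarrow> L \<subseteq> U1 M" using sides V1 by blast
    then show ?thesis using True by (simp add: leaf_less_def)
  qed (simp add: leaf_less_def)
  then have "leaf_less \<xi> C = {(L, M). L \<in> leaves \<xi> C \<and> M \<in> leaves \<xi> C \<and> L \<subseteq> U1 M}" by auto
  then show ?thesis using ord by (simp add: ordered_sides_def)
qed

section \<open>Strips\<close>

definition strip :: "real set \<Rightarrow> (real \<Rightarrow> ereal) \<Rightarrow> (real \<Rightarrow> ereal) \<Rightarrow> plane set"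
  where "strip B f g = {(x, y). x \<in> B \<and> f x < ereal y \<and> ereal y < g x}"

lemma mem_strip [simp]: "(x, y) \<in> strip B f g \<longleftrightarrow> x \<in> B \<and> f x < ereal y \<and> ereal y < g x"
  by (simp add: strip_def)

text \<open>Formulated relative to \<open>S\<close> because the boundary functions of a strip are
  continuous only over its base.\<close>

lemma open_less_on:
  fixes f g :: "'a::t2_space \<Rightarrow> 'b::{linorder_topology, dense_linorder}"
  assumes "open S" "continuous_on S f" "continuous_on S g"
  shows "open {x\<in>S. f x < g x}"
proof (subst open_subopen, intro ballI)
  fix x assume "x \<in> {x\<in>S. f x < g x}"
  then have x: "x \<in> S" "f x < g x" by auto
  then obtain m where m: "f x < m" "m < g x" using dense by blast
  have "isCont f x" "isCont g x" using assms x by (auto simp: continuous_on_eq_continuous_at)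
  then have "(f \<longlongrightarrow> f x) (nhds x)" "(g \<longlongrightarrow> g x) (nhds x)"
    by (simp_all add: continuous_at tendsto_at_iff_tendsto_nhds)
  then have "\<forall>\<^sub>F y in nhds x. f y < m" "\<forall>\<^sub>F y in nhds x. m < g y"
    using m by (auto intro: order_tendstoD)
  moreover have "\<forall>\<^sub>F y in nhds x. y \<in> S" by (rule eventually_nhds_in_open[OF assms(1) x(1)])
  ultimately have "\<forall>\<^sub>F y in nhds x. y \<in> S \<and> f y < g y" by eventually_elim auto
  then show "\<exists>T. open T \<and> x \<in> T \<and> T \<subseteq> {x\<in>S. f x < g x}" unfolding eventually_nhds by blast
qed

lemma open_strip:
  assumes "open B" "continuous_on B f" "continuous_on B g" shows "open (strip B f g)"
proof -
  let ?S = "B \<times> (UNIV :: real set)"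
  have S: "open ?S" using assms(1) by (intro open_Times) auto
  have c: "continuous_on ?S (\<lambda>p. f (fst p))" "continuous_on ?S (\<lambda>p. g (fst p))" "continuous_on ?S (\<lambda>p. ereal (snd p))"
    by (rule continuous_on_compose2[OF assms(2)] continuous_on_compose2[OF assms(3)]; force intro: continuous_intros)+
      (intro continuous_intros)
  have "strip B f g = {p\<in>?S. f (fst p) < ereal (snd p)} \<inter> {p\<in>?S. ereal (snd p) < g (fst p)}"
    by (auto simp: strip_def)
  then show ?thesis using open_less_on[OF S c(1,3)] open_less_on[OF S c(3,2)] by auto
qed

text \<open>The projection to the first axis is open. A separation of \<open>S\<close> would project
  to two open sets that cover an interval; they share some \<open>x\<close>, and then the fibre over
  \<open>x\<close> is separated.\<close>

lemma connected_by_fibres: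
  fixes S :: "plane set"
  assumes "open S" and fib: "\<And>x. is_interval {y. (x, y) \<in> S}" and proj: "is_interval (fst ` S)"
  shows "connected S"
  unfolding connected_def
proof (rule notI, elim exE conjE)
  fix A D :: "plane set"
  assume A: "open A" and D: "open D" and cov: "S \<subseteq> A \<union> D" and dis: "A \<inter> D \<inter> S = {}"
    and ne: "A \<inter> S \<noteq> {}" "D \<inter> S \<noteq> {}"
  let ?A = "fst ` (A \<inter> S)" and ?D = "fst ` (D \<inter> S)"
  have op: "open ?A" "open ?D" using A D assms(1) by (auto intro: open_image_fst)
  have co: "fst ` S \<subseteq> ?A \<union> ?D" using cov by (force simp: image_iff)
  have conn: "connected (fst ` S)" using proj by (simp add: is_interval_connected_1)
  have "?A \<inter> fst ` S \<noteq> {}" "?D \<inter> fst ` S \<noteq> {}" using ne by auto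
  then have "?A \<inter> ?D \<inter> fst ` S \<noteq> {}" using connectedD[OF conn op _ co] by blast
  then obtain x where "x \<in> ?A" "x \<in> ?D" by blast
  then obtain y1 y2 where x: "(x, y1) \<in> A \<inter> S" "(x, y2) \<in> D \<inter> S" by force
  let ?F = "{y. (x, y) \<in> S}"
  have F: "connected ?F" using fib by (simp add: is_interval_connected_1)
  have op: "open (Pair x -` A)" "open (Pair x -` D)"
    using A D by (auto intro!: open_vimage continuous_intros)
  have "?F \<subseteq> Pair x -` A \<union> Pair x -` D" using cov by auto
  moreover have "Pair x -` A \<inter> Pair x -` D \<inter> ?F = {}" using dis by auto
  moreover have "y1 \<in> Pair x -` A \<inter> ?F" "y2 \<in> Pair x -` D \<inter> ?F" using x by auto
  ultimately show False using connectedD[OF F op] by blast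
qed

lemma strip_fibre: "is_interval {y. (x, y) \<in> strip B f g}"
  unfolding is_interval_1
proof (intro ballI allI impI)
  fix a b y assume "a \<in> {y. (x, y) \<in> strip B f g}" "b \<in> {y. (x, y) \<in> strip B f g}" "a \<le> y \<and> y \<le> b"
  then have "x \<in> B" "f x < ereal a" "ereal a \<le> ereal y" "ereal y \<le> ereal b" "ereal b < g x" by simp_all
  then have "x \<in> B" "f x < ereal y" "ereal y < g x" by (simp, metis less_le_trans, metis le_less_trans)
  then show "y \<in> {y. (x, y) \<in> strip B f g}" by simp
qed

text \<open>As both sets are open, a connected subset of \<open>S\<close> that contains one of them
  cannot meet the other.\<close>

lemma components_two:
  assumes S: "S = U \<union> V" and U: "open U" "connected U" "U \<noteq> {}" and V: "open V" "connected V" "V \<noteq> {}"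
    and dis: "U \<inter> V = {}"
  shows "components S = {U, V}"
proof -
  have max: "A \<in> components S" if A: "A \<subseteq> S" "A \<noteq> {}" "connected A" "open A" "open A'" "S = A \<union> A'" "A \<inter> A' = {}" for A A'
    unfolding in_components_maximal
  proof (intro conjI allI impI A, elim conjE)
    fix D assume D: "D \<noteq> {}" "A \<subseteq> D" "D \<subseteq> S" "connected D"
    have "A \<inter> D = {} \<or> A' \<inter> D = {}"
      using connectedD[OF D(4) A(4,5)] D(3) A(6,7) by blast
    then show "D = A" using D A by blast
  qed
  have "U \<in> components S" "V \<in> components S"
    using max[of U V] max[of V U] S U V dis by blast+
  moreover have "W = U \<or> W = V" if W: "W \<in> components S" for W
  proof -
    have "W \<noteq> {}" "W \<subseteq> S" using W in_components_nonempty in_components_subset by blast+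
    then have "W \<inter> U \<noteq> {} \<or> W \<inter> V \<noteq> {}" using S by blast
    then show ?thesis using W \<open>U \<in> components S\<close> \<open>V \<in> components S\<close> components_nonoverlap by metis
  qed
  ultimately show ?thesis by blast
qed

section \<open>Vertical leaves\<close>

text \<open>A leaf stays on one vertical line because the first component of the field vanishes. In
  the fibre of the strip it is open by invariance of domain and closed by
  \<open>leaf_closed\<close>, so it is the whole connected fibre.\<close>

lemma vertical_leaf:
  assumes lip: "locally_lipschitz \<xi>" and B: "open B" and f: "continuous_on B f" and g: "continuous_on B g"
    and a1: "\<And>z. z \<in> strip B f g \<Longrightarrow> fst (\<xi> z) = 0" and a2: "\<And>z. z \<in> strip B f g \<Longrightarrow> 0 < snd (\<xi> z)"
    and L: "L \<in> leaves \<xi> (strip B f g)"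
  obtains x0 where "x0 \<in> B" "L = {z\<in>strip B f g. fst z = x0}"
proof -
  let ?C = "strip B f g"
  have C: "open ?C" by (rule open_strip[OF B f g])
  obtain I \<gamma> where I: "open I" "is_interval I" "I \<noteq> {}" "L = \<gamma> ` I" "\<And>t. t \<in> I \<Longrightarrow> \<gamma> t \<in> ?C"
    "\<And>t. t \<in> I \<Longrightarrow> (\<gamma> has_vector_derivative \<xi> (\<gamma> t)) (at t)"
    by (rule leaf_parametrization[OF L]) (rule that)
  obtain t0 where t0: "t0 \<in> I" using I(3) by blast
  define x0 where "x0 = fst (\<gamma> t0)"
  have "fst (\<gamma> t) = x0" if t: "t \<in> I" for t
  proof -
    have "((\<lambda>t. fst (\<gamma> t)) has_vector_derivative 0) (at u within I)" if "u \<in> I" for u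
    proof -
      have "((\<lambda>t. fst (\<gamma> t)) has_vector_derivative fst (\<xi> (\<gamma> u))) (at u)"
        by (rule bounded_linear.has_vector_derivative[OF bounded_linear_fst I(6)[OF that]])
      then show ?thesis using a1[OF I(5)[OF that]] by (simp add: has_vector_derivative_at_within)
    qed
    then obtain c where "\<And>u. u \<in> I \<Longrightarrow> fst (\<gamma> u) = c"
      using has_vector_derivative_zero_constant[of I "\<lambda>t. fst (\<gamma> t)"] I(2) by (metis is_interval_convex)
    then show ?thesis using t t0 by (simp add: x0_def)
  qed
  then have sub: "L \<subseteq> {z\<in>?C. fst z = x0}" using I by auto
  have x0B: "x0 \<in> B" using I(5)[OF t0] by (cases "\<gamma> t0") (auto simp: x0_def)
  let ?F = "{y. (x0, y) \<in> ?C}" and ?Y = "{y. (x0, y) \<in> L}"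
  have "connected ?F" using strip_fibre by (simp add: is_interval_connected_1)
  moreover have YF: "?Y \<subseteq> ?F" using sub by auto
  moreover have Yne: "?Y \<noteq> {}"
    using I(4) t0 \<open>\<And>t. t \<in> I \<Longrightarrow> fst (\<gamma> t) = x0\<close> by (auto intro!: exI[of _ "snd (\<gamma> t0)"] image_eqI[of _ _ t0] simp: prod_eq_iff)
  moreover have "openin (top_of_set ?F) ?Y"
  proof -
    have snd: "?Y = (\<lambda>t. snd (\<gamma> t)) ` I" using I(4) \<open>\<And>t. t \<in> I \<Longrightarrow> fst (\<gamma> t) = x0\<close>
      by (auto simp: image_iff prod_eq_iff) 
    have mono: "snd (\<gamma> s) < snd (\<gamma> t)" if "s \<in> I" "t \<in> I" "s < t" for s t
      using strict_mono_along[OF I(2,6), of "(0, 1)" s t] that a2[OF I(5)] by (simp add: inner_prod_def)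
    have "inj_on (\<lambda>t. snd (\<gamma> t)) I" by (rule inj_onI) (metis mono less_irrefl linorder_less_linear)
    moreover have "continuous_on I (\<lambda>t. snd (\<gamma> t))"
      using I(6) by (intro continuous_intros continuous_at_imp_continuous_on) (auto intro: has_vector_derivative_continuous)
    ultimately have "open ?Y" unfolding snd using I(1) by (intro invariance_of_domain)
    then show ?thesis using YF by (intro open_subset)
  qed
  moreover have "closedin (top_of_set ?F) ?Y"
  proof -
    have "?Y = ?F \<inter> Pair x0 -` closure L"
      using leaf_closed[OF lip C, of "(0, 1)", OF _ L] a2 closure_subset[of L] sub by (auto simp: inner_prod_def)
    moreover have "closed (Pair x0 -` closure L)" by (intro closed_vimage continuous_intros) simp
    ultimately show ?thesis by (metis closedin_closed_Int)
  qed
  ultimately have YF: "?Y = ?F" using connected_clopen by blast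
  have "z \<in> L" if "z \<in> ?C" "fst z = x0" for z
  proof -
    have "snd z \<in> ?F" using that by (cases z) simp
    then have "snd z \<in> ?Y" unfolding YF .
    then show ?thesis using that(2) by (cases z) simp
  qed
  then have "L = {z\<in>?C. fst z = x0}" using sub by blast
  then show thesis by (rule that[OF x0B])
qed

text \<open>The leaves are ordered by their abscissas \<open>x0 L\<close>. The field points upwards,
  so \<open>perp \<xi>\<close> points to the right, and \<open>U2\<close> is the part to the right
  of the leaf.\<close>

lemma vertical_ordered_sides:
  assumes lip: "locally_lipschitz \<xi>" and B: "open B" "is_interval B"
    and f: "continuous_on B f" and g: "continuous_on B g" and fg: "\<And>x. x \<in> B \<Longrightarrow> f x < g x"
    and a1: "\<And>z. z \<in> strip B f g \<Longrightarrow> fst (\<xi> z) = 0" and a2: "\<And>z. z \<in> strip B f g \<Longrightarrow> 0 < snd (\<xi> z)"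
  shows "\<exists>U1 U2. ordered_sides \<xi> (strip B f g) U1 U2"
proof -
  let ?C = "strip B f g"
  have "\<exists>x0. x0 \<in> B \<and> (\<forall>z. z \<in> L \<longleftrightarrow> z \<in> ?C \<and> fst z = x0)" if L: "L \<in> leaves \<xi> ?C" for L
  proof -
    obtain x0 where "x0 \<in> B" "L = {z\<in>?C. fst z = x0}"
      by (rule vertical_leaf[OF lip B(1) f g a1 a2 L]) (assumption | rule that)+
    then show ?thesis by blast
  qed
  then obtain x0 where x0: "\<And>L. L \<in> leaves \<xi> ?C \<Longrightarrow> x0 L \<in> B"
    "\<And>L z. L \<in> leaves \<xi> ?C \<Longrightarrow> z \<in> L \<longleftrightarrow> z \<in> ?C \<and> fst z = x0 L"
    by metis
  have full: "\<exists>y. (x, y) \<in> ?C" if "x \<in> B" for x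
    using ereal_dense2[OF fg[OF that]] that by auto
  define U1 where "U1 L = strip (B \<inter> {..<x0 L}) f g" for L
  define U2 where "U2 L = strip (B \<inter> {x0 L<..}) f g" for L
  have two: "two_sided \<xi> ?C L (U1 L) (U2 L)" if L: "L \<in> leaves \<xi> ?C" for L
  proof -
    have split: "?C - L = U1 L \<union> U2 L" using x0(2)[OF L] by (auto simp: U1_def U2_def strip_def)
    have strip_props: "open (strip A f g)" "connected (strip A f g)" "strip A f g \<noteq> {}"
      if A: "A \<subseteq> B" "open A" "is_interval A" "A \<noteq> {}" for A
    proof -
      show op: "open (strip A f g)" using A f g by (intro open_strip) (auto intro: continuous_on_subset)
      have proj: "fst ` strip A f g = A"
      proof
        show "A \<subseteq> fst ` strip A f g"
        proof
          fix x assume x: "x \<in> A"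
          then obtain y where "(x, y) \<in> ?C" using full A(1) by blast
          then have "(x, y) \<in> strip A f g" using x by simp
          then show "x \<in> fst ` strip A f g" by (rule image_eqI[rotated]) simp
        qed
      qed (auto simp: strip_def)
      then show "strip A f g \<noteq> {}" using A(4) by auto
      show "connected (strip A f g)" using connected_by_fibres[OF op strip_fibre] proj A(3) by simp
    qed
    have "x0 L \<in> interior B" using x0(1)[OF L] B(1) by (simp add: interior_open)
    then obtain e where e: "e > 0" "ball (x0 L) e \<subseteq> B" using B(1) x0(1)[OF L] open_contains_ball by blast
    have "x0 L - e/2 \<in> B \<inter> {..<x0 L}" "x0 L + e/2 \<in> B \<inter> {x0 L<..}"
      using e by (auto simp: subset_eq dist_real_def)
    then have ne: "B \<inter> {..<x0 L} \<noteq> {}" "B \<inter> {x0 L<..} \<noteq> {}" by blast+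
    have int: "is_interval (B \<inter> {..<x0 L})" "is_interval (B \<inter> {x0 L<..})"
      using B(2) by (simp_all add: is_interval_convex_1 convex_Int)
    note P1 = strip_props[of "B \<inter> {..<x0 L}", OF Int_lower1 open_Int[OF B(1) open_lessThan] int(1) ne(1)]
    note P2 = strip_props[of "B \<inter> {x0 L<..}", OF Int_lower1 open_Int[OF B(1) open_greaterThan] int(2) ne(2)]
    have dis: "U1 L \<inter> U2 L = {}" by (auto simp: U1_def U2_def strip_def)
    have comp: "components (?C - L) = {U1 L, U2 L}"
      using components_two[OF split] P1 P2 dis unfolding U1_def U2_def by blast
    have "side_at z (perp \<xi> z) (U1 L) (U2 L)" if z: "z \<in> L" for z
    proof -
      have zC: "z \<in> ?C" "fst z = x0 L" using x0(2)[OF L] z by auto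
      have "open ?C" by (rule open_strip[OF B(1) f g])
      then obtain r where r: "r > 0" "ball z r \<subseteq> ?C" using zC(1) open_contains_ball by blast
      \<comment> \<open>Scales \<open>perp \<xi> z\<close>, here \<open>(snd (\<xi> z), 0)\<close>,
        to the gradient of the first coordinate.\<close>
      define c where "c = 1 / snd (\<xi> z)"
      have c: "c > 0" using a2[OF zC(1)] by (simp add: c_def)
      have eq: "c * (perp \<xi> z \<bullet> v) = fst v" for v
        using a1[OF zC(1)] a2[OF zC(1)] by (simp add: perp_def inner_prod_def c_def)
      have "((\<lambda>p. fst p - x0 L) has_derivative fst) (at z)"
        by (auto intro!: derivative_eq_intros)
      then have der: "((\<lambda>p. fst p - x0 L) has_derivative (\<lambda>v. c * (perp \<xi> z \<bullet> v))) (at z)" unfolding eq .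
      have "(0 < fst p - x0 L \<longrightarrow> p \<in> U2 L) \<and> (fst p - x0 L < 0 \<longrightarrow> p \<in> U1 L)" if "p \<in> ball z r" for p
      proof -
        have "p \<in> ?C" using that r(2) by blast
        then show ?thesis by (cases p) (simp add: U1_def U2_def)
      qed
      then show ?thesis by (intro side_atI[OF r(1) c _ der]) (simp_all only: zC(2) diff_self)
    qed
    moreover have "U1 L \<noteq> {}" using P1(3) by (simp only: U1_def not_False_eq_True)
    then have "U1 L \<noteq> U2 L" using dis by blast
    moreover have "open (?C - L)" unfolding split U1_def U2_def by (rule open_Un[OF P1(1) P2(1)])
    ultimately show ?thesis unfolding two_sided_def using comp by (intro conjI ballI)
  qed
  have inj: "L = M" if "L \<in> leaves \<xi> ?C" "M \<in> leaves \<xi> ?C" "x0 L = x0 M" for L M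
  proof (rule set_eqI)
    fix z show "z \<in> L \<longleftrightarrow> z \<in> M"
      using x0(2)[OF that(1), of z] x0(2)[OF that(2), of z] that(3) by simp
  qed
  have less1: "L \<subseteq> U1 M \<longleftrightarrow> x0 L < x0 M" if L: "L \<in> leaves \<xi> ?C" and M: "M \<in> leaves \<xi> ?C" for L M
  proof
    assume sub: "L \<subseteq> U1 M"
    obtain y where y: "(x0 L, y) \<in> ?C" using full[OF x0(1)[OF L]] by blast
    then have "(x0 L, y) \<in> L" using x0(2)[OF L, of "(x0 L, y)"] by simp
    from subsetD[OF sub this] show "x0 L < x0 M" by (simp add: U1_def)
  next
    assume less: "x0 L < x0 M"
    show "L \<subseteq> U1 M"
    proof
      fix z assume "z \<in> L"
      then have "z \<in> ?C" "fst z = x0 L" using x0(2)[OF L, of z] by simp_all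
      then show "z \<in> U1 M" using less by (cases z) (simp add: U1_def)
    qed
  qed
  have less2: "L \<subseteq> U2 M \<longleftrightarrow> x0 M < x0 L" if L: "L \<in> leaves \<xi> ?C" and M: "M \<in> leaves \<xi> ?C" for L M
  proof
    assume sub: "L \<subseteq> U2 M"
    obtain y where y: "(x0 L, y) \<in> ?C" using full[OF x0(1)[OF L]] by blast
    then have "(x0 L, y) \<in> L" using x0(2)[OF L, of "(x0 L, y)"] by simp
    from subsetD[OF sub this] show "x0 M < x0 L" by (simp add: U2_def)
  next
    assume less: "x0 M < x0 L"
    show "L \<subseteq> U2 M"
    proof
      fix z assume "z \<in> L"
      then have "z \<in> ?C" "fst z = x0 L" using x0(2)[OF L, of z] by simp_all
      then show "z \<in> U2 M" using less by (cases z) (simp add: U2_def)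
    qed
  qed
  have eq1: "{(L, M). L \<in> leaves \<xi> ?C \<and> M \<in> leaves \<xi> ?C \<and> L \<subseteq> U1 M} = {(L, M). L \<in> leaves \<xi> ?C \<and> M \<in> leaves \<xi> ?C \<and> x0 L < x0 M}"
    using less1 by auto
  have eq2: "{(L, M). L \<in> leaves \<xi> ?C \<and> M \<in> leaves \<xi> ?C \<and> L \<subseteq> U2 M} = {(L, M). L \<in> leaves \<xi> ?C \<and> M \<in> leaves \<xi> ?C \<and> x0 M < x0 L}"
    using less2 by auto
  have "ordered_sides \<xi> ?C U1 U2" unfolding ordered_sides_def eq1 eq2
  proof (intro conjI ballI two)
    show "strict_linear_order_on (leaves \<xi> ?C) {(L, M). L \<in> leaves \<xi> ?C \<and> M \<in> leaves \<xi> ?C \<and> x0 L < x0 M}"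
      unfolding strict_linear_order_on_def trans_def irrefl_def total_on_def
      using inj by (fastforce simp: not_less_iff_gr_or_eq)
    show "strict_linear_order_on (leaves \<xi> ?C) {(L, M). L \<in> leaves \<xi> ?C \<and> M \<in> leaves \<xi> ?C \<and> x0 M < x0 L}"
      unfolding strict_linear_order_on_def trans_def irrefl_def total_on_def
      using inj by (fastforce simp: not_less_iff_gr_or_eq)
  qed
  then show ?thesis by blast
qed

section \<open>Leaves that are graphs\<close>

definition right_of :: "real set \<Rightarrow> real \<Rightarrow> bool" where "right_of J x \<longleftrightarrow> (\<forall>u\<in>J. u < x)"
definition left_of :: "real set \<Rightarrow> real \<Rightarrow> bool" where "left_of J x \<longleftrightarrow> (\<forall>u\<in>J. x < u)"

lemma right_or_left_of: "is_interval J \<Longrightarrow> x \<notin> J \<Longrightarrow> right_of J x \<or> left_of J x"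
  unfolding is_interval_1 right_of_def left_of_def by (metis linorder_not_less order_less_imp_le)

lemma at_within_closure_bot: "x \<notin> J \<Longrightarrow> at x within J = bot \<longleftrightarrow> x \<notin> closure (J :: real set)"
  by (simp add: at_within_eq_bot_iff)

text \<open>A positive function that does not decrease towards the right end stays above one of its
  values, so it cannot tend to zero. It is applied to a function that measures how far a leaf is
  from a boundary.\<close>

lemma no_positive_limit_right:
  fixes w w' :: "real \<Rightarrow> real"
  assumes J: "is_interval J" and \<beta>: "\<beta> \<in> closure J" "right_of J \<beta>" and \<delta>: "\<delta> > 0"
    and w: "\<And>x. x \<in> J \<Longrightarrow> \<bar>x - \<beta>\<bar> < \<delta> \<Longrightarrow> 0 < w x \<and> (w has_real_derivative w' x) (at x) \<and> 0 \<le> w' x"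
    and lim: "(w \<longlongrightarrow> 0) (at \<beta> within J)"
  shows False
proof -
  have "\<beta> \<notin> J" using \<beta>(2) unfolding right_of_def by blast
  then have nt: "at \<beta> within J \<noteq> bot" using at_within_closure_bot \<beta>(1) by blast
  obtain a where a: "a \<in> J" "dist a \<beta> < \<delta>" using \<beta>(1) \<delta> unfolding closure_approachable by blast
  have ab: "a < \<beta>" using a(1) \<beta>(2) by (simp add: right_of_def)
  have mono: "w a \<le> w x" if x: "x \<in> J" "a \<le> x" for x
  proof (rule DERIV_nonneg_imp_nondecreasing[OF x(2)])
    fix u assume u: "a \<le> u" "u \<le> x"
    have "u \<in> J" using J a(1) x(1) u unfolding is_interval_1 by blast
    moreover from this have "u < \<beta>" using \<beta>(2) by (simp add: right_of_def)
    then have "\<bar>u - \<beta>\<bar> < \<delta>" using u a(2) by (simp add: dist_real_def)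
    ultimately show "\<exists>y. (w has_real_derivative y) (at u) \<and> 0 \<le> y" using w by blast
  qed
  have "\<forall>\<^sub>F x in at \<beta> within J. w a \<le> w x" unfolding eventually_at
    by (rule exI[of _ "\<beta> - a"]) (use ab mono in \<open>auto simp: dist_real_def\<close>)
  then have "w a \<le> 0" by (rule tendsto_lowerbound[OF lim _ nt])
  then show False using w[OF a(1)] a(2) by (simp add: dist_real_def)
qed

lemma no_positive_limit_left:
  fixes w w' :: "real \<Rightarrow> real"
  assumes J: "is_interval J" and \<beta>: "\<beta> \<in> closure J" "left_of J \<beta>" and \<delta>: "\<delta> > 0"
    and w: "\<And>x. x \<in> J \<Longrightarrow> \<bar>x - \<beta>\<bar> < \<delta> \<Longrightarrow> 0 < w x \<and> (w has_real_derivative w' x) (at x) \<and> w' x \<le> 0"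
    and lim: "(w \<longlongrightarrow> 0) (at \<beta> within J)"
  shows False
proof -
  have "\<beta> \<notin> J" using \<beta>(2) unfolding left_of_def by blast
  then have nt: "at \<beta> within J \<noteq> bot" using at_within_closure_bot \<beta>(1) by blast
  obtain a where a: "a \<in> J" "dist a \<beta> < \<delta>" using \<beta>(1) \<delta> unfolding closure_approachable by blast
  have ab: "\<beta> < a" using a(1) \<beta>(2) by (simp add: left_of_def)
  have mono: "w a \<le> w x" if x: "x \<in> J" "x \<le> a" for x
  proof (rule DERIV_nonpos_imp_nonincreasing[OF x(2)])
    fix u assume u: "x \<le> u" "u \<le> a"
    have "u \<in> J" using J a(1) x(1) u unfolding is_interval_1 by blast
    moreover from this have "\<beta> < u" using \<beta>(2) by (simp add: left_of_def)
    then have "\<bar>u - \<beta>\<bar> < \<delta>" using u a(2) by (simp add: dist_real_def)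
    ultimately show "\<exists>y. (w has_real_derivative y) (at u) \<and> y \<le> 0" using w by blast
  qed
  have "\<forall>\<^sub>F x in at \<beta> within J. w a \<le> w x" unfolding eventually_at
    by (rule exI[of _ "a - \<beta>"]) (use ab mono in \<open>auto simp: dist_real_def\<close>)
  then have "w a \<le> 0" by (rule tendsto_lowerbound[OF lim _ nt])
  then show False using w[OF a(1)] a(2) by (simp add: dist_real_def)
qed

locale graph_strip =
  fixes \<xi> :: "plane \<Rightarrow> plane" and B :: "real set" and f g :: "real \<Rightarrow> ereal"
  assumes lip: "locally_lipschitz \<xi>" and openB: "open B" and intB: "is_interval B"
    and cf: "continuous_on B f" and cg: "continuous_on B g" and fg: "\<And>x. x \<in> B \<Longrightarrow> f x < g x"
    and a1: "\<And>z. z \<in> strip B f g \<Longrightarrow> 0 < fst (\<xi> z)"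
begin

lemma open_C: "open (strip B f g)"
  by (rule open_strip[OF openB cf cg])

lemma closed_leaf:
  assumes "L \<in> leaves \<xi> (strip B f g)" "p \<in> strip B f g" "p \<in> closure L" shows "p \<in> L"
  using leaf_closed[OF lip open_C, of "(1, 0)", OF _ assms] a1 by (simp add: inner_prod_def)

definition slope :: "real \<Rightarrow> real \<Rightarrow> real" where "slope x y = snd (\<xi> (x, y)) / fst (\<xi> (x, y))"

definition graph_of :: "plane set \<Rightarrow> real set \<Rightarrow> (real \<Rightarrow> real) \<Rightarrow> bool"
  where "graph_of L J h \<longleftrightarrow> open J \<and> is_interval J \<and> J \<noteq> {} \<and> J \<subseteq> B \<and>
    (\<forall>x y. (x, y) \<in> L \<longleftrightarrow> x \<in> J \<and> y = h x) \<and>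
    (\<forall>x\<in>J. (x, h x) \<in> strip B f g \<and> (h has_real_derivative slope x (h x)) (at x))"

text \<open>The first coordinate increases strictly along the leaf, so it can replace time as the
  parameter; differentiating its inverse function gives the derivative \<open>slope\<close>.\<close>

lemma leaf_graph:
  assumes L: "L \<in> leaves \<xi> (strip B f g)"
  obtains J h where "graph_of L J h"
proof -
  obtain I \<gamma> where I: "open I" "is_interval I" "I \<noteq> {}" "L = \<gamma> ` I" "\<And>t. t \<in> I \<Longrightarrow> \<gamma> t \<in> strip B f g"
    "\<And>t. t \<in> I \<Longrightarrow> (\<gamma> has_vector_derivative \<xi> (\<gamma> t)) (at t)"
    by (rule leaf_parametrization[OF L]) (rule that)
  define X where "X t = fst (\<gamma> t)" for t
  have pos: "0 < fst (\<xi> (\<gamma> t))" if "t \<in> I" for t using a1[OF I(5)[OF that]] .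
  have mono: "X s < X t" if "s \<in> I" "t \<in> I" "s < t" for s t
    using strict_mono_along[OF I(2,6), of "(1, 0)" s t] that pos by (simp add: inner_prod_def X_def)
  have inj: "inj_on X I"
  proof (rule inj_onI)
    fix s t assume "s \<in> I" "t \<in> I" "X s = X t"
    then show "s = t" using mono[of s t] mono[of t s] by (cases s t rule: linorder_cases) auto
  qed
  have dX: "(X has_real_derivative fst (\<xi> (\<gamma> t))) (at t)" if "t \<in> I" for t
    unfolding X_def has_real_derivative_iff_has_vector_derivative
    by (rule bounded_linear.has_vector_derivative[OF bounded_linear_fst I(6)[OF that]])
  have dY: "((\<lambda>t. snd (\<gamma> t)) has_real_derivative snd (\<xi> (\<gamma> t))) (at t)" if "t \<in> I" for t
    unfolding has_real_derivative_iff_has_vector_derivative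
    by (rule bounded_linear.has_vector_derivative[OF bounded_linear_snd I(6)[OF that]])
  have cX: "continuous_on I X" using dX DERIV_isCont continuous_at_imp_continuous_on by blast
  define J where "J = X ` I"
  define T where "T = the_inv_into I X"
  define h where "h x = snd (\<gamma> (T x))" for x
  have TX: "T (X t) = t" if "t \<in> I" for t unfolding T_def by (rule the_inv_into_f_f[OF inj that])
  have \<gamma>eq: "\<gamma> t = (X t, h (X t))" if "t \<in> I" for t using TX[OF that] by (simp add: X_def h_def)
  have "open J" unfolding J_def by (rule invariance_of_domain[OF cX I(1) inj])
  moreover have "is_interval J" unfolding J_def is_interval_connected_1
    by (rule connected_continuous_image[OF cX]) (use I(2) in \<open>simp add: is_interval_connected_1\<close>)
  moreover have "J \<noteq> {}" using I(3) by (simp add: J_def)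
  moreover have "J \<subseteq> B"
  proof
    fix x assume "x \<in> J"
    then obtain t where "t \<in> I" "x = X t" unfolding J_def by blast
    then show "x \<in> B" using I(5)[of t] \<gamma>eq[of t] by simp
  qed
  moreover have "(x, y) \<in> L \<longleftrightarrow> x \<in> J \<and> y = h x" for x y
    unfolding I(4) J_def using \<gamma>eq by (auto simp: image_iff) 
  moreover have "(x, h x) \<in> strip B f g \<and> (h has_real_derivative slope x (h x)) (at x)" if "x \<in> J" for x
  proof -
    obtain t where t: "t \<in> I" "x = X t" using \<open>x \<in> J\<close> unfolding J_def by blast
    have dT: "(T has_real_derivative inverse (fst (\<xi> (\<gamma> t)))) (at (X t))"
      unfolding has_field_derivative_def
      by (rule has_derivative_inverse_strong[OF I(1) t(1) cX TX dX[OF t(1), unfolded has_field_derivative_def]])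
        (use pos[OF t(1)] in \<open>auto simp: fun_eq_iff\<close>)
    have "((\<lambda>t. snd (\<gamma> t)) has_real_derivative snd (\<xi> (\<gamma> t))) (at (T (X t)))"
      using dY[OF t(1)] TX[OF t(1)] by simp
    from DERIV_chain2[OF this dT] have "(h has_real_derivative snd (\<xi> (\<gamma> t)) * inverse (fst (\<xi> (\<gamma> t)))) (at (X t))"
      by (simp add: h_def[abs_def])
    then show ?thesis using I(5)[OF t(1)] \<gamma>eq[OF t(1)] by (simp add: slope_def t(2) divide_inverse)
  qed
  ultimately show thesis using that[of J h] unfolding graph_of_def by blast
qed

text \<open>No point of the fibre of the strip over \<open>\<beta>\<close> is a limit of the leaf,
  because the leaf is closed in the strip and \<open>\<beta>\<close> is outside its domain. So near
  \<open>\<beta>\<close> the graph stays away from each height \<open>m\<close> of the fibre, either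
  above or below it. These two alternatives are open and disjoint conditions on \<open>m\<close>;
  the fibre is connected, hence the same one holds for all \<open>m\<close>, and \<open>h\<close> is
  squeezed towards \<open>g \<beta>\<close> or \<open>f \<beta>\<close>.\<close>

lemma boundary_limit:
  assumes L: "L \<in> leaves \<xi> (strip B f g)" and G: "graph_of L J h"
    and \<beta>: "\<beta> \<in> B" "\<beta> \<notin> J" "\<beta> \<in> closure J"
  shows "((\<lambda>x. ereal (h x)) \<longlongrightarrow> f \<beta>) (at \<beta> within J) \<or> ((\<lambda>x. ereal (h x)) \<longlongrightarrow> g \<beta>) (at \<beta> within J)"
proof -
  have J: "open J" "is_interval J" "J \<subseteq> B" and Liff: "\<And>x y. (x, y) \<in> L \<longleftrightarrow> x \<in> J \<and> y = h x"
    and hC: "\<And>x. x \<in> J \<Longrightarrow> (x, h x) \<in> strip B f g"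
    and dh: "\<And>x. x \<in> J \<Longrightarrow> (h has_real_derivative slope x (h x)) (at x)"
    using G unfolding graph_of_def by blast+
  have ch: "continuous_on J h" using dh DERIV_isCont continuous_at_imp_continuous_on by blast
  \<comment> \<open>\<open>r\<close> is both the radius around \<open>\<beta>\<close> and the margin
    in height; the margin makes \<open>U\<close> and \<open>V\<close> open.\<close>
  define U where "U = {m. \<exists>r>0. \<forall>x\<in>J. \<bar>x - \<beta>\<bar> < r \<longrightarrow> m + r \<le> h x}"
  define V where "V = {m. \<exists>r>0. \<forall>x\<in>J. \<bar>x - \<beta>\<bar> < r \<longrightarrow> h x \<le> m - r}"
  define M where "M = {m. f \<beta> < ereal m \<and> ereal m < g \<beta>}"
  have "open U" unfolding open_contains_ball
  proof
    fix m assume "m \<in> U"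
    then obtain r where r: "r > 0" "\<And>x. x \<in> J \<Longrightarrow> \<bar>x - \<beta>\<bar> < r \<Longrightarrow> m + r \<le> h x" unfolding U_def by blast
    have "m' \<in> U" if "m' \<in> ball m (r/2)" for m'
    proof -
      have "\<bar>m - m'\<bar> < r/2" using that by (simp only: mem_ball dist_real_def)
      then have m': "m' < m + r/2" by linarith
      have "m' + r/2 \<le> h x" if "x \<in> J" "\<bar>x - \<beta>\<bar> < r/2" for x
        using r(1) r(2)[OF that(1)] that(2) m' by simp
      then show ?thesis unfolding U_def using r(1) half_gt_zero by blast
    qed
    then show "\<exists>e>0. ball m e \<subseteq> U" using r(1) half_gt_zero by blast
  qed
  moreover have "open V" unfolding open_contains_ball
  proof
    fix m assume "m \<in> V"
    then obtain r where r: "r > 0" "\<And>x. x \<in> J \<Longrightarrow> \<bar>x - \<beta>\<bar> < r \<Longrightarrow> h x \<le> m - r" unfolding V_def by blast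
    have "m' \<in> V" if "m' \<in> ball m (r/2)" for m'
    proof -
      have "\<bar>m - m'\<bar> < r/2" using that by (simp only: mem_ball dist_real_def)
      then have m': "m - r/2 < m'" by linarith
      have "h x \<le> m' - r/2" if "x \<in> J" "\<bar>x - \<beta>\<bar> < r/2" for x
        using r(1) r(2)[OF that(1)] that(2) m' by simp
      then show ?thesis unfolding V_def using r(1) half_gt_zero by blast
    qed
    then show "\<exists>e>0. ball m e \<subseteq> V" using r(1) half_gt_zero by blast
  qed
  moreover have "U \<inter> V = {}"
  proof (rule ccontr)
    assume "U \<inter> V \<noteq> {}"
    then obtain m r r' where r: "r > 0" "\<And>x. x \<in> J \<Longrightarrow> \<bar>x - \<beta>\<bar> < r \<Longrightarrow> m + r \<le> h x"
      "r' > 0" "\<And>x. x \<in> J \<Longrightarrow> \<bar>x - \<beta>\<bar> < r' \<Longrightarrow> h x \<le> m - r'" unfolding U_def V_def by blast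
    obtain x where "x \<in> J" "dist x \<beta> < min r r'"
      using \<beta>(3) r(1,3) unfolding closure_approachable by (meson min_less_iff_conj)
    then have x: "x \<in> J" "\<bar>x - \<beta>\<bar> < r" "\<bar>x - \<beta>\<bar> < r'" by (simp_all add: dist_real_def)
    show False using r(1,3) r(2)[OF x(1,2)] r(4)[OF x(1,3)] by simp
  qed
  moreover have "M \<subseteq> U \<union> V"
  proof
    fix m assume "m \<in> M"
    then have C: "(\<beta>, m) \<in> strip B f g" using \<beta>(1) by (simp add: M_def)
    have "(\<beta>, m) \<notin> L" using Liff \<beta>(2) by blast
    then have "(\<beta>, m) \<notin> closure L" using closed_leaf[OF L C] by blast
    then obtain e where e: "e > 0" "\<And>z. z \<in> L \<Longrightarrow> e \<le> dist z (\<beta>, m)"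
      unfolding closure_approachable by (meson not_less)
    define r where "r = e / 2"
    have r: "r > 0" using e by (simp add: r_def)
    have far: "r \<le> \<bar>h x - m\<bar>" if x: "x \<in> J" "\<bar>x - \<beta>\<bar> < r" for x
    proof (rule ccontr)
      assume "\<not> r \<le> \<bar>h x - m\<bar>"
      moreover have "dist (x, h x) (\<beta>, m) \<le> \<bar>x - \<beta>\<bar> + \<bar>h x - m\<bar>"
        unfolding dist_Pair_Pair dist_real_def using sqrt_sum_squares_le_sum_abs[of "\<bar>x - \<beta>\<bar>" "\<bar>h x - m\<bar>"] by simp
      moreover have "e \<le> dist (x, h x) (\<beta>, m)" using e(2) Liff x(1) by blast
      ultimately show False using x(2) by (simp add: r_def)
    qed
    let ?N = "J \<inter> ball \<beta> r"
    have "connected ?N" using J(2) is_interval_Int[of J "ball \<beta> r"]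
      by (simp add: is_interval_connected_1[symmetric] is_interval_ball_real)
    then have conn: "connected (h ` ?N)"
      by (intro connected_continuous_image continuous_on_subset[OF ch]) auto
    have N: "x \<in> ?N \<longleftrightarrow> x \<in> J \<and> \<bar>x - \<beta>\<bar> < r" for x by (auto simp: dist_real_def abs_minus_commute)
    have "m \<notin> h ` ?N" using far r N by force
    moreover have "m \<in> h ` ?N" if "s \<in> ?N" "t \<in> ?N" "h s \<le> m" "m \<le> h t" for s t
      using conn[unfolded connected_iff_interval, rule_format, OF imageI[OF that(1)] imageI[OF that(2)] that(3,4)] .
    ultimately have "(\<forall>x\<in>?N. m < h x) \<or> (\<forall>x\<in>?N. h x < m)" by (meson not_less)
    then show "m \<in> U \<union> V"
    proof
      assume *: "\<forall>x\<in>?N. m < h x"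
      have "m + r \<le> h x" if "x \<in> J" "\<bar>x - \<beta>\<bar> < r" for x
        using far[OF that] * N that by force
      then show ?thesis unfolding U_def using r by blast
    next
      assume *: "\<forall>x\<in>?N. h x < m"
      have "h x \<le> m - r" if "x \<in> J" "\<bar>x - \<beta>\<bar> < r" for x
        using far[OF that] * N that by force
      then show ?thesis unfolding V_def using r by blast
    qed
  qed
  moreover have "connected M"
  proof -
    have "M = {y. (\<beta>, y) \<in> strip B f g}" using \<beta>(1) by (simp add: M_def)
    then show ?thesis using strip_fibre by (simp add: is_interval_connected_1)
  qed
  ultimately consider "V \<inter> M = {}" "M \<subseteq> U" | "U \<inter> M = {}" "M \<subseteq> V"
    using connectedD[of M U V] by blast
  then show ?thesis
  proof cases
    case 1
    have "((\<lambda>x. ereal (h x)) \<longlongrightarrow> g \<beta>) (at \<beta> within J)"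
    proof (rule order_tendstoI)
      fix a assume "a < g \<beta>"
      then have "max a (f \<beta>) < g \<beta>" using fg[OF \<beta>(1)] by simp
      then obtain m where m: "max a (f \<beta>) < ereal m" "ereal m < g \<beta>" using ereal_dense2 by blast
      then have "m \<in> U" using 1(2) by (auto simp: M_def)
      then obtain r where r: "r > 0" "\<And>x. x \<in> J \<Longrightarrow> \<bar>x - \<beta>\<bar> < r \<Longrightarrow> m + r \<le> h x" unfolding U_def by blast
      have "a < ereal (h x)" if "x \<in> J" "\<bar>x - \<beta>\<bar> < r" for x
      proof -
        have "ereal m < ereal (h x)" using r(1) r(2)[OF that] by simp
        then show ?thesis using m(1) by (meson less_trans max_less_iff_conj)
      qed
      then show "\<forall>\<^sub>F x in at \<beta> within J. a < ereal (h x)"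
        unfolding eventually_at dist_real_def using r(1) by blast
    next
      fix a assume "g \<beta> < a"
      moreover have "(g \<longlongrightarrow> g \<beta>) (at \<beta> within J)"
        using cg J(3) \<beta>(1) openB by (meson at_le continuous_on_def filterlim_mono order_refl tendsto_within_subset)
      ultimately have "\<forall>\<^sub>F x in at \<beta> within J. g x < a" by (rule order_tendstoD(2)[rotated])
      moreover have "\<forall>\<^sub>F x in at \<beta> within J. x \<in> J" by (simp add: eventually_at_filter)
      ultimately show "\<forall>\<^sub>F x in at \<beta> within J. ereal (h x) < a"
        by eventually_elim (use hC in \<open>auto intro: less_trans\<close>)
    qed
    then show ?thesis by blast
  next
    case 2
    have "((\<lambda>x. ereal (h x)) \<longlongrightarrow> f \<beta>) (at \<beta> within J)"
    proof (rule order_tendstoI)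
      fix a assume "f \<beta> < a"
      then have "f \<beta> < min a (g \<beta>)" using fg[OF \<beta>(1)] by simp
      then obtain m where m: "f \<beta> < ereal m" "ereal m < min a (g \<beta>)" using ereal_dense2 by blast
      then have "m \<in> V" using 2(2) by (auto simp: M_def)
      then obtain r where r: "r > 0" "\<And>x. x \<in> J \<Longrightarrow> \<bar>x - \<beta>\<bar> < r \<Longrightarrow> h x \<le> m - r" unfolding V_def by blast
      have "ereal (h x) < a" if "x \<in> J" "\<bar>x - \<beta>\<bar> < r" for x
      proof -
        have "ereal (h x) < ereal m" using r(1) r(2)[OF that] by simp
        then show ?thesis using m(2) by (meson less_trans min_less_iff_conj)
      qed
      then show "\<forall>\<^sub>F x in at \<beta> within J. ereal (h x) < a"
        unfolding eventually_at dist_real_def using r(1) by blast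
    next
      fix a assume "a < f \<beta>"
      moreover have "(f \<longlongrightarrow> f \<beta>) (at \<beta> within J)"
        using cf J(3) \<beta>(1) openB by (meson at_le continuous_on_def filterlim_mono order_refl tendsto_within_subset)
      ultimately have "\<forall>\<^sub>F x in at \<beta> within J. a < f x" by (rule order_tendstoD(1)[rotated])
      moreover have "\<forall>\<^sub>F x in at \<beta> within J. x \<in> J" by (simp add: eventually_at_filter)
      ultimately show "\<forall>\<^sub>F x in at \<beta> within J. a < ereal (h x)"
        by eventually_elim (use hC in \<open>auto intro: less_trans\<close>)
    qed
    then show ?thesis by blast
  qed
qed

text \<open>An extended leaf function does not record the domain of its leaf separately: the domain
  is the set where the function lies strictly between the two boundaries.\<close>

definition core :: "(real \<Rightarrow> ereal) \<Rightarrow> real set" where "core k = {x\<in>B. f x < k x \<and> k x < g x}"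

text \<open>The function of a leaf, extended by one of the two boundary functions to the left and to
  the right of the domain of the leaf.\<close>

definition leaf_fun :: "plane set \<Rightarrow> (real \<Rightarrow> ereal) \<Rightarrow> bool"
  where "leaf_fun L k \<longleftrightarrow> continuous_on B k \<and> (\<forall>x\<in>B. f x \<le> k x \<and> k x \<le> g x) \<and>
    open (core k) \<and> is_interval (core k) \<and> core k \<noteq> {} \<and>
    (\<forall>x y. (x, y) \<in> L \<longleftrightarrow> x \<in> core k \<and> k x = ereal y) \<and>
    (\<forall>x\<in>core k. ((\<lambda>x. real_of_ereal (k x)) has_real_derivative slope x (real_of_ereal (k x))) (at x)) \<and>
    ((\<forall>x\<in>B. right_of (core k) x \<longrightarrow> k x = f x) \<or> (\<forall>x\<in>B. right_of (core k) x \<longrightarrow> k x = g x)) \<and>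
    ((\<forall>x\<in>B. left_of (core k) x \<longrightarrow> k x = f x) \<or> (\<forall>x\<in>B. left_of (core k) x \<longrightarrow> k x = g x))"

lemma leaf_fun_exists:
  assumes L: "L \<in> leaves \<xi> (strip B f g)"
  shows "\<exists>k. leaf_fun L k"
proof -
  obtain J h where G: "graph_of L J h" by (rule leaf_graph[OF L])
  then have J: "open J" "is_interval J" "J \<noteq> {}" "J \<subseteq> B" and Liff: "\<And>x y. (x, y) \<in> L \<longleftrightarrow> x \<in> J \<and> y = h x"
    and hC: "\<And>x. x \<in> J \<Longrightarrow> (x, h x) \<in> strip B f g"
    and dh: "\<And>x. x \<in> J \<Longrightarrow> (h has_real_derivative slope x (h x)) (at x)"
    unfolding graph_of_def by blast+
  \<comment> \<open>On either side of \<open>J\<close> at most one point lies in the closure of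
    \<open>J\<close>; there the limit selects a boundary function. At all other points of that side
    the filter is \<open>bot\<close> and the limit claim is vacuous, so one boolean serves for the
    whole side.\<close>
  have choose: "\<exists>b. \<forall>x\<in>B. Q x \<longrightarrow> ((\<lambda>x. ereal (h x)) \<longlongrightarrow> (if b then f x else g x)) (at x within J)"
    if Q: "\<And>x. Q x \<Longrightarrow> x \<notin> J" "\<And>x y. Q x \<Longrightarrow> Q y \<Longrightarrow> x \<in> closure J \<Longrightarrow> y \<in> closure J \<Longrightarrow> x = y" for Q
  proof (cases "\<exists>x\<in>B. Q x \<and> x \<in> closure J")
    case True
    then obtain x where x: "x \<in> B" "Q x" "x \<in> closure J" by blast
    then have "\<exists>b. ((\<lambda>x. ereal (h x)) \<longlongrightarrow> (if b then f x else g x)) (at x within J)"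
      using boundary_limit[OF L G x(1) Q(1)[OF x(2)] x(3)] by (metis (full_types))
    then obtain b where b: "((\<lambda>x. ereal (h x)) \<longlongrightarrow> (if b then f x else g x)) (at x within J)" by blast
    have "((\<lambda>x. ereal (h x)) \<longlongrightarrow> (if b then f y else g y)) (at y within J)" if "Q y" for y
    proof (cases "y \<in> closure J")
      case True
      then have "y = x" using Q(2) x that by blast
      with b show ?thesis by (simp only:)
    next
      case False
      then have "at y within J = bot" using at_within_closure_bot Q(1)[OF that] by blast
      then show ?thesis by simp
    qed
    then show ?thesis by blast
  next
    case False
    then have "at x within J = bot" if "x \<in> B" "Q x" for x
      using at_within_closure_bot Q(1)[OF that(2)] that by blast
    then show ?thesis by simp
  qed
  have r1: "x \<notin> J" if "right_of J x" for x using that unfolding right_of_def by blast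
  have l1: "x \<notin> J" if "left_of J x" for x using that unfolding left_of_def by blast
  have rl: "\<not> (right_of J x \<and> left_of J x)" for x
    using J(3) unfolding right_of_def left_of_def by (metis all_not_in_conv less_asym)
  have r2: "\<not> x < y" if xy: "right_of J x" "y \<in> closure J" for x y
  proof
    assume "x < y"
    then obtain u where "u \<in> J" "dist u y < y - x" using xy(2) unfolding closure_approachable by (meson diff_gt_0_iff_gt)
    moreover from this have "u < x" using xy(1) by (simp add: right_of_def)
    ultimately show False by (simp add: dist_real_def abs_less_iff)
  qed
  have l2: "\<not> y < x" if xy: "left_of J x" "y \<in> closure J" for x y
  proof
    assume "y < x"
    then obtain u where "u \<in> J" "dist u y < x - y" using xy(2) unfolding closure_approachable by (meson diff_gt_0_iff_gt)
    moreover from this have "x < u" using xy(1) by (simp add: left_of_def)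
    ultimately show False by (simp add: dist_real_def abs_less_iff)
  qed
  obtain r where r: "\<And>x. x \<in> B \<Longrightarrow> right_of J x \<Longrightarrow> ((\<lambda>x. ereal (h x)) \<longlongrightarrow> (if r then f x else g x)) (at x within J)"
    using choose[of "right_of J"] r1 r2 by (metis linorder_neqE)
  obtain l where l: "\<And>x. x \<in> B \<Longrightarrow> left_of J x \<Longrightarrow> ((\<lambda>x. ereal (h x)) \<longlongrightarrow> (if l then f x else g x)) (at x within J)"
    using choose[of "left_of J"] l1 l2 by (metis linorder_neqE)
  define k where "k x = (if x \<in> J then ereal (h x) else if right_of J x then (if r then f x else g x)
    else (if l then f x else g x))" for x
  have kR: "k x = (if r then f x else g x)" if "right_of J x" for x
    using r1[OF that] that by (simp add: k_def)
  have kL: "k x = (if l then f x else g x)" if "left_of J x" for x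
    using l1[OF that] rl[of x] that by (simp add: k_def)
  have core: "core k = J"
  proof (rule set_eqI)
    fix x
    show "x \<in> core k \<longleftrightarrow> x \<in> J"
    proof (cases "x \<in> J")
      case True
      then show ?thesis using hC[OF True] by (simp add: core_def k_def)
    next
      case False
      then have "k x = f x \<or> k x = g x" by (simp add: k_def)
      then show ?thesis using False by (auto simp: core_def)
    qed
  qed
  have cfat: "(f \<longlongrightarrow> f x) (at x)" "(g \<longlongrightarrow> g x) (at x)" if "x \<in> B" for x
    using cf cg that openB by (simp_all add: continuous_on_eq_continuous_at isCont_def)
  have cont: "isCont k x" if x: "x \<in> B" for x
  proof (cases "x \<in> J")
    case True
    have "isCont (\<lambda>x. ereal (h x)) x" using DERIV_isCont[OF dh[OF True]] by (intro continuous_intros)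
    moreover have "\<forall>\<^sub>F y in nhds x. ereal (h y) = k y"
      using eventually_nhds_in_open[OF J(1) True] by eventually_elim (simp add: k_def)
    ultimately show ?thesis using isCont_cong[of "\<lambda>x. ereal (h x)" k x] by blast
  next
    case False
    obtain u where u: "u \<in> J" using J(3) by blast
    \<comment> \<open>Combines the limit along \<open>J\<close>, where \<open>k\<close> follows the
      leaf, with the limit along the complement, where \<open>k\<close> is a boundary
      function.\<close>
    have lim: "(k \<longlongrightarrow> (if b then f x else g x)) (at x)"
      if ev: "\<forall>\<^sub>F y in at x within - J. k y = (if b then f y else g y)"
        and lJ: "((\<lambda>x. ereal (h x)) \<longlongrightarrow> (if b then f x else g x)) (at x within J)" for b
    proof -
      have "((\<lambda>y. if b then f y else g y) \<longlongrightarrow> (if b then f x else g x)) (at x)"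
        using cfat[OF x] by (cases b) simp_all
      then have "((\<lambda>y. if b then f y else g y) \<longlongrightarrow> (if b then f x else g x)) (at x within - J)"
        by (rule tendsto_within_subset) simp
      then have 1: "(k \<longlongrightarrow> (if b then f x else g x)) (at x within - J)"
        using ev by (simp add: tendsto_cong)
      have "\<forall>\<^sub>F y in at x within J. k y = ereal (h y)"
        unfolding eventually_at_filter by (rule always_eventually) (simp add: k_def)
      then have 2: "(k \<longlongrightarrow> (if b then f x else g x)) (at x within J)"
        using lJ by (simp add: tendsto_cong)
      have "at x = sup (at x within J) (at x within - J)"
        using at_within_union[of x J "- J"] by simp
      then show ?thesis using filterlim_sup[OF 2 1] by simp
    qed
    from False J(2) consider "right_of J x" | "left_of J x" using right_or_left_of by blast
    then show ?thesis
    proof cases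
      case 1
      have "u < x" using 1 u by (simp add: right_of_def)
      have "k y = (if r then f y else g y)" if "y \<in> - J" "dist y x < x - u" for y
      proof -
        have "u < y" using that(2) by (simp add: dist_real_def abs_less_iff)
        then have "\<not> left_of J y" using u unfolding left_of_def by (meson less_asym)
        then have "right_of J y" using right_or_left_of[OF J(2)] that(1) by blast
        then show ?thesis by (rule kR)
      qed
      then have "\<forall>\<^sub>F y in at x within - J. k y = (if r then f y else g y)"
        unfolding eventually_at using \<open>u < x\<close> diff_gt_0_iff_gt by blast
      from lim[OF this r[OF x 1]] show ?thesis unfolding isCont_def kR[OF 1] .
    next
      case 2
      have "x < u" using 2 u by (simp add: left_of_def)
      have "k y = (if l then f y else g y)" if "y \<in> - J" "dist y x < u - x" for y
      proof -
        have "y < u" using that(2) by (simp add: dist_real_def abs_less_iff)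
        then have "\<not> right_of J y" using u unfolding right_of_def by (meson less_asym)
        then have "left_of J y" using right_or_left_of[OF J(2)] that(1) by blast
        then show ?thesis by (rule kL)
      qed
      then have "\<forall>\<^sub>F y in at x within - J. k y = (if l then f y else g y)"
        unfolding eventually_at using \<open>x < u\<close> diff_gt_0_iff_gt by blast
      from lim[OF this l[OF x 2]] show ?thesis unfolding isCont_def kL[OF 2] .
    qed
  qed
  have "leaf_fun L k" unfolding leaf_fun_def core
  proof (intro conjI ballI allI)
    show "continuous_on B k" using cont continuous_at_imp_continuous_on by blast
    show "f x \<le> k x" "k x \<le> g x" if "x \<in> B" for x
      using hC[of x] fg[OF that] unfolding k_def by auto
    show "((x, y) \<in> L) = (x \<in> J \<and> k x = ereal y)" for x y using Liff[of x y] by (auto simp: k_def)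
    show "((\<lambda>x. real_of_ereal (k x)) has_real_derivative slope x (real_of_ereal (k x))) (at x)" if x: "x \<in> J" for x
    proof -
      have "((\<lambda>x. real_of_ereal (k x)) has_real_derivative slope x (h x)) (at x)"
        by (rule has_field_derivative_transform_within_open[OF dh[OF x] J(1) x]) (simp add: k_def)
      then show ?thesis using x by (simp add: k_def)
    qed
    show "(\<forall>x\<in>B. right_of J x \<longrightarrow> k x = f x) \<or> (\<forall>x\<in>B. right_of J x \<longrightarrow> k x = g x)"
      using kR by (cases r) simp_all
    show "(\<forall>x\<in>B. left_of J x \<longrightarrow> k x = f x) \<or> (\<forall>x\<in>B. left_of J x \<longrightarrow> k x = g x)"
      using kL by (cases l) simp_all
  qed (use J in auto)
  then show ?thesis by blast
qed

end

text \<open>\<open>F\<close> is a lower boundary function if \<open>s = 1\<close> and an upper one if \<open>s = -1\<close>. The vector field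
  crosses the vertical translates of its graph inside the strip in the direction given by \<open>\<sigma>\<close>.\<close>

definition boundary_sign :: "(plane \<Rightarrow> plane) \<Rightarrow> real set \<Rightarrow> real \<Rightarrow> (real \<Rightarrow> ereal) \<Rightarrow> bool"
  where "boundary_sign \<xi> B s F \<longleftrightarrow> (\<forall>x\<in>B. F x = ereal (- s) * \<infinity>) \<or>
    (\<exists>\<phi> \<phi>' \<sigma>. (\<sigma> = 1 \<or> \<sigma> = - 1) \<and> (\<forall>x\<in>B. F x = ereal (\<phi> x) \<and> (\<phi> has_real_derivative \<phi>' x) (at x) \<and>
      (\<exists>e>0. \<exists>d>0. \<forall>x' u. \<bar>x' - x\<bar> < d \<and> 0 < u \<and> u < e \<longrightarrow>
        0 \<le> \<sigma> * (snd (\<xi> (x', \<phi> x' + s * u)) - \<phi>' x' * fst (\<xi> (x', \<phi> x' + s * u))))))"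

text \<open>Reversing the field flips \<open>\<sigma>\<close> and leaves the infinite case
  untouched.\<close>

lemma boundary_sign_uminus:
  assumes "boundary_sign \<xi> B s F" shows "boundary_sign (\<lambda>z. - \<xi> z) B s F"
proof (cases "\<forall>x\<in>B. F x = ereal (- s) * \<infinity>")
  case True
  then show ?thesis unfolding boundary_sign_def by blast
next
  case False
  then obtain \<phi> \<phi>' \<sigma> where \<sigma>: "\<sigma> = 1 \<or> \<sigma> = - 1" and
    F: "\<And>x. x \<in> B \<Longrightarrow> F x = ereal (\<phi> x) \<and> (\<phi> has_real_derivative \<phi>' x) (at x) \<and>
      (\<exists>e>0. \<exists>d>0. \<forall>x' u. \<bar>x' - x\<bar> < d \<and> 0 < u \<and> u < e \<longrightarrow>
        0 \<le> \<sigma> * (snd (\<xi> (x', \<phi> x' + s * u)) - \<phi>' x' * fst (\<xi> (x', \<phi> x' + s * u))))"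
    using assms unfolding boundary_sign_def by blast
  have eq: "(- \<sigma>) * (snd (- \<xi> (x', \<phi> x' + s * u)) - \<phi>' x' * fst (- \<xi> (x', \<phi> x' + s * u)))
    = \<sigma> * (snd (\<xi> (x', \<phi> x' + s * u)) - \<phi>' x' * fst (\<xi> (x', \<phi> x' + s * u)))" for x' u
    by (simp add: algebra_simps)
  show ?thesis unfolding boundary_sign_def
    by (rule disjI2, rule exI[of _ \<phi>], rule exI[of _ \<phi>'], rule exI[of _ "- \<sigma>"], unfold eq)
      (use \<sigma> F in \<open>simp add: disj_commute\<close>)
qed

section \<open>Comparability of the extended leaf functions\<close>

context graph_strip begin

lemma leaf_fun_facts:
  assumes "leaf_fun L k"
  shows "continuous_on B k" "\<And>x. x \<in> B \<Longrightarrow> f x \<le> k x" "\<And>x. x \<in> B \<Longrightarrow> k x \<le> g x"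
    "open (core k)" "is_interval (core k)" "core k \<noteq> {}" "core k \<subseteq> B"
    "\<And>x y. (x, y) \<in> L \<longleftrightarrow> x \<in> core k \<and> k x = ereal y"
    "\<And>x. x \<in> core k \<Longrightarrow> ((\<lambda>x. real_of_ereal (k x)) has_real_derivative slope x (real_of_ereal (k x))) (at x)"
    "\<And>x. x \<in> core k \<Longrightarrow> k x = ereal (real_of_ereal (k x))"
    "\<And>x. x \<in> B \<Longrightarrow> x \<notin> core k \<Longrightarrow> k x = f x \<or> k x = g x"
    "(\<forall>x\<in>B. right_of (core k) x \<longrightarrow> k x = f x) \<or> (\<forall>x\<in>B. right_of (core k) x \<longrightarrow> k x = g x)"
    "(\<forall>x\<in>B. left_of (core k) x \<longrightarrow> k x = f x) \<or> (\<forall>x\<in>B. left_of (core k) x \<longrightarrow> k x = g x)"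
proof -
  show *: "continuous_on B k" "\<And>x. x \<in> B \<Longrightarrow> f x \<le> k x" "\<And>x. x \<in> B \<Longrightarrow> k x \<le> g x"
    "open (core k)" "is_interval (core k)" "core k \<noteq> {}" 
    "\<And>x y. (x, y) \<in> L \<longleftrightarrow> x \<in> core k \<and> k x = ereal y"
    "\<And>x. x \<in> core k \<Longrightarrow> ((\<lambda>x. real_of_ereal (k x)) has_real_derivative slope x (real_of_ereal (k x))) (at x)"
    "(\<forall>x\<in>B. right_of (core k) x \<longrightarrow> k x = f x) \<or> (\<forall>x\<in>B. right_of (core k) x \<longrightarrow> k x = g x)"
    "(\<forall>x\<in>B. left_of (core k) x \<longrightarrow> k x = f x) \<or> (\<forall>x\<in>B. left_of (core k) x \<longrightarrow> k x = g x)"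
    using assms unfolding leaf_fun_def by blast+
  show "core k \<subseteq> B" by (auto simp: core_def)
  show "k x = ereal (real_of_ereal (k x))" if "x \<in> core k" for x
    using that unfolding core_def by (cases "k x") auto
  show "k x = f x \<or> k x = g x" if "x \<in> B" "x \<notin> core k" for x
    using that *(2,3)[OF that(1)] unfolding core_def by auto
qed

text \<open>\<open>leaf_fun\<close> allows one boundary function on each side of the domain; as
  \<open>f < g\<close>, a single value decides which one it is.\<close>

lemma boundary_type:
  assumes k: "leaf_fun L k" and F: "F = f \<or> F = g" and x: "x \<in> B" "x' \<in> B" "k x = F x"
  shows "right_of (core k) x \<Longrightarrow> right_of (core k) x' \<Longrightarrow> k x' = F x'"
    and "left_of (core k) x \<Longrightarrow> left_of (core k) x' \<Longrightarrow> k x' = F x'"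
  using leaf_fun_facts(12,13)[OF k] F x fg[OF x(1)] by (metis less_irrefl)+

text \<open>The excluded situation: one leaf has run into \<open>F\<close> on its way to the right,
  and another one comes out of \<open>F\<close>. The points \<open>x\<close> and \<open>x'\<close>
  are anywhere beyond the domains, not just at their ends, because \<open>no_crossing_aux\<close>
  finds them as a point where two extended functions agree.\<close>

definition no_lens :: "(real \<Rightarrow> ereal) \<Rightarrow> bool"
  where "no_lens F \<longleftrightarrow> (\<forall>L M k m x x'. leaf_fun L k \<longrightarrow> leaf_fun M m \<longrightarrow> x \<in> B \<longrightarrow> right_of (core k) x \<longrightarrow> k x = F x \<longrightarrow>
    x' \<in> B \<longrightarrow> left_of (core m) x' \<longrightarrow> m x' = F x' \<longrightarrow> False)"

text \<open>At a point \<open>c\<close> where the functions agree, both lie on the same boundary,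
  since the leaves are disjoint. Suppose it is \<open>f\<close>. As \<open>m\<close> is above
  \<open>k\<close> at \<open>x0\<close>, it is not equal to \<open>f\<close> all the way to the
  left, so its domain lies to the left of \<open>c\<close>; as \<open>k\<close> is above
  \<open>m\<close> at \<open>x1\<close>, its domain lies to the right of \<open>c\<close>. This is
  what \<open>no_lens\<close> forbids, and the case of \<open>g\<close> is dual.\<close>

lemma no_crossing_aux:
  assumes nf: "no_lens f" and ng: "no_lens g"
    and k: "leaf_fun L k" and m: "leaf_fun M m" and dis: "L \<inter> M = {}"
    and x: "x0 \<in> B" "x1 \<in> B" "x0 < x1" "k x0 < m x0" "m x1 < k x1"
  shows False
proof -
  note K = leaf_fun_facts[OF k] and M = leaf_fun_facts[OF m]
  let ?U = "{x\<in>B. k x < m x}" and ?V = "{x\<in>B. m x < k x}"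
  have U: "open ?U" "open ?V" using open_less_on[OF openB] K(1) M(1) by blast+
  have sub: "{x0..x1} \<subseteq> B" using intB x(1,2) unfolding is_interval_1 by (meson atLeastAtMost_iff subsetI)
  have "\<exists>x\<in>{x0..x1}. k x = m x"
  proof (rule ccontr)
    assume "\<not> ?thesis"
    then have "{x0..x1} \<subseteq> ?U \<union> ?V" using sub by (auto simp: neq_iff)
    moreover have "?U \<inter> ?V \<inter> {x0..x1} = {}" by auto
    ultimately have "?U \<inter> {x0..x1} = {} \<or> ?V \<inter> {x0..x1} = {}"
      using connectedD[OF connected_Icc U] by blast
    moreover have "x0 \<in> ?U \<inter> {x0..x1}" "x1 \<in> ?V \<inter> {x0..x1}" using x by auto
    ultimately show False by blast
  qed
  then obtain c where c: "c \<in> {x0..x1}" "k c = m c" by blast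
  then have cB: "c \<in> B" and c0: "x0 < c" and c1: "c < x1"
    using sub x(4,5) by (auto simp: le_less)
  have notcore: "c \<notin> core k" "c \<notin> core m"
  proof -
    have "\<not> (c \<in> core k \<and> c \<in> core m)"
    proof
      assume *: "c \<in> core k \<and> c \<in> core m"
      then have "(c, real_of_ereal (k c)) \<in> L" using K(8,10) by blast
      moreover have "(c, real_of_ereal (k c)) \<in> M" using M(8,10) * c(2) by metis
      ultimately show False using dis by blast
    qed
    moreover have "c \<in> core k \<longleftrightarrow> c \<in> core m" using c(2) by (simp add: core_def)
    ultimately show "c \<notin> core k" "c \<notin> core m" by blast+
  qed
  have krl: "right_of (core k) c \<or> left_of (core k) c" using right_or_left_of[OF K(5) notcore(1)] .
  have mrl: "right_of (core m) c \<or> left_of (core m) c" using right_or_left_of[OF M(5) notcore(2)] .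
  have left: "left_of J c \<Longrightarrow> left_of J x0" and right: "right_of J c \<Longrightarrow> right_of J x1" for J
    using c0 c1 unfolding left_of_def right_of_def by (meson less_trans)+
  from K(11)[OF cB notcore(1)] show False
  proof
    assume kf: "k c = f c"
    then have mf: "m c = f c" using c(2) by simp
    have "\<not> left_of (core m) c"
      using boundary_type(2)[where F = f, OF m _ cB x(1) mf] left K(2)[OF x(1)] x(4) by (metis not_less)
    then have "right_of (core m) c" using mrl by blast
    moreover have "\<not> right_of (core k) c"
      using boundary_type(1)[where F = f, OF k _ cB x(2) kf] right M(2)[OF x(2)] x(5) by (metis not_less)
    then have "left_of (core k) c" using krl by blast
    ultimately show False using nf m k cB mf kf unfolding no_lens_def by blast
  next
    assume kg: "k c = g c"
    then have mg: "m c = g c" using c(2) by simp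
    have "\<not> left_of (core k) c"
      using boundary_type(2)[where F = g, OF k _ cB x(1) kg] left M(3)[OF x(1)] x(4) by (metis not_less)
    then have "right_of (core k) c" using krl by blast
    moreover have "\<not> right_of (core m) c"
      using boundary_type(1)[where F = g, OF m _ cB x(2) mg] right K(3)[OF x(2)] x(5) by (metis not_less)
    then have "left_of (core m) c" using mrl by blast
    ultimately show False using ng m k cB mg kg unfolding no_lens_def by blast
  qed
qed

lemma no_crossing:
  assumes "no_lens f" "no_lens g" "leaf_fun L k" "leaf_fun M m" "L \<inter> M = {}"
  shows "(\<forall>x\<in>B. k x \<le> m x) \<or> (\<forall>x\<in>B. m x \<le> k x)"
proof (rule ccontr)
  assume "\<not> ?thesis"
  then obtain x0 x1 where x: "x0 \<in> B" "x1 \<in> B" "k x0 < m x0" "m x1 < k x1" by (auto simp: not_le)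
  then have "x0 \<noteq> x1" by auto
  then consider "x0 < x1" | "x1 < x0" by linarith
  then show False
  proof cases
    case 1
    then show False using no_crossing_aux[OF assms x(1,2)] x by blast
  next
    case 2
    have "M \<inter> L = {}" using assms(5) by blast
    from no_crossing_aux[OF assms(1,2,4,3) this x(2,1) 2 x(4,3)] show False .
  qed
qed

text \<open>The first component of the field is positive, so \<open>perp \<xi>\<close> points
  downwards; this is why the part above the leaf comes first and the part below second. Each part is
  connected because its base is an interval: once the extended function has joined a boundary beyond
  the domain of the leaf, it stays there.\<close>

lemma leaf_two_sided:
  assumes L: "L \<in> leaves \<xi> (strip B f g)" and k: "leaf_fun L k"
  shows "two_sided \<xi> (strip B f g) L (strip B k g) (strip B f k)"
proof -
  note K = leaf_fun_facts[OF k]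
  have Liff: "(x, y) \<in> L \<longleftrightarrow> (x, y) \<in> strip B f g \<and> k x = ereal y" for x y
    unfolding K(8) core_def by auto
  have split: "strip B f g - L = strip B k g \<union> strip B f k"
  proof (rule set_eqI)
    fix z :: plane
    obtain x y where z: "z = (x, y)" by (cases z)
    show "z \<in> strip B f g - L \<longleftrightarrow> z \<in> strip B k g \<union> strip B f k"
      unfolding z using Liff[of x y] K(2,3)[of x] by (auto intro: le_less_trans less_le_trans)
  qed
  have op: "open (strip B k g)" "open (strip B f k)"
    using open_strip[OF openB] K(1) cf cg by blast+
  have dis: "strip B k g \<inter> strip B f k = {}" by (auto simp: strip_def)
  obtain c where c: "c \<in> core k" using K(6) by blast
  then have cc: "c \<in> B" "f c < k c" "k c < g c" by (simp_all add: core_def)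
  have ne: "strip B k g \<noteq> {}" "strip B f k \<noteq> {}"
    using ereal_dense2[OF cc(3)] ereal_dense2[OF cc(2)] cc(1) by (auto simp: strip_def)
  have proj: "fst ` strip B u v = {x\<in>B. u x < v x}" for u v
  proof (rule set_eqI)
    fix x
    show "x \<in> fst ` strip B u v \<longleftrightarrow> x \<in> {x\<in>B. u x < v x}"
    proof
      assume "x \<in> {x\<in>B. u x < v x}"
      then obtain y where "(x, y) \<in> strip B u v" using ereal_dense2[of "u x" "v x"] by auto
      then show "x \<in> fst ` strip B u v" by (rule image_eqI[rotated]) simp
    qed (auto simp: strip_def intro: less_trans)
  qed
  have outside: "x \<in> core k \<or> (right_of (core k) x \<or> left_of (core k) x)" for x
    using right_or_left_of[OF K(5)] by blast
  have conv: "is_interval {x\<in>B. k x \<noteq> F x}" if F: "F = f \<or> F = g" for F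
    unfolding is_interval_1
  proof (intro ballI allI impI)
    fix a b x assume a: "a \<in> {x\<in>B. k x \<noteq> F x}" and b: "b \<in> {x\<in>B. k x \<noteq> F x}" and ab: "a \<le> x \<and> x \<le> b"
    have xB: "x \<in> B" using intB a b ab unfolding is_interval_1 by blast
    have "k x \<noteq> F x"
    proof
      assume eq: "k x = F x"
      then have "x \<notin> core k" using F by (auto simp: core_def)
      then consider "right_of (core k) x" | "left_of (core k) x" using outside by blast
      then show False
      proof cases
        case 1
        then have "right_of (core k) b" using ab unfolding right_of_def by (meson less_le_trans)
        then show False using boundary_type(1)[OF k F xB _ eq 1] b by blast
      next
        case 2
        then have "left_of (core k) a" using ab unfolding left_of_def by (meson le_less_trans)
        then show False using boundary_type(2)[OF k F xB _ eq 2] a by blast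
      qed
    qed
    with xB show "x \<in> {x\<in>B. k x \<noteq> F x}" by blast
  qed
  have "{x\<in>B. k x < g x} = {x\<in>B. k x \<noteq> g x}" "{x\<in>B. f x < k x} = {x\<in>B. k x \<noteq> f x}"
    using K(2,3) by (auto simp: less_le)
  then have "is_interval (fst ` strip B k g)" "is_interval (fst ` strip B f k)"
    unfolding proj using conv[of f] conv[of g] by simp_all
  then have conn: "connected (strip B k g)" "connected (strip B f k)"
    using connected_by_fibres[OF op(1) strip_fibre] connected_by_fibres[OF op(2) strip_fibre] by blast+
  have comp: "components (strip B f g - L) = {strip B k g, strip B f k}"
    by (rule components_two[OF split op(1) conn(1) ne(1) op(2) conn(2) ne(2) dis])
  have "side_at z (perp \<xi> z) (strip B k g) (strip B f k)" if z: "z \<in> L" for z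
  proof -
    obtain x y where zxy: "z = (x, y)" by (cases z)
    have x: "x \<in> core k" "k x = ereal y" using z K(8) unfolding zxy by blast+
    have zC: "(x, y) \<in> strip B f g" using z Liff unfolding zxy by blast
    \<comment> \<open>The height of the graph over the point, hence positive below the leaf. Its
      gradient, the slope in the first and \<open>- 1\<close> in the second coordinate, is
      \<open>perp \<xi> z\<close> divided by the first component of the field, which explains
      \<open>c\<close>.\<close>
    define H where "H p = real_of_ereal (k (fst p)) - snd p" for p :: plane
    define c where "c = 1 / fst (\<xi> (x, y))"
    have a1pos: "0 < fst (\<xi> (x, y))" using a1[OF zC] .
    then have c: "c > 0" by (simp add: c_def)
    let ?O = "strip B f g \<inter> (core k \<times> UNIV)"
    have "open ?O" using open_C K(4) by (intro open_Int open_Times) auto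
    moreover have "z \<in> ?O" using zC x(1) by (simp add: zxy)
    ultimately obtain e where e: "e > 0" "ball z e \<subseteq> ?O" unfolding open_contains_ball by blast
    have "((\<lambda>x. real_of_ereal (k x)) has_real_derivative slope x y) (at (fst z))"
      using K(9)[OF x(1)] x(2) by (simp add: zxy)
    then have "((\<lambda>x. real_of_ereal (k x)) has_derivative (\<lambda>h. h * slope x y)) (at (fst z))"
      by (simp add: has_field_derivative_def mult_commute_abs)
    from has_derivative_compose[OF has_derivative_fst[OF has_derivative_ident] this]
    have "((\<lambda>p. real_of_ereal (k (fst p))) has_derivative (\<lambda>v. fst v * slope x y)) (at z)" .
    then have "(H has_derivative (\<lambda>v. fst v * slope x y - snd v)) (at z)"
      unfolding H_def by (intro has_derivative_diff has_derivative_snd has_derivative_ident)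
    moreover have "fst v * slope x y - snd v = c * (perp \<xi> z \<bullet> v)" for v
      using a1pos by (simp add: zxy perp_def inner_prod_def slope_def c_def field_simps)
    ultimately have der: "(H has_derivative (\<lambda>v. c * (perp \<xi> z \<bullet> v))) (at z)" by simp
    have near: "p \<in> strip B f g \<and> k (fst p) = ereal (H p + snd p)" if "p \<in> ball z e" for p
    proof -
      have "p \<in> ?O" using that e(2) by blast
      then have "p \<in> strip B f g" "fst p \<in> core k" by (auto simp: mem_Times_iff)
      then show ?thesis using K(10)[of "fst p"] by (simp add: H_def)
    qed
    show ?thesis
    proof (rule side_atI[OF e(1) c _ der])
      show "H z = 0" using x(2) by (simp add: H_def zxy)
      show "p \<in> strip B f k" if "p \<in> ball z e" "0 < H p" for p
        using near[OF that(1)] that(2) by (cases p) simp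
      show "p \<in> strip B k g" if "p \<in> ball z e" "H p < 0" for p
        using near[OF that(1)] that(2) by (cases p) simp
    qed
  qed
  moreover have "strip B k g \<noteq> strip B f k" using dis ne by blast
  moreover have "open (strip B f g - L)" unfolding split by (rule open_Un[OF op])
  ultimately show ?thesis unfolding two_sided_def using comp by (intro conjI ballI)
qed

text \<open>By \<open>no_crossing\<close> the extended functions are totally ordered by pointwise
  comparison. Over the domain of either leaf the inequality is strict, because equality would be a
  common point of two disjoint leaves; so comparison amounts to lying in the lower or upper
  part.\<close>

lemma ordered_sides_if_no_lens:
  assumes nf: "no_lens f" and ng: "no_lens g"
  shows "\<exists>U1 U2. ordered_sides \<xi> (strip B f g) U1 U2"
proof -
  let ?S = "leaves \<xi> (strip B f g)"
  obtain k where k: "\<And>L. L \<in> ?S \<Longrightarrow> leaf_fun L (k L)" using leaf_fun_exists by metis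
  define U1 where "U1 L = strip B (k L) g" for L
  define U2 where "U2 L = strip B f (k L)" for L
  define le where "le L M \<longleftrightarrow> (\<forall>x\<in>B. k L x \<le> k M x)" for L M
  have disj: "L \<inter> M = {}" if "L \<in> ?S" "M \<in> ?S" "L \<noteq> M" for L M
    by (rule leaves_disjoint[OF lip that])
  have tot: "le L M \<or> le M L" if "L \<in> ?S" "M \<in> ?S" "L \<noteq> M" for L M
    unfolding le_def by (rule no_crossing[OF nf ng k[OF that(1)] k[OF that(2)] disj[OF that]])
  have trans: "le L N" if "le L M" "le M N" for L M N using that unfolding le_def by (meson order_trans)
  have sub2: "L \<subseteq> U2 M" and sub1: "M \<subseteq> U1 L" if "L \<in> ?S" "M \<in> ?S" "L \<noteq> M" "le L M" for L M
  proof -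
    note KL = leaf_fun_facts[OF k[OF that(1)]] and KM = leaf_fun_facts[OF k[OF that(2)]]
    have strict: "k L x \<noteq> k M x" if "x \<in> core (k L) \<or> x \<in> core (k M)" "x \<in> B" for x
    proof
      assume eq: "k L x = k M x"
      then have "x \<in> core (k L)" "x \<in> core (k M)" using that by (auto simp: core_def)
      then have "(x, real_of_ereal (k L x)) \<in> L" "(x, real_of_ereal (k L x)) \<in> M"
        using KL(8,10) KM(8,10) eq by metis+
      then show False using disj \<open>L \<in> ?S\<close> \<open>M \<in> ?S\<close> \<open>L \<noteq> M\<close> by blast
    qed
    show "L \<subseteq> U2 M"
    proof
      fix z assume zL: "z \<in> L"
      obtain x y where z: "z = (x, y)" by (cases z)
      have x: "x \<in> core (k L)" "k L x = ereal y" using zL KL(8) unfolding z by blast+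
      then have xB: "x \<in> B" "f x < k L x" by (simp_all add: core_def)
      have "k L x < k M x" using strict x(1) xB(1) \<open>le L M\<close> unfolding le_def by (metis le_less)
      then show "z \<in> U2 M" using xB x(2) by (simp add: z U2_def)
    qed
    show "M \<subseteq> U1 L"
    proof
      fix z assume zM: "z \<in> M"
      obtain x y where z: "z = (x, y)" by (cases z)
      have x: "x \<in> core (k M)" "k M x = ereal y" using zM KM(8) unfolding z by blast+
      then have xB: "x \<in> B" "k M x < g x" by (simp_all add: core_def)
      have "k L x < k M x" using strict x(1) xB(1) \<open>le L M\<close> unfolding le_def by (metis le_less)
      then show "z \<in> U1 L" using xB x(2) by (simp add: z U1_def)
    qed
  qed
  have two: "two_sided \<xi> (strip B f g) L (U1 L) (U2 L)" if "L \<in> ?S" for L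
    unfolding U1_def U2_def by (rule leaf_two_sided[OF that k[OF that]])
  have U12: "U1 L \<inter> U2 L = {}" for L unfolding U1_def U2_def by (auto simp: strip_def)
  have irr: "\<not> L \<subseteq> U1 L" "\<not> L \<subseteq> U2 L" if "L \<in> ?S" for L
  proof -
    have "U1 L \<in> components (strip B f g - L)" "U2 L \<in> components (strip B f g - L)"
      using two[OF that] by (simp_all add: two_sided_def)
    then have "U1 L \<inter> L = {}" "U2 L \<inter> L = {}" using in_components_subset by blast+
    then show "\<not> L \<subseteq> U1 L" "\<not> L \<subseteq> U2 L" using leaf_nonempty_connected(1)[OF that] by blast+
  qed
  have iff2: "L \<subseteq> U2 M \<longleftrightarrow> L \<noteq> M \<and> le L M" if LM: "L \<in> ?S" "M \<in> ?S" for L M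
  proof (cases "L = M")
    case True
    then show ?thesis using irr LM by blast
  next
    case False
    have "le L M" if "L \<subseteq> U2 M"
    proof (rule ccontr)
      assume "\<not> le L M"
      then have "le M L" using tot LM False by blast
      then have "L \<subseteq> U1 M" using sub1[OF LM(2,1)] False by blast
      then show False using that U12 leaf_nonempty_connected(1)[OF LM(1)] by blast
    qed
    then show ?thesis using sub2[OF LM False] False by blast
  qed
  have iff1: "L \<subseteq> U1 M \<longleftrightarrow> L \<noteq> M \<and> le M L" if LM: "L \<in> ?S" "M \<in> ?S" for L M
  proof (cases "L = M")
    case True
    then show ?thesis using irr LM by blast
  next
    case False
    have "le M L" if "L \<subseteq> U1 M"
    proof (rule ccontr)
      assume "\<not> le M L"
      then have "le L M" using tot LM False by blast
      then have "L \<subseteq> U2 M" using sub2[OF LM] False by blast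
      then show False using that U12 leaf_nonempty_connected(1)[OF LM(1)] by blast
    qed
    then show ?thesis using sub1[OF LM(2,1)] False by blast
  qed
  \<comment> \<open>Distinct leaves comparable both ways would place \<open>L\<close> in both of the
    disjoint sides of \<open>M\<close>.\<close>
  have anti: "L = M" if "L \<in> ?S" "M \<in> ?S" "le L M" "le M L" for L M
    using sub1[OF that(1,2)] sub2[OF that(1,2)] iff1[OF that(1,2)] iff2[OF that(1,2)] that
      U12[of M] leaf_nonempty_connected(1)[OF that(1)] by blast
  have eq1: "{(L, M). L \<in> ?S \<and> M \<in> ?S \<and> L \<subseteq> U1 M} = {(L, M). L \<in> ?S \<and> M \<in> ?S \<and> L \<noteq> M \<and> le M L}"
    using iff1 by blast
  have eq2: "{(L, M). L \<in> ?S \<and> M \<in> ?S \<and> L \<subseteq> U2 M} = {(L, M). L \<in> ?S \<and> M \<in> ?S \<and> L \<noteq> M \<and> le L M}"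
    using iff2 by blast
  have so: "strict_linear_order_on ?S {(L, M). L \<in> ?S \<and> M \<in> ?S \<and> L \<noteq> M \<and> R L M}"
    if R: "\<And>L M N. R L M \<Longrightarrow> R M N \<Longrightarrow> R L N" "\<And>L M. L \<in> ?S \<Longrightarrow> M \<in> ?S \<Longrightarrow> R L M \<Longrightarrow> R M L \<Longrightarrow> L = M"
      "\<And>L M. L \<in> ?S \<Longrightarrow> M \<in> ?S \<Longrightarrow> L \<noteq> M \<Longrightarrow> R L M \<or> R M L" for R
    unfolding strict_linear_order_on_def
  proof (intro conjI)
    show "trans {(L, M). L \<in> ?S \<and> M \<in> ?S \<and> L \<noteq> M \<and> R L M}"
      by (rule transI) (use R(1,2) in blast)
    show "irrefl {(L, M). L \<in> ?S \<and> M \<in> ?S \<and> L \<noteq> M \<and> R L M}" by (rule irreflI) blast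
    show "total_on ?S {(L, M). L \<in> ?S \<and> M \<in> ?S \<and> L \<noteq> M \<and> R L M}"
      by (rule total_onI) (use R(3) in blast)
  qed
  have "ordered_sides \<xi> (strip B f g) U1 U2" unfolding ordered_sides_def eq1 eq2
  proof (intro conjI ballI two)
    show "strict_linear_order_on ?S {(L, M). L \<in> ?S \<and> M \<in> ?S \<and> L \<noteq> M \<and> le M L}"
      by (rule so[of "\<lambda>L M. le M L"]) (use trans anti tot in blast)+
    show "strict_linear_order_on ?S {(L, M). L \<in> ?S \<and> M \<in> ?S \<and> L \<noteq> M \<and> le L M}"
      by (rule so[of le]) (use trans anti tot in blast)+
  qed
  then show ?thesis by blast
qed

section \<open>Boundary functions met by leaves only on one side\<close>

text \<open>\<open>w\<close> measures how far a leaf is from \<open>F\<close>: it is positive, tends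
  to zero where the leaf reaches \<open>F\<close>, and the sign \<open>\<tau>\<close> of its
  derivative is the same for all leaves and all points \<open>\<beta>\<close>. For a finite boundary
  \<open>w\<close> is the vertical distance, and the sign comes from \<open>boundary_sign\<close>.
  For an infinite one it is \<open>exp (s * h)\<close>, and the sign comes from the second component
  of the field.\<close>

lemma boundary_function:
  assumes bs: "boundary_sign \<xi> B s F" and sF: "s = 1 \<and> F = f \<or> s = - 1 \<and> F = g"
    and a2: "(\<forall>z\<in>strip B f g. 0 \<le> snd (\<xi> z)) \<or> (\<forall>z\<in>strip B f g. snd (\<xi> z) \<le> 0)"
  obtains \<tau> :: real where "\<tau> = 1 \<or> \<tau> = - 1"
    "\<And>L k \<beta>. leaf_fun L k \<Longrightarrow> \<beta> \<in> B \<Longrightarrow> \<beta> \<notin> core k \<Longrightarrow> k \<beta> = F \<beta> \<Longrightarrow>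
      \<exists>w w' \<delta>. \<delta> > 0 \<and> (\<forall>x\<in>core k. \<bar>x - \<beta>\<bar> < \<delta> \<longrightarrow>
        0 < w x \<and> (w has_real_derivative w' x) (at x) \<and> 0 \<le> \<tau> * w' x) \<and> (w \<longlongrightarrow> 0) (at \<beta> within core k)"
proof (cases "\<forall>x\<in>B. F x = ereal (- s) * \<infinity>")
  case True
  have s: "s = 1 \<or> s = - 1" using sF by blast
  \<comment> \<open>The weak sign of the second component, and therefore of the slope of every
    leaf.\<close>
  obtain \<rho> :: real where \<rho>: "\<rho> = 1 \<or> \<rho> = - 1" "\<And>z. z \<in> strip B f g \<Longrightarrow> 0 \<le> \<rho> * snd (\<xi> z)"
  proof -
    from a2 show thesis
    proof
      assume "\<forall>z\<in>strip B f g. 0 \<le> snd (\<xi> z)"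
      then show thesis using that[of 1] by simp
    next
      assume "\<forall>z\<in>strip B f g. snd (\<xi> z) \<le> 0"
      then show thesis using that[of "-1"] by simp
    qed
  qed
  show thesis
  proof (rule that[of "s * \<rho>"])
    show "s * \<rho> = 1 \<or> s * \<rho> = - 1" using s \<rho>(1) by auto
    fix L k \<beta> assume k: "leaf_fun L k" and \<beta>: "\<beta> \<in> B" "\<beta> \<notin> core k" "k \<beta> = F \<beta>"
    note K = leaf_fun_facts[OF k]
    define h where "h x = real_of_ereal (k x)" for x
    define w where "w x = exp (s * h x)" for x
    define w' where "w' x = exp (s * h x) * (s * slope x (h x))" for x
    have der: "(w has_real_derivative w' x) (at x)" if x: "x \<in> core k" for x
    proof -
      have "(h has_real_derivative slope x (h x)) (at x)" using K(9)[OF x] by (simp add: h_def[abs_def])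
      then show ?thesis unfolding w_def w'_def by (auto intro!: derivative_eq_intros)
    qed
    have sgn: "0 \<le> (s * \<rho>) * w' x" if x: "x \<in> core k" for x
    proof -
      have C: "(x, h x) \<in> strip B f g" using x K(10)[OF x] unfolding core_def by (simp add: h_def)
      have "0 \<le> \<rho> * slope x (h x)" using \<rho>(2)[OF C] a1[OF C] by (simp add: slope_def)
      then have "0 \<le> exp (s * h x) * (\<rho> * slope x (h x))" by simp
      moreover have "(s * \<rho>) * w' x = (s * s) * (exp (s * h x) * (\<rho> * slope x (h x)))"
        by (simp add: w'_def)
      moreover have "s * s = 1" using s by auto
      ultimately show ?thesis by (simp only: mult_1_left)
    qed
    have "isCont k \<beta>" using K(1) openB \<beta>(1) by (simp add: continuous_on_eq_continuous_at)
    then have "(k \<longlongrightarrow> F \<beta>) (at \<beta> within core k)"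
      using \<beta>(3) unfolding isCont_def by (metis tendsto_within_subset subset_UNIV)
    moreover have "\<forall>\<^sub>F x in at \<beta> within core k. k x = ereal (h x)"
      unfolding eventually_at_filter h_def by (rule always_eventually) (use K(10) in blast)
    ultimately have lim: "((\<lambda>x. ereal (h x)) \<longlongrightarrow> F \<beta>) (at \<beta> within core k)" by (simp add: tendsto_cong)
    have "filterlim (\<lambda>x. s * h x) at_bot (at \<beta> within core k)"
    proof (cases "s = 1")
      case s1: True
      then have "F \<beta> = - \<infinity>" using True \<beta>(1) by simp
      then have "filterlim (\<lambda>x. - h x) at_top (at \<beta> within core k)"
        using tendsto_uminus_ereal[OF lim] by (simp add: tendsto_PInfty_eq_at_top)
      then show ?thesis using s1 by (simp add: filterlim_uminus_at_top)
    next
      case False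
      then have s1: "s = - 1" using s by blast
      then have "F \<beta> = \<infinity>" using True \<beta>(1) by simp
      then have "filterlim h at_top (at \<beta> within core k)" using lim by (simp add: tendsto_PInfty_eq_at_top)
      then show ?thesis using s1 by (simp add: filterlim_uminus_at_bot)
    qed
    then have "(w \<longlongrightarrow> 0) (at \<beta> within core k)"
      unfolding w_def by (rule filterlim_compose[OF exp_at_bot])
    then show "\<exists>w w' \<delta>. \<delta> > 0 \<and> (\<forall>x\<in>core k. \<bar>x - \<beta>\<bar> < \<delta> \<longrightarrow>
        0 < w x \<and> (w has_real_derivative w' x) (at x) \<and> 0 \<le> (s * \<rho>) * w' x) \<and> (w \<longlongrightarrow> 0) (at \<beta> within core k)"
      using der sgn by (intro exI[of _ w] exI[of _ w'] exI[of _ 1]) (simp add: w_def)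
  qed
next
  case False
  have s: "s = 1 \<or> s = - 1" using sF by blast
  then have ss: "s * s = 1" by auto
  obtain \<phi> \<phi>' \<sigma> where \<sigma>: "\<sigma> = 1 \<or> \<sigma> = - 1" and
    F: "\<And>x. x \<in> B \<Longrightarrow> F x = ereal (\<phi> x)" "\<And>x. x \<in> B \<Longrightarrow> (\<phi> has_real_derivative \<phi>' x) (at x)"
    and D: "\<And>x. x \<in> B \<Longrightarrow> \<exists>e>0. \<exists>d>0. \<forall>x' u. \<bar>x' - x\<bar> < d \<and> 0 < u \<and> u < e \<longrightarrow>
        0 \<le> \<sigma> * (snd (\<xi> (x', \<phi> x' + s * u)) - \<phi>' x' * fst (\<xi> (x', \<phi> x' + s * u)))"
    using bs False unfolding boundary_sign_def by blast
  show thesis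
  proof (rule that[of "s * \<sigma>"])
    show "s * \<sigma> = 1 \<or> s * \<sigma> = - 1" using s \<sigma>(1) by auto
    fix L k \<beta> assume k: "leaf_fun L k" and \<beta>: "\<beta> \<in> B" "\<beta> \<notin> core k" "k \<beta> = F \<beta>"
    note K = leaf_fun_facts[OF k]
    define h where "h x = real_of_ereal (k x)" for x
    define w where "w x = s * (h x - \<phi> x)" for x
    define w' where "w' x = s * (slope x (h x) - \<phi>' x)" for x
    have der: "(w has_real_derivative w' x) (at x)" if x: "x \<in> core k" for x
    proof -
      have "(h has_real_derivative slope x (h x)) (at x)" using K(9)[OF x] by (simp add: h_def[abs_def])
      moreover have "(\<phi> has_real_derivative \<phi>' x) (at x)" using F(2) K(7) x by blast
      ultimately show ?thesis unfolding w_def w'_def by (auto intro!: derivative_eq_intros)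
    qed
    have pos: "0 < w x" if x: "x \<in> core k" for x
    proof -
      have "x \<in> B" "f x < ereal (h x)" "ereal (h x) < g x"
        using x K(10)[OF x] unfolding core_def by (auto simp: h_def)
      then show ?thesis using sF F(1)[of x] by (auto simp: w_def)
    qed
    have "isCont k \<beta>" using K(1) openB \<beta>(1) by (simp add: continuous_on_eq_continuous_at)
    then have "(k \<longlongrightarrow> F \<beta>) (at \<beta> within core k)"
      using \<beta>(3) unfolding isCont_def by (metis tendsto_within_subset subset_UNIV)
    moreover have "\<forall>\<^sub>F x in at \<beta> within core k. k x = ereal (h x)"
      unfolding eventually_at_filter h_def by (rule always_eventually) (use K(10) in blast)
    ultimately have "((\<lambda>x. ereal (h x)) \<longlongrightarrow> ereal (\<phi> \<beta>)) (at \<beta> within core k)"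
      using F(1)[OF \<beta>(1)] by (simp add: tendsto_cong)
    then have "(h \<longlongrightarrow> \<phi> \<beta>) (at \<beta> within core k)" by simp
    moreover have "(\<phi> \<longlongrightarrow> \<phi> \<beta>) (at \<beta> within core k)"
      using DERIV_isCont[OF F(2)[OF \<beta>(1)]] unfolding isCont_def by (metis tendsto_within_subset subset_UNIV)
    ultimately have "((\<lambda>x. s * (h x - \<phi> x)) \<longlongrightarrow> s * (\<phi> \<beta> - \<phi> \<beta>)) (at \<beta> within core k)"
      by (intro tendsto_intros)
    then have lim: "(w \<longlongrightarrow> 0) (at \<beta> within core k)" unfolding w_def by simp
    \<comment> \<open>Both bounds of \<open>boundary_sign\<close> have to be met at once:
      \<open>d\<close> by the abscissa, and \<open>e\<close> by the distance from the boundary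
      graph, which is small near \<open>\<beta>\<close> because \<open>w\<close> tends to
      zero.\<close>
    obtain e d where ed: "e > 0" "d > 0" "\<And>x' u. \<bar>x' - \<beta>\<bar> < d \<Longrightarrow> 0 < u \<Longrightarrow> u < e \<Longrightarrow>
        0 \<le> \<sigma> * (snd (\<xi> (x', \<phi> x' + s * u)) - \<phi>' x' * fst (\<xi> (x', \<phi> x' + s * u)))"
      using D[OF \<beta>(1)] by blast
    have "\<forall>\<^sub>F x in at \<beta> within core k. w x < e" by (rule order_tendstoD(2)[OF lim ed(1)])
    then obtain d' where d': "d' > 0" "\<And>x. x \<in> core k \<Longrightarrow> x \<noteq> \<beta> \<Longrightarrow> dist x \<beta> < d' \<Longrightarrow> w x < e"
      unfolding eventually_at by blast
    have sgn: "0 \<le> (s * \<sigma>) * w' x" if x: "x \<in> core k" "\<bar>x - \<beta>\<bar> < min d d'" for x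
    proof -
      have C: "(x, h x) \<in> strip B f g" using x K(10)[OF x(1)] unfolding core_def by (simp add: h_def)
      have "x \<noteq> \<beta>" using x(1) \<beta>(2) by blast
      then have we: "w x < e" using d'(2)[OF x(1)] x(2) by (simp add: dist_real_def)
      have "s * w x = (s * s) * (h x - \<phi> x)" by (simp add: w_def)
      then have h: "\<phi> x + s * w x = h x" using ss by simp
      have "0 \<le> \<sigma> * (snd (\<xi> (x, h x)) - \<phi>' x * fst (\<xi> (x, h x)))"
        using ed(3)[of x "w x", OF _ pos[OF x(1)] we] x(2) unfolding h by simp
      then have "0 \<le> \<sigma> * (snd (\<xi> (x, h x)) - \<phi>' x * fst (\<xi> (x, h x))) / fst (\<xi> (x, h x))"
        using a1[OF C] by simp
      also have "\<dots> = \<sigma> * (slope x (h x) - \<phi>' x)"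
        using a1[OF C] by (simp add: slope_def field_simps)
      also have "\<dots> = (s * \<sigma>) * w' x" using ss by (simp add: w'_def)
      finally show ?thesis .
    qed
    show "\<exists>w w' \<delta>. \<delta> > 0 \<and> (\<forall>x\<in>core k. \<bar>x - \<beta>\<bar> < \<delta> \<longrightarrow>
        0 < w x \<and> (w has_real_derivative w' x) (at x) \<and> 0 \<le> (s * \<sigma>) * w' x) \<and> (w \<longlongrightarrow> 0) (at \<beta> within core k)"
      by (rule exI[of _ w], rule exI[of _ w'], rule exI[of _ "min d d'"], intro conjI ballI impI)
        (simp add: ed(2) d'(1), (rule pos der sgn lim; assumption?)+)
  qed
qed

text \<open>If \<open>\<tau> = 1\<close>, the distance from \<open>F\<close> does not decrease to
  the right, so no leaf runs into \<open>F\<close> at its right end; if \<open>\<tau> = - 1\<close>,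
  no leaf comes out of \<open>F\<close> at its left end. Either way one half of the forbidden
  configuration is missing.\<close>

lemma no_lens_boundary:
  assumes bs: "boundary_sign \<xi> B s F" and sF: "s = 1 \<and> F = f \<or> s = - 1 \<and> F = g"
    and a2: "(\<forall>z\<in>strip B f g. 0 \<le> snd (\<xi> z)) \<or> (\<forall>z\<in>strip B f g. snd (\<xi> z) \<le> 0)"
  shows "no_lens F"
  unfolding no_lens_def
proof (intro allI impI)
  fix L M k m x x'
  assume k: "leaf_fun L k" and m: "leaf_fun M m" and x: "x \<in> B" "right_of (core k) x" "k x = F x"
    and x': "x' \<in> B" "left_of (core m) x'" "m x' = F x'"
  note K = leaf_fun_facts[OF k] and M = leaf_fun_facts[OF m]
  have F: "F = f \<or> F = g" using sF by blast
  obtain \<tau> :: real where \<tau>: "\<tau> = 1 \<or> \<tau> = - 1"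
    "\<And>L k \<beta>. leaf_fun L k \<Longrightarrow> \<beta> \<in> B \<Longrightarrow> \<beta> \<notin> core k \<Longrightarrow> k \<beta> = F \<beta> \<Longrightarrow>
      \<exists>w w' \<delta>. \<delta> > 0 \<and> (\<forall>x\<in>core k. \<bar>x - \<beta>\<bar> < \<delta> \<longrightarrow>
        0 < w x \<and> (w has_real_derivative w' x) (at x) \<and> 0 \<le> \<tau> * w' x) \<and> (w \<longlongrightarrow> 0) (at \<beta> within core k)"
    by (rule boundary_function[OF bs sF a2]) (rule that)
  from \<tau>(1) show False
  proof
    assume t: "\<tau> = 1"
    \<comment> \<open>\<open>x\<close> may lie beyond the end of the leaf. The limit is taken at the
      end itself, where \<open>boundary_type\<close> yields the same boundary function.\<close>
    define \<beta> where "\<beta> = Sup (core k)"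
    have bdd: "bdd_above (core k)" using x(2) unfolding right_of_def bdd_above_def by (meson less_imp_le)
    have cl: "\<beta> \<in> closure (core k)" unfolding \<beta>_def by (rule closure_contains_Sup[OF K(6) bdd])
    have up: "u \<le> \<beta>" if "u \<in> core k" for u unfolding \<beta>_def by (rule cSup_upper[OF that bdd])
    have "\<beta> \<le> x" unfolding \<beta>_def by (rule cSup_least[OF K(6)]) (use x(2) in \<open>auto simp: right_of_def less_imp_le\<close>)
    have nc: "\<beta> \<notin> core k"
    proof
      assume "\<beta> \<in> core k"
      then obtain e where e: "e > 0" "ball \<beta> e \<subseteq> core k" using K(4) unfolding open_contains_ball by blast
      have "\<beta> + e/2 \<in> ball \<beta> e" using e(1) by (simp add: dist_real_def)
      then have "\<beta> + e/2 \<le> \<beta>" using e(2) up by blast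
      then show False using e(1) by simp
    qed
    have ro: "right_of (core k) \<beta>" unfolding right_of_def using up nc by (metis le_less)
    obtain u where "u \<in> core k" using K(6) by blast
    then have "\<beta> \<in> B" using intB x(1) K(7) up \<open>\<beta> \<le> x\<close> unfolding is_interval_1 by blast
    moreover from this have "k \<beta> = F \<beta>" using boundary_type(1)[OF k F x(1) _ x(3) x(2) ro] by blast
    ultimately obtain w w' \<delta> where w: "\<delta> > 0" "\<And>x. x \<in> core k \<Longrightarrow> \<bar>x - \<beta>\<bar> < \<delta> \<Longrightarrow>
        0 < w x \<and> (w has_real_derivative w' x) (at x) \<and> 0 \<le> \<tau> * w' x" "(w \<longlongrightarrow> 0) (at \<beta> within core k)"
      using \<tau>(2)[OF k _ nc] by blast
    show False by (rule no_positive_limit_right[OF K(5) cl ro w(1) _ w(3), of w']) (use w(2) t in simp)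
  next
    assume t: "\<tau> = - 1"
    define \<beta> where "\<beta> = Inf (core m)"
    have bdd: "bdd_below (core m)" using x'(2) unfolding left_of_def bdd_below_def by (meson less_imp_le)
    have cl: "\<beta> \<in> closure (core m)" unfolding \<beta>_def by (rule closure_contains_Inf[OF M(6) bdd])
    have up: "\<beta> \<le> u" if "u \<in> core m" for u unfolding \<beta>_def by (rule cInf_lower[OF that bdd])
    have "x' \<le> \<beta>" unfolding \<beta>_def by (rule cInf_greatest[OF M(6)]) (use x'(2) in \<open>auto simp: left_of_def less_imp_le\<close>)
    have nc: "\<beta> \<notin> core m"
    proof
      assume "\<beta> \<in> core m"
      then obtain e where e: "e > 0" "ball \<beta> e \<subseteq> core m" using M(4) unfolding open_contains_ball by blast
      have "\<beta> - e/2 \<in> ball \<beta> e" using e(1) by (simp add: dist_real_def)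
      then have "\<beta> \<le> \<beta> - e/2" using e(2) up by blast
      then show False using e(1) by simp
    qed
    have lo: "left_of (core m) \<beta>" unfolding left_of_def using up nc by (metis le_less)
    obtain u where "u \<in> core m" using M(6) by blast
    then have "\<beta> \<in> B" using intB x'(1) M(7) up \<open>x' \<le> \<beta>\<close> unfolding is_interval_1 by blast
    moreover from this have "m \<beta> = F \<beta>" using boundary_type(2)[OF m F x'(1) _ x'(3) x'(2) lo] by blast
    ultimately obtain w w' \<delta> where w: "\<delta> > 0" "\<And>x. x \<in> core m \<Longrightarrow> \<bar>x - \<beta>\<bar> < \<delta> \<Longrightarrow>
        0 < w x \<and> (w has_real_derivative w' x) (at x) \<and> 0 \<le> \<tau> * w' x" "(w \<longlongrightarrow> 0) (at \<beta> within core m)"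
      using \<tau>(2)[OF m _ nc] by blast
    show False by (rule no_positive_limit_left[OF M(5) cl lo w(1) _ w(3), of w']) (use w(2) t in simp)
  qed
qed

end

section \<open>Strips on which both components have constant sign\<close>

lemma strip_leaves_aux:
  assumes lip: "locally_lipschitz \<xi>" and B: "open B" "is_interval B" and f: "continuous_on B f"
    and g: "continuous_on B g" and fg: "\<And>x. x \<in> B \<Longrightarrow> f x < g x"
    and a1: "(\<forall>z\<in>strip B f g. 0 < fst (\<xi> z)) \<or> (\<forall>z\<in>strip B f g. fst (\<xi> z) = 0 \<and> 0 < snd (\<xi> z))"
    and a2: "(\<forall>z\<in>strip B f g. 0 \<le> snd (\<xi> z)) \<or> (\<forall>z\<in>strip B f g. snd (\<xi> z) \<le> 0)"
    and bf: "boundary_sign \<xi> B 1 f" and bg: "boundary_sign \<xi> B (- 1) g"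
  shows "\<exists>U1 U2. ordered_sides \<xi> (strip B f g) U1 U2"
  using a1
proof
  assume "\<forall>z\<in>strip B f g. 0 < fst (\<xi> z)"
  then interpret graph_strip \<xi> B f g by unfold_locales (use lip B f g fg in blast)+
  show ?thesis by (rule ordered_sides_if_no_lens) (use no_lens_boundary[OF bf _ a2] no_lens_boundary[OF bg _ a2] in blast)+
next
  assume "\<forall>z\<in>strip B f g. fst (\<xi> z) = 0 \<and> 0 < snd (\<xi> z)"
  then show ?thesis using vertical_ordered_sides[OF lip B f g fg] by blast
qed

text \<open>Passing to the reversed field if necessary leaves two cases: a positive first component,
  or a vertical field pointing upwards. Reversal keeps the leaves and exchanges the sides, which
  \<open>ordered_sides\<close> permits.\<close>

proposition strip_leaves:
  assumes lip: "locally_lipschitz \<xi>" and B: "open B" "is_interval B" and f: "continuous_on B f"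
    and g: "continuous_on B g" and fg: "\<And>x. x \<in> B \<Longrightarrow> f x < g x"
    and reg: "strip B f g \<inter> sing \<xi> = {}"
    and a1: "(\<forall>z\<in>strip B f g. 0 < fst (\<xi> z)) \<or> (\<forall>z\<in>strip B f g. fst (\<xi> z) < 0) \<or> (\<forall>z\<in>strip B f g. fst (\<xi> z) = 0)"
    and a2: "(\<forall>z\<in>strip B f g. 0 < snd (\<xi> z)) \<or> (\<forall>z\<in>strip B f g. snd (\<xi> z) < 0) \<or> (\<forall>z\<in>strip B f g. snd (\<xi> z) = 0)"
    and bf: "boundary_sign \<xi> B 1 f" and bg: "boundary_sign \<xi> B (- 1) g"
  shows "(\<forall>L\<in>leaves \<xi> (strip B f g). rolle_leaf \<xi> (strip B f g) L) \<and>
    strict_linear_order_on (leaves \<xi> (strip B f g)) (leaf_less \<xi> (strip B f g))"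
proof -
  let ?C = "strip B f g" and ?\<eta> = "\<lambda>z. - \<xi> z"
  have "\<exists>U1 U2. ordered_sides \<xi> ?C U1 U2"
  proof (cases "(\<forall>z\<in>?C. 0 < fst (\<xi> z)) \<or> (\<forall>z\<in>?C. fst (\<xi> z) = 0 \<and> 0 < snd (\<xi> z))")
    case True
    show ?thesis by (rule strip_leaves_aux[OF lip B f g fg True _ bf bg]) (use a2 in \<open>auto simp: less_imp_le\<close>)
  next
    case False
    have nz: "fst (\<xi> z) \<noteq> 0 \<or> snd (\<xi> z) \<noteq> 0" if "z \<in> ?C" for z using reg that by (auto simp: sing_def)
    have "(\<forall>z\<in>?C. 0 < fst (?\<eta> z)) \<or> (\<forall>z\<in>?C. fst (?\<eta> z) = 0 \<and> 0 < snd (?\<eta> z))"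
    proof -
      from a1 False consider "\<forall>z\<in>?C. fst (\<xi> z) < 0" | "\<forall>z\<in>?C. fst (\<xi> z) = 0" by blast
      then show ?thesis
      proof cases
        case 2
        have "\<not> (\<forall>z\<in>?C. 0 < snd (\<xi> z))" using False 2 by blast
        then have "\<forall>z\<in>?C. snd (\<xi> z) < 0" using a2 2 nz by blast
        then show ?thesis using 2 by simp
      qed simp
    qed
    moreover have "(\<forall>z\<in>?C. 0 \<le> snd (?\<eta> z)) \<or> (\<forall>z\<in>?C. snd (?\<eta> z) \<le> 0)"
      using a2 by (auto simp: less_imp_le)
    ultimately have "\<exists>U1 U2. ordered_sides ?\<eta> ?C U1 U2"
      by (intro strip_leaves_aux[OF locally_lipschitz_uminus[OF lip] B f g fg] boundary_sign_uminus bf bg)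
    then show ?thesis using ordered_sides_uminus by blast
  qed
  then obtain U1 U2 where U: "ordered_sides \<xi> ?C U1 U2" by blast
  have "rolle_leaf \<xi> ?C L" if "L \<in> leaves \<xi> ?C" for L
    using two_sided_rolle[OF lip _ that] U that unfolding ordered_sides_def by blast
  then show ?thesis using ordered_sides_leaf_less[OF U reg] by blast
qed

section \<open>Adapted cell decompositions\<close>

text \<open>Gap \<open>k\<close> is the \<open>k\<close>-th interval complementary to
  \<open>A\<close>, counted from \<open>0\<close>: it lies above the element of rank
  \<open>k - 1\<close> and below the one of rank \<open>k\<close>. There is one gap more than there
  are elements, so \<open>k = card A\<close> is the topmost gap.\<close>

definition gap_lower :: "real set \<Rightarrow> nat \<Rightarrow> ereal"
  where "gap_lower A k = (if k = 0 then - \<infinity> else ereal (nth_smallest A (k - 1)))"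

definition gap_upper :: "real set \<Rightarrow> nat \<Rightarrow> ereal"
  where "gap_upper A k = (if k = card A then \<infinity> else ereal (nth_smallest A k))"

lemma gap_iff:
  assumes A: "finite A" and k: "k \<le> card A"
  shows "y \<notin> A \<and> num_below A y = k \<longleftrightarrow> gap_lower A k < ereal y \<and> ereal y < gap_upper A k"
proof
  assume y: "y \<notin> A \<and> num_below A y = k"
  have "gap_lower A k < ereal y"
  proof (cases "k = 0")
    case False
    then have z: "num_below A (nth_smallest A (k - 1)) = k - 1" using nth_smallest(2)[OF A] k by simp
    have "\<not> y \<le> nth_smallest A (k - 1)"
    proof
      assume "y \<le> nth_smallest A (k - 1)"
      from num_below_mono[OF A this] show False using y z False by simp
    qed
    then show ?thesis using False by (simp add: gap_lower_def)
  qed (simp add: gap_lower_def)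
  moreover have "ereal y < gap_upper A k"
  proof (cases "k = card A")
    case False
    then have z: "nth_smallest A k \<in> A" "num_below A (nth_smallest A k) = k" using nth_smallest[OF A] k by simp_all
    have "\<not> nth_smallest A k < y" using num_below_strict_mono[OF A z(1), of y] y z(2) by auto
    moreover have "nth_smallest A k \<noteq> y" using z(1) y by blast
    ultimately show ?thesis using False by (simp add: gap_upper_def)
  qed (simp add: gap_upper_def)
  ultimately show "gap_lower A k < ereal y \<and> ereal y < gap_upper A k" ..
next
  assume y: "gap_lower A k < ereal y \<and> ereal y < gap_upper A k"
  have ge: "k \<le> num_below A y"
  proof (cases "k = 0")
    case False
    then have z: "nth_smallest A (k - 1) \<in> A" "num_below A (nth_smallest A (k - 1)) = k - 1" using nth_smallest[OF A] k by simp_all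
    have "nth_smallest A (k - 1) < y" using y False by (simp add: gap_lower_def)
    from num_below_strict_mono[OF A z(1) this] show ?thesis using z(2) by simp
  qed simp
  show "y \<notin> A \<and> num_below A y = k"
  proof (cases "k = card A")
    case True
    have "num_below A y = k" using ge num_below_le_card[OF A, of y] True by simp
    moreover have "y \<notin> A" using num_below_less_card[OF A, of y] ge True by auto
    ultimately show ?thesis by blast
  next
    case False
    then have z: "nth_smallest A k \<in> A" "num_below A (nth_smallest A k) = k" using nth_smallest[OF A] k by simp_all
    have less: "y < nth_smallest A k" using y False by (simp add: gap_upper_def)
    have "num_below A y = k" using ge num_below_mono[OF A, of y "nth_smallest A k"] less z(2) by simp
    moreover have "y \<notin> A"
    proof
      assume "y \<in> A"
      from num_below_strict_mono[OF A this less] show False using ge z(2) by simp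
    qed
    ultimately show ?thesis by blast
  qed
qed

lemma gap_less:
  assumes A: "finite A" and k: "k \<le> card A"
  shows "gap_lower A k < gap_upper A k"
proof (cases "k = 0 \<or> k = card A")
  case True
  then show ?thesis by (auto simp: gap_lower_def gap_upper_def)
next
  case False
  then have "k - 1 < card A" "k < card A" using k by auto
  then have z: "nth_smallest A (k - 1) \<in> A" "num_below A (nth_smallest A (k - 1)) = k - 1"
    "nth_smallest A k \<in> A" "num_below A (nth_smallest A k) = k" using nth_smallest[OF A] by blast+
  then have "nth_smallest A (k - 1) < nth_smallest A k" using num_below_less_iff[OF A z(1,3)] False by simp
  then show ?thesis using False by (simp add: gap_lower_def gap_upper_def)
qed

text \<open>The indices \<open>0\<close> to \<open>3\<close> stand for \<open>a1 > 0\<close>,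
  \<open>a1 < 0\<close>, \<open>a2 > 0\<close> and \<open>a2 < 0\<close>; a coefficient vanishes
  where both of its conditions fail. Negation is written as a difference to fit the rule
  \<open>def_term_diff\<close>.\<close>

definition sign_set :: "(plane \<Rightarrow> real) \<Rightarrow> (plane \<Rightarrow> real) \<Rightarrow> nat \<Rightarrow> real \<Rightarrow> real set"
  where "sign_set a1 a2 i x = {y. 0 < (if i = 0 then a1 (x, y) else if i = 1 then 0 - a1 (x, y)
    else if i = 2 then a2 (x, y) else 0 - a2 (x, y))}"

text \<open>Frontiers of the sign sets in a vertical line rather than zeros of the coefficients:
  they are finite in number even where a coefficient vanishes on a whole segment.\<close>

definition walls :: "(plane \<Rightarrow> real) \<Rightarrow> (plane \<Rightarrow> real) \<Rightarrow> real \<Rightarrow> real set"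
  where "walls a1 a2 x = (\<Union>i<4. frontier (sign_set a1 a2 i x))"

definition wall :: "(plane \<Rightarrow> real) \<Rightarrow> (plane \<Rightarrow> real) \<Rightarrow> nat \<Rightarrow> real \<Rightarrow> real"
  where "wall a1 a2 k x = nth_smallest (walls a1 a2 x) k"

section \<open>Definability of the walls\<close>

context o_minimal_real_field begin

lemma Def2_I:
  assumes "def_pred 2 (\<lambda>v. R (v 0) (v 1))" shows "{[x, y] | x y. R x y} \<in> Def 2"
proof -
  from assms obtain A where A: "A \<in> Def 2" "\<And>v. R (v 0) (v 1) \<longleftrightarrow> map v [0..<2] \<in> A"
    by (rule def_predE) (rule that)
  have iff: "R x y \<longleftrightarrow> [x, y] \<in> A" for x y
    using A(2)[of "\<lambda>i. if i = 0 then x else y"] by (simp add: numeral_2_eq_2)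
  have "xs \<in> A \<longleftrightarrow> (\<exists>x y. xs = [x, y] \<and> R x y)" for xs
  proof
    assume xs: "xs \<in> A"
    then have "length xs = Suc (Suc 0)" using arity[OF A(1)] by auto
    then obtain x y where "xs = [x, y]" by (auto simp: length_Suc_conv)
    then show "\<exists>x y. xs = [x, y] \<and> R x y" using xs iff by blast
  qed (use iff in blast)
  then have "A = {[x, y] | x y. R x y}" by blast
  then show ?thesis using A(1) by simp
qed

lemma def_fun2_plane:
  assumes "definable_on_plane Def f" shows "def_fun2 (\<lambda>x y. f (x, y))"
proof -
  have "{[x, y, f (x, y)] | x y. True} \<in> Def 3" using assms by (simp add: definable_on_plane_def)
  then show ?thesis unfolding def_fun2_def def_pred_def
    by (rule bexI[rotated]) (auto simp: numeral_3_eq_3 numeral_2_eq_2)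
qed

lemma definable_on_line_def_fun:
  assumes "def_fun \<phi>" "def_set B" shows "definable_on_line Def B \<phi>"
proof -
  have "def_pred 2 (\<lambda>v. v 0 \<in> B \<and> \<phi> (v 0) = v 1)"
    by (intro def_pred_rules def_pred_mem[OF assms(2)] def_term_app[OF assms(1)]) simp_all
  from Def2_I[OF this] have "{[x, y] | x y. x \<in> B \<and> \<phi> x = y} \<in> Def 2" .
  moreover have "{[x, y] | x y. x \<in> B \<and> \<phi> x = y} = {[x, \<phi> x] | x. x \<in> B}" by blast
  ultimately show ?thesis by (simp add: definable_on_line_def)
qed

lemma def_fun_const: "def_fun (\<lambda>_. c)"
  unfolding def_fun_def by (intro def_pred_rules) simp_all

lemma def_set_fibre: "def_family A \<Longrightarrow> def_set (A x)"
  unfolding def_set_def by (intro def_pred_mem2 def_term_const def_term_var) simp_all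

text \<open>A frontier point has points of the set and of its complement at every distance
  \<open>e\<close>, and this description is already a formula.\<close>

lemma def_family_frontier:
  assumes A: "def_family A" shows "def_family (\<lambda>x. frontier (A x))"
proof -
  have "def_family (\<lambda>x. {y. \<forall>e. 0 < e \<longrightarrow> (\<exists>u. u \<in> A x \<and> \<bar>y - u\<bar> < e) \<and> (\<exists>u. \<not> u \<in> A x \<and> \<bar>y - u\<bar> < e)})"
    unfolding def_family_def mem_Collect_eq by (intro def_pred_rules def_pred_mem2[OF A]) simp_all
  moreover have "{y. \<forall>e. 0 < e \<longrightarrow> (\<exists>u. u \<in> A x \<and> \<bar>y - u\<bar> < e) \<and> (\<exists>u. \<not> u \<in> A x \<and> \<bar>y - u\<bar> < e)}
      = frontier (A x)" for x
    by (rule set_eqI) (simp only: frontier_straddle dist_real_def mem_Collect_eq Bex_def)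
  ultimately show ?thesis by simp
qed

lemma def_family_UN_lessThan: "(\<And>i. i < (n::nat) \<Longrightarrow> def_family (A i)) \<Longrightarrow> def_family (\<lambda>x. \<Union>i<n. A i x)"
proof (induction n)
  case 0
  then show ?case unfolding def_family_def by (simp add: def_pred_const)
next
  case (Suc n)
  have "def_pred 2 (\<lambda>v. v 1 \<in> (\<Union>i<n. A i (v 0)) \<or> v 1 \<in> A n (v 0))"
    using Suc.IH Suc.prems unfolding def_family_def by (intro def_pred_disj) simp_all
  moreover have "v 1 \<in> (\<Union>i<Suc n. A i (v 0)) \<longleftrightarrow> v 1 \<in> (\<Union>i<n. A i (v 0)) \<or> v 1 \<in> A n (v 0)" for v :: "nat \<Rightarrow> real"
    by (auto simp: less_Suc_eq)
  ultimately show ?case unfolding def_family_def by simp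
qed

end

locale tame_coefficients = o_minimal_real_field +
  fixes a1 a2 :: "plane \<Rightarrow> real"
  assumes a1: "def_fun2 (\<lambda>x y. a1 (x, y))" and a2: "def_fun2 (\<lambda>x y. a2 (x, y))"
begin

abbreviation "S \<equiv> sign_set a1 a2"
abbreviation "Z \<equiv> walls a1 a2"
abbreviation "f \<equiv> wall a1 a2"

lemma def_family_S: "def_family (S i)"
proof -
  have "def_family (\<lambda>x. {y. 0 < a1 (x, y)})" "def_family (\<lambda>x. {y. 0 < 0 - a1 (x, y)})"
    "def_family (\<lambda>x. {y. 0 < a2 (x, y)})" "def_family (\<lambda>x. {y. 0 < 0 - a2 (x, y)})"
    unfolding def_family_def mem_Collect_eq by (intro def_pred_rules def_term_app2[OF a1] def_term_app2[OF a2]; simp)+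
  then show ?thesis unfolding sign_set_def[abs_def]
    by (cases "i = 0"; cases "i = 1"; cases "i = 2") simp_all
qed

lemma finite_Z: "finite (Z x)"
  unfolding walls_def by (intro finite_UN_I def_set_frontier def_set_fibre[OF def_family_S]) simp

lemma def_family_Z: "def_family Z"
  unfolding walls_def[abs_def] by (intro def_family_UN_lessThan def_family_frontier def_family_S)

lemma def_fun_f: "def_fun (f k)"
  unfolding wall_def[abs_def] by (rule def_fun_nth_elem[OF def_family_Z finite_Z])

text \<open>The product of \<open>perp\<close> of the field at \<open>(x, y)\<close> with the
  tangent vector \<open>(1, f' k x)\<close> of the translate of wall \<open>k\<close>. On a leaf
  that is a graph it equals the first component of the field times the derivative of the height over
  the wall.\<close>

definition tangency :: "(nat \<Rightarrow> real \<Rightarrow> real) \<Rightarrow> nat \<Rightarrow> real \<Rightarrow> real \<Rightarrow> real"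
  where "tangency f' k x y = a2 (x, y) - f' k x * a1 (x, y)"

text \<open>\<open>u\<close> is the height above the wall if \<open>s = 1\<close> and the depth
  below it if \<open>s = - 1\<close>; \<open>\<sigma>\<close> is the sign being tested.\<close>

definition side_germ :: "(nat \<Rightarrow> real \<Rightarrow> real) \<Rightarrow> nat \<Rightarrow> real \<Rightarrow> real \<Rightarrow> real \<Rightarrow> real set"
  where "side_germ f' k s \<sigma> x = {u. 0 \<le> \<sigma> * tangency f' k x (f k x + s * u)}"

end

text \<open>An assumption \<open>frontier {x. P x} \<subseteq> F\<close> makes \<open>P\<close>
  constant on every class of \<open>F\<close>, so the properties that a cell should have along its
  base are collected in this form. \<open>fr_gap\<close> asks only for some point of a gap, since
  within one vertical line the sign in a gap is constant anyway. The last assumption is of another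
  kind: it makes the sign next to a wall uniform near every abscissa outside
  \<open>F\<close>.\<close>

locale adapted = tame_coefficients +
  fixes N :: nat and f' :: "nat \<Rightarrow> real \<Rightarrow> real" and F :: "real set"
  assumes card_le: "\<And>x. card (Z x) \<le> N" and finF: "finite F"
    and C1: "\<And>k x. k < N \<Longrightarrow> x \<notin> F \<Longrightarrow> (f k has_real_derivative f' k x) (at x) \<and> isCont (f' k) x"
    and fr_card: "\<And>n. n \<le> N \<Longrightarrow> frontier {x. card (Z x) = n} \<subseteq> F"
    and fr_gap: "\<And>k i. k \<le> N \<Longrightarrow> i < 4 \<Longrightarrow> frontier {x. \<exists>y. \<not> y \<in> Z x \<and> num_below (Z x) y = k \<and> y \<in> S i x} \<subseteq> F"
    and fr_wall: "\<And>k i. k < N \<Longrightarrow> i < 4 \<Longrightarrow> frontier {x. f k x \<in> S i x} \<subseteq> F"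
    and fr_tan: "\<And>k. k < N \<Longrightarrow> frontier {x. tangency f' k x (f k x) = 0} \<subseteq> F"
    and fr_germ: "\<And>k s \<sigma>. k < N \<Longrightarrow> s \<in> {1, - 1} \<Longrightarrow> \<sigma> \<in> {1, - 1} \<Longrightarrow>
      frontier {x. \<exists>e. 0 < e \<and> (\<forall>h. 0 < h \<and> h < e \<longrightarrow> h \<in> side_germ f' k s \<sigma> x)} \<subseteq> F"
    and germ: "\<And>k s \<sigma> x. k < N \<Longrightarrow> s \<in> {1, - 1} \<Longrightarrow> \<sigma> \<in> {1, - 1} \<Longrightarrow> x \<notin> F \<Longrightarrow>
      \<exists>e>0. \<forall>h. 0 < h \<and> h < e \<longrightarrow> h \<in> side_germ f' k s \<sigma> x \<Longrightarrow>
      \<exists>e>0. \<exists>d>0. \<forall>x' h. \<bar>x' - x\<bar> < d \<and> 0 < h \<and> h < e \<longrightarrow> h \<in> side_germ f' k s \<sigma> x'"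

context tame_coefficients begin

text \<open>All properties of the abscissa that occur are definable, so their frontiers are finite,
  and \<open>uniform_finiteness\<close> leaves only finitely many of them by bounding the number of
  walls. The remaining exceptional points come from \<open>def_fun_C1\<close> and
  \<open>germ_locally_uniform\<close>.\<close>

lemma adapted_exists: "\<exists>N f' F. adapted Def a1 a2 N f' F"
proof -
  obtain N where N: "\<And>x. card (Z x) \<le> N" using uniform_finiteness[OF def_family_Z finite_Z] by blast
  have "\<exists>g G. def_fun g \<and> finite G \<and> (\<forall>x. x \<notin> G \<longrightarrow> (f k has_real_derivative g x) (at x) \<and> isCont g x)" for k
  proof -
    obtain g G where "def_fun g" "finite G" "\<And>x. x \<notin> G \<Longrightarrow> (f k has_real_derivative g x) (at x)"
      "\<And>x. x \<notin> G \<Longrightarrow> isCont g x"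
      by (rule def_fun_C1[OF def_fun_f[of k]]) (rule that)
    then show ?thesis by blast
  qed
  then obtain f' G where f': "\<And>k. def_fun (f' k)" and G: "\<And>k. finite (G k)"
    and der: "\<And>k x. x \<notin> G k \<Longrightarrow> (f k has_real_derivative f' k x) (at x) \<and> isCont (f' k) x"
    by metis
  note dfs = def_term_app[OF f'] def_term_app[OF def_fun_f] def_term_app2[OF a1] def_term_app2[OF a2]
  have A: "def_family (side_germ f' k s \<sigma>)" for k s \<sigma>
    unfolding def_family_def side_germ_def mem_Collect_eq tangency_def by (intro def_pred_rules dfs) simp_all
  define P1 where "P1 n = {x. card (Z x) = n}" for n
  define P2 where "P2 = (\<lambda>(k, i). {x. \<exists>y. \<not> y \<in> Z x \<and> num_below (Z x) y = k \<and> y \<in> S i x})"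
  define P3 where "P3 = (\<lambda>(k, i). {x. f k x \<in> S i x})"
  define P4 where "P4 k = {x. tangency f' k x (f k x) = 0}" for k
  define P5 where "P5 = (\<lambda>(k, s, \<sigma>). {x. \<exists>e. 0 < e \<and> (\<forall>h. 0 < h \<and> h < e \<longrightarrow> h \<in> side_germ f' k s \<sigma> x)})"
  define P6 where "P6 = (\<lambda>(k, s, \<sigma>). {x. (\<exists>e>0. \<forall>h. 0 < h \<and> h < e \<longrightarrow> h \<in> side_germ f' k s \<sigma> x) \<and>
    \<not> (\<exists>e>0. \<exists>d>0. \<forall>x' h. \<bar>x' - x\<bar> < d \<and> 0 < h \<and> h < e \<longrightarrow> h \<in> side_germ f' k s \<sigma> x')})"
  have d1: "def_set (P1 n)" for n unfolding P1_def by (rule def_set_card_eq[OF def_family_Z finite_Z])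
  have d2: "def_set (P2 t)" for t unfolding P2_def
    by (cases t) (simp only: prod.case, intro def_setI def_pred_rules def_pred_mem2[OF def_family_Z] def_pred_mem2[OF def_family_S] def_pred_app2[OF def_pred_rank[OF def_family_Z finite_Z]]; simp)
  have d3: "def_set (P3 t)" for t unfolding P3_def
    by (cases t) (simp only: prod.case, intro def_setI def_pred_mem2[OF def_family_S] dfs def_term_var; simp)
  have d4: "def_set (P4 k)" for k unfolding P4_def tangency_def by (intro def_setI def_pred_rules dfs) simp_all
  have d5: "def_set (P5 t)" for t unfolding P5_def
    by (cases t) (simp only: prod.case, intro def_setI def_pred_rules def_pred_mem2[OF A]; simp)
  have d6: "finite (P6 t)" for t unfolding P6_def
    by (cases t) (simp only: prod.case, rule germ_locally_uniform[OF A])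
  define K where "K = {..<N} \<times> {1, - 1 :: real} \<times> {1, - 1 :: real}"
  define F where "F = (\<Union>k<N. G k) \<union> (\<Union>n\<le>N. frontier (P1 n)) \<union> (\<Union>t\<in>{..N} \<times> {..<4}. frontier (P2 t)) \<union>
    (\<Union>t\<in>{..<N} \<times> {..<4}. frontier (P3 t)) \<union> (\<Union>k<N. frontier (P4 k)) \<union> (\<Union>t\<in>K. frontier (P5 t)) \<union> (\<Union>t\<in>K. P6 t)"
  have F5: "(\<Union>t\<in>K. frontier (P5 t)) \<subseteq> F" and F6: "(\<Union>t\<in>K. P6 t) \<subseteq> F"
    unfolding F_def by (rule le_supI1[OF Un_upper2], rule Un_upper2)
  have "finite K" by (simp add: K_def)
  then have finF: "finite F" unfolding F_def
    using G d6 def_set_frontier[OF d1] def_set_frontier[OF d2] def_set_frontier[OF d3] def_set_frontier[OF d4] def_set_frontier[OF d5]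
    by (intro finite_UnI finite_UN_I) simp_all
  have "adapted Def a1 a2 N f' F"
  proof (rule adapted.intro[OF tame_coefficients_axioms adapted_axioms.intro, OF N finF])
    show "(f k has_real_derivative f' k x) (at x) \<and> isCont (f' k) x" if "k < N" "x \<notin> F" for k x
      by (rule der) (use that in \<open>auto simp: F_def\<close>)
    show "frontier {x. card (Z x) = n} \<subseteq> F" if "n \<le> N" for n
    proof -
      have "frontier (P1 n) \<subseteq> F" using that unfolding F_def by blast
      then show ?thesis unfolding P1_def .
    qed
    show "frontier {x. \<exists>y. \<not> y \<in> Z x \<and> num_below (Z x) y = k \<and> y \<in> S i x} \<subseteq> F" if "k \<le> N" "i < 4" for k i
    proof -
      have "(k, i) \<in> {..N} \<times> {..<4}" using that by simp
      then have "frontier (P2 (k, i)) \<subseteq> F" unfolding F_def by blast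
      then show ?thesis unfolding P2_def prod.case .
    qed
    show "frontier {x. f k x \<in> S i x} \<subseteq> F" if "k < N" "i < 4" for k i
    proof -
      have "(k, i) \<in> {..<N} \<times> {..<4}" using that by simp
      then have "frontier (P3 (k, i)) \<subseteq> F" unfolding F_def by blast
      then show ?thesis unfolding P3_def prod.case .
    qed
    show "frontier {x. tangency f' k x (f k x) = 0} \<subseteq> F" if "k < N" for k
    proof -
      have "frontier (P4 k) \<subseteq> F" using that unfolding F_def by blast
      then show ?thesis unfolding P4_def .
    qed
    show "frontier {x. \<exists>e. 0 < e \<and> (\<forall>h. 0 < h \<and> h < e \<longrightarrow> h \<in> side_germ f' k s \<sigma> x)} \<subseteq> F"
      if "k < N" "s \<in> {1, - 1}" "\<sigma> \<in> {1, - 1}" for k s \<sigma>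
    proof -
      have "(k, s, \<sigma>) \<in> K" unfolding K_def using that by blast
      from order_trans[OF UN_upper[OF this] F5] have "frontier (P5 (k, s, \<sigma>)) \<subseteq> F" .
      then show ?thesis unfolding P5_def prod.case .
    qed
    show "\<exists>e>0. \<exists>d>0. \<forall>x' h. \<bar>x' - x\<bar> < d \<and> 0 < h \<and> h < e \<longrightarrow> h \<in> side_germ f' k s \<sigma> x'"
      if "k < N" "s \<in> {1, - 1}" "\<sigma> \<in> {1, - 1}" "x \<notin> F"
        "\<exists>e>0. \<forall>h. 0 < h \<and> h < e \<longrightarrow> h \<in> side_germ f' k s \<sigma> x" for k s \<sigma> x
    proof -
      have "(k, s, \<sigma>) \<in> K" unfolding K_def using that(1-3) by blast
      from order_trans[OF UN_upper[OF this] F6] have "P6 (k, s, \<sigma>) \<subseteq> F" .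
      then have "x \<notin> P6 (k, s, \<sigma>)" using that(4) by blast
      then show ?thesis using that(5) unfolding P6_def prod.case by blast
    qed
  qed
  then show ?thesis by blast
qed

end

text \<open>A class is a single point or a connected set that misses the frontier.\<close>

lemma line_class_constant:
  assumes F: "finite F" and P: "frontier {x. P x} \<subseteq> F" and x: "x \<in> line_class F x0"
  shows "P x \<longleftrightarrow> P x0"
proof (cases "x0 \<in> F")
  case True
  then show ?thesis using x line_class_point[OF F True] by simp
next
  case False
  note I = line_class_interval[OF F False]
  have "connected (line_class F x0)" using I(2) by (simp add: is_interval_connected_1)
  moreover have "line_class F x0 \<inter> frontier {x. P x} = {}" using I(3) P by blast
  ultimately have "line_class F x0 \<inter> {x. P x} = {} \<or> line_class F x0 - {x. P x} = {}"
    using connected_Int_frontier[of "line_class F x0" "{x. P x}"] by blast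
  then show ?thesis using x I(4) by blast
qed

lemma line_class_eq: "x \<in> line_class F x0 \<Longrightarrow> line_class F x = line_class F x0"
  unfolding line_class_def by auto

lemma line_class_self: "x \<in> line_class F x"
  by (simp add: line_class_def)

section \<open>Cells of the adapted decomposition\<close>

context adapted begin

definition base :: "plane \<Rightarrow> real set" where "base p = line_class F (fst p)"
definition idx :: "plane \<Rightarrow> nat" where "idx p = num_below (Z (fst p)) (snd p)"
definition on_wall :: "plane \<Rightarrow> bool" where "on_wall p \<longleftrightarrow> snd p \<in> Z (fst p)"
text \<open>The cells are the classes of three invariants, so they form a partition by construction;
  that they are graphs and bands is shown afterwards in \<open>cell_wall\<close> and
  \<open>cell_gap\<close>.\<close>

definition cell :: "plane \<Rightarrow> plane set"
  where "cell p = {q. base q = base p \<and> idx q = idx p \<and> on_wall q = on_wall p}"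
definition lower :: "plane \<Rightarrow> real \<Rightarrow> ereal" where "lower p x = gap_lower (Z x) (idx p)"
definition upper :: "plane \<Rightarrow> real \<Rightarrow> ereal" where "upper p x = gap_upper (Z x) (idx p)"

lemma cell_self: "p \<in> cell p" by (simp add: cell_def)

lemma cell_sym: "q \<in> cell p \<longleftrightarrow> p \<in> cell q" by (auto simp: cell_def)

lemma cell_eq: "q \<in> cell p \<Longrightarrow> cell q = cell p" by (auto simp: cell_def)

lemma base_iff: "base q = base p \<longleftrightarrow> fst q \<in> base p"
  unfolding base_def using line_class_eq line_class_self by metis

lemma card_const: "x \<in> base p \<Longrightarrow> card (Z x) = card (Z (fst p))"
  using line_class_constant[OF finF fr_card[OF card_le[of "fst p"]]] unfolding base_def by blast

lemma idx_le: "idx p \<le> card (Z (fst p))"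
  unfolding idx_def by (rule num_below_le_card[OF finite_Z])

lemma idx_less: "on_wall p \<Longrightarrow> idx p < card (Z (fst p))"
  unfolding idx_def on_wall_def by (rule num_below_less_card[OF finite_Z])

lemma cell_wall:
  assumes w: "on_wall p" shows "cell p = {(x, f (idx p) x) | x. x \<in> base p}"
proof (rule set_eqI)
  fix q :: plane
  obtain x y where q: "q = (x, y)" by (cases q)
  have "q \<in> cell p \<longleftrightarrow> x \<in> base p \<and> y \<in> Z x \<and> num_below (Z x) y = idx p"
    using w unfolding cell_def q by (auto simp: base_iff on_wall_def idx_def)
  also have "\<dots> \<longleftrightarrow> x \<in> base p \<and> y = f (idx p) x"
  proof (cases "x \<in> base p")
    case True
    then have "idx p < card (Z x)" using idx_less[OF w] card_const by simp
    then show ?thesis using nth_smallest[OF finite_Z] nth_smallest_eq[OF finite_Z] True unfolding wall_def by blast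
  qed simp
  finally show "q \<in> cell p \<longleftrightarrow> q \<in> {(x, f (idx p) x) | x. x \<in> base p}" unfolding q by blast
qed

lemma cell_wallD:
  assumes "on_wall p" "q \<in> cell p" shows "fst q \<in> base p" "snd q = f (idx p) (fst q)"
proof -
  obtain x where "q = (x, f (idx p) x)" "x \<in> base p" using assms(2) unfolding cell_wall[OF assms(1)] by blast
  then show "fst q \<in> base p" "snd q = f (idx p) (fst q)" by simp_all
qed

lemma cell_gap:
  assumes w: "\<not> on_wall p" shows "cell p = strip (base p) (lower p) (upper p)"
proof (rule set_eqI)
  fix q :: plane
  obtain x y where q: "q = (x, y)" by (cases q)
  have "q \<in> cell p \<longleftrightarrow> x \<in> base p \<and> y \<notin> Z x \<and> num_below (Z x) y = idx p"
    using w unfolding cell_def q by (auto simp: base_iff on_wall_def idx_def)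
  also have "\<dots> \<longleftrightarrow> q \<in> strip (base p) (lower p) (upper p)"
  proof (cases "x \<in> base p")
    case True
    then have "idx p \<le> card (Z x)" using idx_le card_const by simp
    then show ?thesis using gap_iff[OF finite_Z, of "idx p" x y] True by (simp add: q lower_def upper_def)
  qed (simp add: q)
  finally show "q \<in> cell p \<longleftrightarrow> q \<in> strip (base p) (lower p) (upper p)" .
qed

lemma lower_less_upper: "x \<in> base p \<Longrightarrow> lower p x < upper p x"
  unfolding lower_def upper_def using gap_less[OF finite_Z] idx_le card_const by simp

lemma base_cell: "\<exists>d. line_cell d (base p)"
  unfolding base_def by (rule line_class_cell[OF finF])

lemma fst_cell: "fst ` cell p = base p"
proof
  show "fst ` cell p \<subseteq> base p" unfolding cell_def using base_iff by auto
  show "base p \<subseteq> fst ` cell p"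
  proof
    fix x assume x: "x \<in> base p"
    have "\<exists>y. (x, y) \<in> cell p"
    proof (cases "on_wall p")
      case True
      then show ?thesis using cell_wall x by blast
    next
      case False
      then show ?thesis using cell_gap[OF False] x ereal_dense2[OF lower_less_upper[OF x]] by auto
    qed
    then obtain y where "(x, y) \<in> cell p" by blast
    then show "x \<in> fst ` cell p" by (rule image_eqI[rotated]) simp
  qed
qed

text \<open>Over a point of \<open>F\<close> the wall function may fail to be differentiable, while
  \<open>definable_C1\<close> asks for a derivative there; a constant function with the same value
  takes its place. All other bases avoid \<open>F\<close>.\<close>

lemma wall_definable_C1:
  assumes k: "k < N" shows "\<exists>\<phi>. definable_C1 Def (base p) \<phi> \<and> (\<forall>x\<in>base p. \<phi> x = f k x)"
proof (cases "fst p \<in> F")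
  case True
  then have b: "base p = {fst p}" unfolding base_def by (rule line_class_point[OF finF])
  have "definable_on_line Def (base p) (\<lambda>_. f k (fst p))"
    using base_cell def_set_line_cell by (blast intro: definable_on_line_def_fun def_fun_const)
  moreover have "(\<lambda>_. f k (fst p)) C1_differentiable_on base p" by simp
  ultimately show ?thesis unfolding definable_C1_def
    by (intro exI[of _ "\<lambda>_. f k (fst p)"]) (simp add: b)
next
  case False
  then have b: "base p \<inter> F = {}" unfolding base_def by (rule line_class_interval[OF finF])
  have "definable_on_line Def (base p) (f k)"
    using base_cell def_set_line_cell by (blast intro: definable_on_line_def_fun def_fun_f)
  moreover have "f k C1_differentiable_on base p" unfolding C1_differentiable_on_def
  proof (intro exI[of _ "f' k"] conjI ballI)
    show "(f k has_vector_derivative f' k x) (at x)" if "x \<in> base p" for x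
      using C1[OF k] b that unfolding has_real_derivative_iff_has_vector_derivative by blast
    show "continuous_on (base p) (f' k)" using C1[OF k] b continuous_at_imp_continuous_on by blast
  qed
  ultimately show ?thesis unfolding definable_C1_def by blast
qed

lemma lower_bound: "cell_bound Def (base p) (lower p)"
proof (cases "idx p = 0")
  case True
  then show ?thesis by (simp add: cell_bound_def lower_def gap_lower_def)
next
  case False
  then have "idx p - 1 < N" using idx_le[of p] card_le[of "fst p"] by simp
  from wall_definable_C1[OF this] obtain \<phi> where "definable_C1 Def (base p) \<phi>" "\<forall>x\<in>base p. \<phi> x = f (idx p - 1) x"
    by blast
  moreover from this have "\<forall>x\<in>base p. lower p x = ereal (\<phi> x)"
    using False by (simp add: lower_def gap_lower_def wall_def)
  ultimately show ?thesis unfolding cell_bound_def by blast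
qed

text \<open>The number of walls is constant along the base, so it is decided at \<open>fst p\<close>
  whether the gap is the topmost one.\<close>

lemma upper_eq:
  assumes "x \<in> base p"
  shows "upper p x = (if idx p = card (Z (fst p)) then \<infinity> else ereal (f (idx p) x))"
  using card_const[OF assms] by (simp add: upper_def gap_upper_def wall_def)

lemma lower_eq: "lower p x = (if idx p = 0 then - \<infinity> else ereal (f (idx p - 1) x))"
  by (simp add: lower_def gap_lower_def wall_def)

lemma upper_bound: "cell_bound Def (base p) (upper p)"
proof (cases "idx p = card (Z (fst p))")
  case True
  then show ?thesis by (simp add: cell_bound_def upper_eq)
next
  case False
  then have "idx p < N" using idx_le[of p] card_le[of "fst p"] by simp
  from wall_definable_C1[OF this] obtain \<phi> where "definable_C1 Def (base p) \<phi>" "\<forall>x\<in>base p. \<phi> x = f (idx p) x"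
    by blast
  moreover from this have "\<forall>x\<in>base p. upper p x = ereal (\<phi> x)"
    using False by (simp add: upper_eq)
  ultimately show ?thesis unfolding cell_bound_def by blast
qed

lemma plane_cell_cell: "\<exists>d. plane_cell Def d (cell p)"
proof -
  obtain d where d: "line_cell d (base p)" using base_cell by blast
  show ?thesis
  proof (cases "on_wall p")
    case True
    then have "idx p < N" using idx_less[OF True] card_le[of "fst p"] by simp
    from wall_definable_C1[OF this] obtain \<phi> where \<phi>: "definable_C1 Def (base p) \<phi>" "\<forall>x\<in>base p. \<phi> x = f (idx p) x"
      by blast
    have "cell p = {(x, \<phi> x) | x. x \<in> base p}" unfolding cell_wall[OF True] using \<phi>(2) by force
    then show ?thesis using plane_cell.graph[OF d \<phi>(1)] by auto
  next
    case False
    have "plane_cell Def (Suc d) {(x, y) | x y. x \<in> base p \<and> lower p x < ereal y \<and> ereal y < upper p x}"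
      by (rule plane_cell.band[OF d lower_bound upper_bound]) (simp add: lower_less_upper)
    moreover have "cell p = {(x, y) | x y. x \<in> base p \<and> lower p x < ereal y \<and> ereal y < upper p x}"
      unfolding cell_gap[OF False] strip_def by blast
    ultimately show ?thesis by auto
  qed
qed

lemma cells_decomposition: "plane_decomposition Def (range cell)"
proof -
  have sub: "range cell \<subseteq> (\<lambda>(b, k, w). {q. base q = b \<and> idx q = k \<and> on_wall q = w}) ` (range (line_class F) \<times> {..N} \<times> UNIV)"
  proof
    fix C assume "C \<in> range cell"
    then obtain p where "C = cell p" by blast
    moreover have "(base p, idx p, on_wall p) \<in> range (line_class F) \<times> {..N} \<times> UNIV"
      using idx_le[of p] card_le[of "fst p"] by (simp add: base_def)
    ultimately show "C \<in> (\<lambda>(b, k, w). {q. base q = b \<and> idx q = k \<and> on_wall q = w}) ` (range (line_class F) \<times> {..N} \<times> UNIV)"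
      by (intro image_eqI[of _ _ "(base p, idx p, on_wall p)"]) (simp_all add: cell_def)
  qed
  have "finite (range (line_class F))"
    using line_class_decomposition[OF finF] by (simp add: line_decomposition_def)
  then have "finite (range cell)" by (intro finite_subset[OF sub]) simp
  moreover have "partition_on UNIV (range cell)"
  proof (rule partition_onI)
    show "\<Union>(range cell) = UNIV" using cell_self by blast
    show "disjnt C D" if CD: "C \<in> range cell" "D \<in> range cell" "C \<noteq> D" for C D
    proof -
      obtain p q where "C = cell p" "D = cell q" using CD(1,2) by blast
      then show ?thesis using cell_eq CD(3) unfolding disjnt_def by blast
    qed
    show "{} \<notin> range cell" using cell_self by blast
  qed
  moreover have "(`) fst ` range cell = range (line_class F)"
  proof -
    have "(`) fst ` range cell = range base" by (simp add: image_image fst_cell)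
    also have "\<dots> = range (line_class F)"
    proof
      show "range base \<subseteq> range (line_class F)" unfolding base_def by blast
      have "line_class F x = base (x, 0)" for x by (simp add: base_def)
      then show "range (line_class F) \<subseteq> range base" by blast
    qed
    finally show ?thesis .
  qed
  ultimately show ?thesis
    unfolding plane_decomposition_def using plane_cell_cell line_class_decomposition[OF finF] by auto
qed

text \<open>On a wall the sign is a property of the abscissa and constant along the base. In a gap,
  \<open>fr_gap\<close> carries the existence of a point with this sign from the line of
  \<open>p\<close> to the line of \<open>q\<close>; between that point and \<open>q\<close> there is
  no wall, hence no change of sign. The converse follows by symmetry of cells.\<close>

lemma sign_imp:
  assumes q: "q \<in> cell p" and i: "i < 4" and p: "snd p \<in> S i (fst p)"
  shows "snd q \<in> S i (fst q)"
proof (cases "on_wall p")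
  case True
  then have k: "idx p < N" using idx_less[OF True] card_le[of "fst p"] by simp
  note qe = cell_wallD[OF True q] and pe = cell_wallD(2)[OF True cell_self]
  show ?thesis using line_class_constant[OF finF fr_wall[OF k i], of "fst q" "fst p"] qe pe p
    unfolding base_def by simp
next
  case False
  have k: "idx p \<le> N" using idx_le[of p] card_le[of "fst p"] by simp
  have qe: "fst q \<in> base p" "snd q \<notin> Z (fst q)" "num_below (Z (fst q)) (snd q) = idx p"
    using q False base_iff by (auto simp: cell_def on_wall_def idx_def)
  have "\<exists>y. \<not> y \<in> Z (fst p) \<and> num_below (Z (fst p)) y = idx p \<and> y \<in> S i (fst p)"
    using False p by (auto simp: on_wall_def idx_def)
  then have "\<exists>y. \<not> y \<in> Z (fst q) \<and> num_below (Z (fst q)) y = idx p \<and> y \<in> S i (fst q)"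
    using line_class_constant[OF finF fr_gap[OF k i], of "fst q" "fst p"] qe(1) unfolding base_def by simp
  then obtain y where y: "y \<notin> Z (fst q)" "num_below (Z (fst q)) y = idx p" "y \<in> S i (fst q)" by blast
  let ?I = "{min y (snd q)..max y (snd q)}"
  have "Z (fst q) \<inter> ?I = {}"
    using num_below_eq_iff_no_between[OF finite_Z y(1) qe(2)] num_below_eq_iff_no_between[OF finite_Z qe(2) y(1)] y(2) qe(3)
    by (cases "y \<le> snd q") (simp_all add: min_def max_def)
  moreover have "frontier (S i (fst q)) \<subseteq> Z (fst q)" using i unfolding walls_def by blast
  ultimately have "?I \<inter> S i (fst q) = {} \<or> ?I - S i (fst q) = {}"
    using connected_Int_frontier[of ?I "S i (fst q)"] connected_Icc by blast
  moreover have "y \<in> ?I" "snd q \<in> ?I" by auto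
  ultimately show ?thesis using y(3) by blast
qed

lemma sign_iff: "q \<in> cell p \<Longrightarrow> i < 4 \<Longrightarrow> snd q \<in> S i (fst q) \<longleftrightarrow> snd p \<in> S i (fst p)"
  using sign_imp cell_sym by blast

lemma sign_const:
  assumes "q \<in> cell p"
  shows "0 < a1 q \<longleftrightarrow> 0 < a1 p" "a1 q < 0 \<longleftrightarrow> a1 p < 0" "0 < a2 q \<longleftrightarrow> 0 < a2 p" "a2 q < 0 \<longleftrightarrow> a2 p < 0"
  using sign_iff[OF assms, of 0] sign_iff[OF assms, of 1] sign_iff[OF assms, of 2] sign_iff[OF assms, of 3]
  by (simp_all add: sign_set_def)

lemma zero_const:
  assumes "q \<in> cell p" shows "a1 q = 0 \<longleftrightarrow> a1 p = 0" "a2 q = 0 \<longleftrightarrow> a2 p = 0"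
  using sign_const[OF assms] by (metis linorder_neq_iff)+

section \<open>The vector field on the cells\<close>

abbreviation "\<xi> \<equiv> \<lambda>z. (a1 z, a2 z)"

lemma cells_compatible: "compatible (range cell) (sing \<xi>)"
  unfolding compatible_def
proof
  fix C assume "C \<in> range cell"
  then obtain p where C: "C = cell p" by blast
  show "C \<subseteq> sing \<xi> \<or> C \<inter> sing \<xi> = {}"
  proof (cases "p \<in> sing \<xi>")
    case True
    then show ?thesis unfolding C using zero_const[of _ p] by (auto simp: sing_def)
  next
    case False
    then show ?thesis unfolding C using zero_const[of _ p] by (auto simp: sing_def)
  qed
qed

text \<open>The cell is a graph over an interval or a vertical segment. For a graph the product with
  \<open>perp \<xi>\<close> is \<open>tangency\<close>, whose vanishing is constant along the base
  by \<open>fr_tan\<close>. For a segment it is \<open>- a1\<close>, whose vanishing is constant on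
  the cell.\<close>

lemma one_dimensional_cell:
  assumes C: "plane_cell Def 1 (cell p)"
  shows "transverse_cell \<xi> (cell p) \<or> tangent_cell \<xi> (cell p)"
  using C
proof cases
  case (graph B \<phi>)
  have B: "open B" "is_interval B" using graph(2) by (auto elim: line_cell_cases)
  have "fst ` cell p = B" unfolding graph(1) by (auto simp: image_iff)
  then have bB: "base p = B" using fst_cell by simp
  have pF: "fst p \<notin> F"
  proof
    assume "fst p \<in> F"
    then have "base p = {fst p}" unfolding base_def by (rule line_class_point[OF finF])
    then show False using B(1) bB not_open_singleton by metis
  qed
  \<comment> \<open>So far the cell is only known to be some graph. A cell in a gap has two points
    on one vertical line, so this one must lie on a wall.\<close>
  have w: "on_wall p"
  proof (rule ccontr)
    assume nw: "\<not> on_wall p"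
    have x: "fst p \<in> base p" unfolding base_def by (rule line_class_self)
    obtain y1 where y1: "lower p (fst p) < ereal y1" "ereal y1 < upper p (fst p)"
      using ereal_dense2[OF lower_less_upper[OF x]] by blast
    obtain y2 where y2: "ereal y1 < ereal y2" "ereal y2 < upper p (fst p)" using ereal_dense2[OF y1(2)] by blast
    have "lower p (fst p) < ereal y2" using y1(1) y2(1) by (rule less_trans)
    then have "(fst p, y1) \<in> cell p" "(fst p, y2) \<in> cell p"
      unfolding cell_gap[OF nw] using x y1 y2 by simp_all
    then have "y1 = y2" unfolding graph(1) by auto
    then show False using y2(1) by simp
  qed
  let ?k = "idx p"
  have k: "?k < N" using idx_less[OF w] card_le[of "fst p"] by simp
  have bF: "base p \<inter> F = {}" using pF unfolding base_def by (rule line_class_interval[OF finF])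
  have der: "(f ?k has_vector_derivative f' ?k x) (at x)" "isCont (f' ?k) x" if "x \<in> base p" for x
    using C1[OF k] bF that unfolding has_real_derivative_iff_has_vector_derivative by blast+
  have param: "regular_param (base p) (\<lambda>x. (x, f ?k x)) (\<lambda>x. (1, f' ?k x)) (cell p)"
    unfolding regular_param_def
  proof (intro conjI ballI)
    show "open (base p)" "is_interval (base p)" using B bB by simp_all
    show "bij_betw (\<lambda>x. (x, f ?k x)) (base p) (cell p)"
      unfolding cell_wall[OF w] by (auto simp: bij_betw_def inj_on_def)
    show "((\<lambda>x. (x, f ?k x)) has_vector_derivative (1, f' ?k x)) (at x)" if "x \<in> base p" for x
      by (intro has_vector_derivative_Pair der(1)[OF that] has_vector_derivative_id)
    show "(1::real, f' ?k x) \<noteq> 0" for x by (simp add: zero_prod_def)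
    have "continuous_on (base p) (f' ?k)" using der(2) continuous_at_imp_continuous_on by blast
    then show "continuous_on (base p) (\<lambda>x. (1::real, f' ?k x))" by (intro continuous_intros)
  qed
  have prod: "perp \<xi> (x, f ?k x) \<bullet> (1, f' ?k x) = tangency f' ?k x (f ?k x)" for x
    by (simp add: perp_def inner_prod_def tangency_def mult.commute)
  have const: "tangency f' ?k x (f ?k x) = 0 \<longleftrightarrow> tangency f' ?k (fst p) (f ?k (fst p)) = 0" if "x \<in> base p" for x
    using line_class_constant[OF finF fr_tan[OF k]] that unfolding base_def by blast
  show ?thesis
  proof (cases "tangency f' ?k (fst p) (f ?k (fst p)) = 0")
    case True
    then have "\<forall>x\<in>base p. perp \<xi> (x, f ?k x) \<bullet> (1, f' ?k x) = 0" unfolding prod using const by blast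
    then show ?thesis unfolding tangent_cell_def using param by blast
  next
    case False
    then have "\<forall>x\<in>base p. perp \<xi> (x, f ?k x) \<bullet> (1, f' ?k x) \<noteq> 0" unfolding prod using const by blast
    then show ?thesis unfolding transverse_cell_def using param by blast
  qed
next
  case (band d B lo hi)
  then have "line_cell 0 B" by simp
  then obtain r where B: "B = {r}" by (rule line_cell_cases) auto
  let ?I = "{y. lo r < ereal y \<and> ereal y < hi r}"
  have cell: "cell p = (\<lambda>y. (r, y)) ` ?I" unfolding band(2) B by auto
  have cI: "(r, y) \<in> cell p" if "y \<in> ?I" for y using that unfolding cell by blast
  have param: "regular_param ?I (\<lambda>y. (r, y)) (\<lambda>y. (0, 1)) (cell p)"
    unfolding regular_param_def
  proof (intro conjI ballI)
    show "open ?I" by (intro open_Collect_conj open_Collect_less continuous_intros)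
    show "is_interval ?I" using strip_fibre[of r "{r}" lo hi] by simp
    show "bij_betw (\<lambda>y. (r, y)) ?I (cell p)" unfolding cell by (auto simp: bij_betw_def inj_on_def)
    show "((\<lambda>y. (r, y)) has_vector_derivative (0, 1)) (at y)" for y
      by (intro has_vector_derivative_Pair has_vector_derivative_const has_vector_derivative_id)
    show "(0, 1) \<noteq> (0 :: plane)" by (simp add: zero_prod_def)
    show "continuous_on ?I (\<lambda>y. (0::real, 1::real))" by (intro continuous_intros)
  qed
  have prod: "perp \<xi> (r, y) \<bullet> (0, 1) = - a1 (r, y)" for y by (simp add: perp_def inner_prod_def)
  show ?thesis
  proof (cases "a1 p = 0")
    case True
    then have "\<forall>y\<in>?I. perp \<xi> (r, y) \<bullet> (0, 1) = 0" unfolding prod using zero_const(1)[OF cI] by simp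
    then show ?thesis unfolding tangent_cell_def using param by blast
  next
    case False
    then have "\<forall>y\<in>?I. perp \<xi> (r, y) \<bullet> (0, 1) \<noteq> 0" unfolding prod using zero_const(1)[OF cI] by simp
    then show ?thesis unfolding transverse_cell_def using param by blast
  qed
qed

text \<open>On the vertical line of \<open>p\<close> the tangency expression has a settled weak sign
  next to the wall, by \<open>def_set_germ\<close>; this fixes \<open>\<sigma>\<close>. Then
  \<open>fr_germ\<close> transports the sign along the base, and \<open>germ\<close> makes it
  locally uniform.\<close>

lemma wall_boundary_sign:
  assumes k: "k < N" and pF: "fst p \<notin> F" and s: "s \<in> {1, - 1}"
    and G: "\<And>x. x \<in> base p \<Longrightarrow> G x = ereal (f k x)"
  shows "boundary_sign \<xi> (base p) s G"
proof -
  have "def_set {u. 0 \<le> 1 * tangency f' k (fst p) (f k (fst p) + s * u)}"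
    unfolding tangency_def
    by (intro def_setI def_pred_rules def_term_app2[OF a1] def_term_app2[OF a2]) simp_all
  from def_set_germ[OF this] obtain e where e: "e > 0" and
    "(\<forall>h. 0 < h \<and> h < e \<longrightarrow> h \<in> side_germ f' k s 1 (fst p)) \<or> (\<forall>h. 0 < h \<and> h < e \<longrightarrow> h \<notin> side_germ f' k s 1 (fst p))"
    unfolding side_germ_def by blast
  moreover have "h \<notin> side_germ f' k s 1 (fst p) \<Longrightarrow> h \<in> side_germ f' k s (- 1) (fst p)" for h
    by (simp add: side_germ_def)
  ultimately obtain \<sigma> :: real where \<sigma>: "\<sigma> \<in> {1, - 1}" "\<exists>e. 0 < e \<and> (\<forall>h. 0 < h \<and> h < e \<longrightarrow> h \<in> side_germ f' k s \<sigma> (fst p))"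
    by blast
  have germs: "\<exists>e>0. \<exists>d>0. \<forall>x' u. \<bar>x' - x\<bar> < d \<and> 0 < u \<and> u < e \<longrightarrow>
        0 \<le> \<sigma> * (snd (\<xi> (x', f k x' + s * u)) - f' k x' * fst (\<xi> (x', f k x' + s * u)))" if x: "x \<in> base p" for x
  proof -
    have "x \<notin> F" using x pF line_class_interval(3)[OF finF pF] unfolding base_def by blast
    moreover have "\<exists>e. 0 < e \<and> (\<forall>h. 0 < h \<and> h < e \<longrightarrow> h \<in> side_germ f' k s \<sigma> x)"
      using line_class_constant[OF finF fr_germ[OF k s \<sigma>(1)], of x "fst p"] x \<sigma>(2) unfolding base_def by simp
    ultimately have "\<exists>e>0. \<exists>d>0. \<forall>x' h. \<bar>x' - x\<bar> < d \<and> 0 < h \<and> h < e \<longrightarrow> h \<in> side_germ f' k s \<sigma> x'"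
      by (rule germ[OF k s \<sigma>(1)])
    then show ?thesis unfolding side_germ_def tangency_def by simp
  qed
  have der: "(f k has_real_derivative f' k x) (at x)" if "x \<in> base p" for x
    using C1[OF k, of x] line_class_interval(3)[OF finF pF] that unfolding base_def by blast
  show ?thesis unfolding boundary_sign_def
    by (rule disjI2, rule exI[of _ "f k"], rule exI[of _ "f' k"], rule exI[of _ \<sigma>], intro conjI ballI)
      (use \<sigma>(1) G der germs in blast)+
qed

lemma continuous_on_wall: "k < N \<Longrightarrow> fst p \<notin> F \<Longrightarrow> continuous_on (base p) (\<lambda>x. ereal (f k x))"
proof -
  assume k: "k < N" and pF: "fst p \<notin> F"
  have "isCont (f k) x" if "x \<in> base p" for x
    using C1[OF k, of x] line_class_interval(3)[OF finF pF] that DERIV_isCont unfolding base_def by blast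
  then have "continuous_on (base p) (f k)" using continuous_at_imp_continuous_on by blast
  then show ?thesis by (intro continuous_intros)
qed

text \<open>An open cell neither lies on a wall nor is based at a point of \<open>F\<close>. So it
  is a band over an open interval, and its sign properties along the base and next to the walls
  supply the hypotheses of \<open>strip_leaves\<close>.\<close>

lemma open_cell:
  assumes lip: "locally_lipschitz \<xi>" and op: "open (cell p)" and reg: "cell p \<inter> sing \<xi> = {}"
  shows "(\<forall>L\<in>leaves \<xi> (cell p). rolle_leaf \<xi> (cell p) L) \<and>
    strict_linear_order_on (leaves \<xi> (cell p)) (leaf_less \<xi> (cell p))"
proof -
  have pF: "fst p \<notin> F"
  proof
    assume "fst p \<in> F"
    then have "base p = {fst p}" unfolding base_def by (rule line_class_point[OF finF])
    then show False using open_image_fst[OF op] fst_cell not_open_singleton by metis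
  qed
  have w: "\<not> on_wall p"
  proof
    assume w: "on_wall p"
    obtain e where e: "e > 0" "ball p e \<subseteq> cell p" using op cell_self unfolding open_contains_ball by blast
    have "dist p (fst p, snd p + e/2) < e" using e(1) by (simp add: dist_prod_def dist_real_def)
    then have "(fst p, snd p + e/2) \<in> cell p" using e(2) by auto
    then have "snd p + e/2 = f (idx p) (fst p)" using cell_wallD(2)[OF w] by fastforce
    moreover have "snd p = f (idx p) (fst p)" by (rule cell_wallD(2)[OF w cell_self])
    ultimately show False using e(1) by linarith
  qed
  have B: "open (base p)" "is_interval (base p)" using line_class_interval[OF finF pF] by (simp_all add: base_def)
  have lo: "continuous_on (base p) (lower p) \<and> boundary_sign \<xi> (base p) 1 (lower p)"
  proof (cases "idx p = 0")
    case True
    then have "lower p = (\<lambda>x. - \<infinity>)" by (simp add: lower_eq fun_eq_iff)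
    then show ?thesis by (simp add: boundary_sign_def)
  next
    case False
    then have k: "idx p - 1 < N" using idx_le[of p] card_le[of "fst p"] by simp
    have eq: "lower p x = ereal (f (idx p - 1) x)" for x using False by (simp add: lower_eq)
    have "continuous_on (base p) (lower p)"
      by (rule iffD2[OF continuous_on_cong[OF refl eq] continuous_on_wall[OF k pF]])
    moreover have "boundary_sign \<xi> (base p) 1 (lower p)" by (rule wall_boundary_sign[OF k pF _ eq]) simp
    ultimately show ?thesis by (rule conjI)
  qed
  have hi: "continuous_on (base p) (upper p) \<and> boundary_sign \<xi> (base p) (- 1) (upper p)"
  proof (cases "idx p = card (Z (fst p))")
    case True
    then have eq: "\<And>x. x \<in> base p \<Longrightarrow> upper p x = \<infinity>" by (simp add: upper_eq)
    have "continuous_on (base p) (upper p) \<longleftrightarrow> continuous_on (base p) (\<lambda>_. \<infinity> :: ereal)"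
      by (rule continuous_on_cong[OF refl eq])
    moreover have "boundary_sign \<xi> (base p) (- 1) (upper p)"
      unfolding boundary_sign_def by (rule disjI1) (simp add: eq)
    ultimately show ?thesis by simp
  next
    case False
    then have k: "idx p < N" using idx_le[of p] card_le[of "fst p"] by simp
    have eq: "upper p x = ereal (f (idx p) x)" if "x \<in> base p" for x using False that by (simp add: upper_eq)
    have "continuous_on (base p) (upper p)"
      by (rule iffD2[OF continuous_on_cong[OF refl eq] continuous_on_wall[OF k pF]])
    moreover have "boundary_sign \<xi> (base p) (- 1) (upper p)" by (rule wall_boundary_sign[OF k pF _ eq]) simp
    ultimately show ?thesis by (rule conjI)
  qed
  note C = cell_gap[OF w]
  have s1: "(\<forall>z\<in>cell p. 0 < fst (\<xi> z)) \<or> (\<forall>z\<in>cell p. fst (\<xi> z) < 0) \<or> (\<forall>z\<in>cell p. fst (\<xi> z) = 0)"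
    using sign_const(1,2)[of _ p] zero_const(1)[of _ p] by (cases "a1 p" "0::real" rule: linorder_cases) simp_all
  have s2: "(\<forall>z\<in>cell p. 0 < snd (\<xi> z)) \<or> (\<forall>z\<in>cell p. snd (\<xi> z) < 0) \<or> (\<forall>z\<in>cell p. snd (\<xi> z) = 0)"
    using sign_const(3,4)[of _ p] zero_const(2)[of _ p] by (cases "a2 p" "0::real" rule: linorder_cases) simp_all
  show ?thesis
    unfolding C
    by (rule strip_leaves[OF lip B conjunct1[OF lo] conjunct1[OF hi] lower_less_upper reg[unfolded C] s1[unfolded C]
        s2[unfolded C] conjunct2[OF lo] conjunct2[OF hi]])
qed

end

theorem theoremA:
  fixes Def :: "nat \<Rightarrow> real list set set"
    and a1 a2 :: "real \<times> real \<Rightarrow> real"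
    and \<xi> :: "real \<times> real \<Rightarrow> real \<times> real"
  assumes "o_minimal_real_field Def"
    and "\<xi> = (\<lambda>z. (a1 z, a2 z))"
    and "C1_on UNIV a1" and "C1_on UNIV a2"
    and "definable_on_plane Def a1" and "definable_on_plane Def a2"
  shows "\<exists>\<C>. plane_decomposition Def \<C> \<and> compatible \<C> (sing \<xi>) \<and>
    (\<forall>C\<in>\<C>. C \<inter> sing \<xi> = {} \<longrightarrow>
      (plane_cell Def 1 C \<longrightarrow> transverse_cell \<xi> C \<or> tangent_cell \<xi> C) \<and>
      (open C \<longrightarrow> (\<forall>L\<in>leaves \<xi> C. rolle_leaf \<xi> C L)) \<and>
      (open C \<longrightarrow> strict_linear_order_on (leaves \<xi> C) (leaf_less \<xi> C)))"
proof -
  interpret o_minimal_real_field Def by (rule assms(1))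
  interpret tame_coefficients Def a1 a2
    by unfold_locales (rule def_fun2_plane[OF assms(5)] def_fun2_plane[OF assms(6)])+
  obtain N f' F where "adapted Def a1 a2 N f' F" using adapted_exists by blast
  then interpret adapted Def a1 a2 N f' F .
  have lip: "locally_lipschitz (\<lambda>z. (a1 z, a2 z))"
    by (intro locally_lipschitz_Pair locally_lipschitz_C1 assms)
  show ?thesis unfolding assms(2)
    by (rule exI[of _ "range cell"])
      (use cells_decomposition cells_compatible one_dimensional_cell open_cell[OF lip] in auto)
qed

end
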